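(* Let $\sigma=\{R_1,\dots,R_p\}$ be a finite signature with $R_i$ of arity $k_i\ge 1$, let $k=\max_ik_i$, and let $\tilde\sigma=\{R\}$ consist of a single symbol of arity $k+p-1$. If the class of problems $\mathrm{MP}^{\tilde\sigma}_\star$ has a dichotomy, then the class $\mathrm{MP}^\sigma_\star$ has a dichotomy.
   Context: Given a poset $(P,\preceq)$ and a signature $\sigma$, a $(P,\sigma)$-structure $\mathbf G$ consists of a finite domain $G$ and, for each $R\in\sigma$ of arity $k$, a map $R^{\mathbf G}\colon G^k\to P$. A homomorphism $h\colon\mathbf G\to\mathbf H$ is a map $h\colon G\to H$ with $R^{\mathbf G}(\mathbf t)\preceq R^{\mathbf H}(h(\mathbf t))$ for all $R\in\sigma$ and tuples $\mathbf t$. Let $P_\star=\{0,1,\star\}$ with $0\preceq\star$, $1\preceq\star$, $0,1$ incomparable; $(P_\star,\sigma)$-structures are called $(\star,\sigma)$-structures. For a $(\star,\sigma)$-structure $\mathbf A$, $\mathrm{MP}^\sigma_\star(\mathbf A)$ is the decision problem: given a $(\star,\sigma)$-structure $\mathbf G$, is there a homomorphism $\mathbf G\to\mathbf A$?; $\mathrm{MP}^\sigma_\star$ is the class of all such problems. A class of decision problems has a dichotomy if every problem in it is either in $\mathrm{P}$ or $\mathrm{NP}$-complete. *)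

theory Defs
  imports Main "HOL-Computational_Algebra.Polynomial"
begin

section \<open>Structures over a poset\<close>

text \<open>
  A signature is the list of the arities of its relation symbols; the symbol
  \<open>R\<^sub>i\<close> is represented by its (0-based) position \<open>i\<close>.
  Tuples are lists. In a structure, the values of \<open>interp G i t\<close> for \<open>i\<close> outside the
  signature or for \<open>t\<close> not a tuple over the domain of the right arity are
  irrelevant and never inspected below.
\<close>

type_synonym signature = "nat list"

record ('a, 'p) struct =
  universe :: "'a set"
  interp :: "nat \<Rightarrow> 'a list \<Rightarrow> 'p"

definition tuples :: "'a set \<Rightarrow> nat \<Rightarrow> 'a list set" where
  "tuples D k = {t. length t = k \<and> set t \<subseteq> D}"

definition homomorphism ::
  "signature \<Rightarrow> ('a \<Rightarrow> 'b) \<Rightarrow> ('a, 'p::order) struct \<Rightarrow> ('b, 'p) struct \<Rightarrow> bool" where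
  "homomorphism \<sigma> h G H \<longleftrightarrow>
     h ` universe G \<subseteq> universe H \<and>
     (\<forall>i < length \<sigma>. \<forall>t \<in> tuples (universe G) (\<sigma> ! i).
        interp G i t \<le> interp H i (map h t))"

datatype pstar = Zero | One | Star

instantiation pstar :: order
begin

definition less_eq_pstar :: "pstar \<Rightarrow> pstar \<Rightarrow> bool" where
  "x \<le> y \<longleftrightarrow> x = y \<or> y = Star"

definition less_pstar :: "pstar \<Rightarrow> pstar \<Rightarrow> bool" where
  "x < y \<longleftrightarrow> x \<noteq> y \<and> y = Star"

instance
  by standard (auto simp: less_eq_pstar_def less_pstar_def)

end


section \<open>Polynomial time, nondeterministic polynomial time, NP-completeness\<close>

text \<open>
  Multi-tape Turing machines with two-way infinite tapes. A machine is given by its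
  number of tapes and a \<^emph>\<open>finite\<close> set of instructions \<open>(q, rs, q', as)\<close>: in state \<open>q\<close>,
  reading the symbols \<open>rs\<close>, the machine may enter state \<open>q'\<close> and perform on each
  tape the given write-and-move action. States and tape symbols are natural numbers;
  as the instruction set is finite, only finitely many of them are used.
  The initial state is 0, the accepting state is 1, the blank symbol is 0, and a
  machine halts when no instruction applies.
\<close>

datatype move = MoveLeft | Stay | MoveRight

type_synonym instruction = "nat \<times> nat list \<times> nat \<times> (nat \<times> move) list"

record tm =
  num_tapes :: nat
  instrs :: "instruction set"

type_synonym tape = "(int \<Rightarrow> nat) \<times> int"  \<comment> \<open>contents and head position\<close>
type_synonym config = "nat \<times> tape list"

definition turing_machine :: "tm \<Rightarrow> bool" where
  "turing_machine M \<longleftrightarrow>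
     num_tapes M \<ge> 1 \<and> finite (instrs M) \<and>
     (\<forall>(q, rs, q', as) \<in> instrs M. length rs = num_tapes M \<and> length as = num_tapes M)"

definition deterministic :: "tm \<Rightarrow> bool" where
  "deterministic M \<longleftrightarrow> inj_on (\<lambda>(q, rs, q', as). (q, rs)) (instrs M)"

fun read_tape :: "tape \<Rightarrow> nat" where
  "read_tape (f, i) = f i"

fun offset :: "move \<Rightarrow> int" where
  "offset MoveLeft = -1"
| "offset Stay = 0"
| "offset MoveRight = 1"

fun act :: "nat \<times> move \<Rightarrow> tape \<Rightarrow> tape" where
  "act (s, m) (f, i) = (f(i := s), i + offset m)"

definition tm_step :: "tm \<Rightarrow> config \<Rightarrow> config \<Rightarrow> bool" where
  "tm_step M c c' \<longleftrightarrow>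
     (\<exists>(q, rs, q', as) \<in> instrs M.
        fst c = q \<and> map read_tape (snd c) = rs \<and> c' = (q', map2 act as (snd c)))"

definition halted :: "tm \<Rightarrow> config \<Rightarrow> bool" where
  "halted M c \<longleftrightarrow> (\<nexists>c'. tm_step M c c')"

definition word_tape :: "bool list \<Rightarrow> tape" where
  "word_tape x =
     (\<lambda>i. if 0 \<le> i \<and> i < int (length x) then (if x ! nat i then 2 else 1) else 0, 0)"

definition init_config :: "tm \<Rightarrow> bool list \<Rightarrow> config" where
  "init_config M x = (0, word_tape x # replicate (num_tapes M - 1) (word_tape []))"

definition poly_time :: "tm \<Rightarrow> bool" where
  "poly_time M \<longleftrightarrow>
     (\<exists>p :: nat poly. \<forall>x t c. (tm_step M ^^ t) (init_config M x) c \<longrightarrow> t \<le> poly p (length x))"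

definition accepts :: "tm \<Rightarrow> bool list \<Rightarrow> bool" where
  "accepts M x \<longleftrightarrow>
     (\<exists>c. (tm_step M)\<^sup>*\<^sup>* (init_config M x) c \<and> halted M c \<and> fst c = 1)"

text \<open>The output of a machine computing a function replaces the input on the first tape.\<close>

definition computes :: "tm \<Rightarrow> (bool list \<Rightarrow> bool list) \<Rightarrow> bool" where
  "computes M f \<longleftrightarrow>
     (\<forall>x. \<exists>c. (tm_step M)\<^sup>*\<^sup>* (init_config M x) c \<and> halted M c \<and> hd (snd c) = word_tape (f x))"

type_synonym language = "bool list set"

definition class_P :: "language set" where
  "class_P = {L. \<exists>M. turing_machine M \<and> deterministic M \<and> poly_time M \<and> L = {x. accepts M x}}"

definition class_NP :: "language set" where
  "class_NP = {L. \<exists>M. turing_machine M \<and> poly_time M \<and> L = {x. accepts M x}}"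

definition poly_time_computable :: "(bool list \<Rightarrow> bool list) \<Rightarrow> bool" where
  "poly_time_computable f \<longleftrightarrow>
     (\<exists>M. turing_machine M \<and> deterministic M \<and> poly_time M \<and> computes M f)"

definition poly_reducible :: "language \<Rightarrow> language \<Rightarrow> bool" where
  "poly_reducible L L' \<longleftrightarrow> (\<exists>f. poly_time_computable f \<and> (\<forall>x. x \<in> L \<longleftrightarrow> f x \<in> L'))"

definition NP_complete :: "language \<Rightarrow> bool" where
  "NP_complete L \<longleftrightarrow> L \<in> class_NP \<and> (\<forall>L' \<in> class_NP. poly_reducible L' L)"

definition has_dichotomy :: "language set \<Rightarrow> bool" where
  "has_dichotomy C \<longleftrightarrow> (\<forall>L \<in> C. L \<in> class_P \<or> NP_complete L)"


section \<open>The problems MP\<close>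

text \<open>
  An instance with domain \<open>{0, \<dots>, n - 1}\<close> is encoded by \<open>n\<close> in unary, followed by
  the tables of all its relations, the tuples being listed in lexicographic order.
\<close>

fun encode_value :: "pstar \<Rightarrow> bool list" where
  "encode_value Zero = [False, False]"
| "encode_value One = [False, True]"
| "encode_value Star = [True, True]"

definition encode :: "signature \<Rightarrow> nat \<Rightarrow> (nat, pstar) struct \<Rightarrow> bool list" where
  "encode \<sigma> n G =
     replicate n True @ [False] @
     concat (map (\<lambda>i. concat (map (\<lambda>t. encode_value (interp G i t))
                                 (product_lists (replicate (\<sigma> ! i) [0..<n]))))
                 [0..<length \<sigma>])"

definition MP :: "signature \<Rightarrow> (nat, pstar) struct \<Rightarrow> language" where
  "MP \<sigma> A = {encode \<sigma> n G | n G. universe G = {..<n} \<and> (\<exists>h. homomorphism \<sigma> h G A)}"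

text \<open>
  Up to isomorphism, which does not affect the problem, every finite template
  has a domain consisting of natural numbers.
\<close>

definition MP_class :: "signature \<Rightarrow> language set" where
  "MP_class \<sigma> = {MP \<sigma> A | A. finite (universe A)}"

end

theory Submission
  imports Defs "HOL-Library.Countable"
begin

text \<open>A single symbol of the original signature is no different from \<open>\<sigma>\<close> itself, so let there be
  \<open>p \<ge> 2\<close> symbols. Add a new element \<open>c\<close> to the template and store the value of \<open>R\<^sub>i\<close> at \<open>t\<close> as the
  value of \<open>R\<close> at \<open>c\<^sup>i t c\<^sup>j\<close>, where \<open>i < p\<close> and \<open>j\<close> fills up the arity; let \<open>R\<close> be \<open>One\<close> at
  \<open>(c, \<dots>, c)\<close> and \<open>Zero\<close> at all remaining tuples. Constant tuples then tell \<open>c\<close> from the old elements,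
  so homomorphisms preserve the positions of \<open>c\<close> in a tuple, hence the decoding. The same construction
  reduces the original problem to the new one. Conversely, in an instance over \<open>R\<close> the elements
  whose constant tuple has value \<open>One\<close> play the role of \<open>c\<close>; they are removed, and \<open>R\<^sub>i\<close> gets at \<open>t\<close>
  the join of the values of \<open>R\<close> over all ways to fill in such elements.

  Both reductions only loop over the domain and test first-order conditions, and any such
  transduction runs in polynomial time on a Turing machine with one unary tape per variable.\<close>

section \<open>Sequential composition of Turing machines\<close>

text \<open>The arity \<open>K = k + p - 1\<close> leaves room for a block of length up to k at
  every starting position i <= p - 1. For p >= 2 it also exceeds every arity, so a coded tuple
  contains both c and an old element, and constant tuples are never coded. At uncoded tuples the
  template takes only the values \<open>Zero\<close> and \<open>One\<close>, which are minimal: an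
  instance that maps to it must have exactly the same value there, and any disagreement makes it a
  no-instance.

  At coded tuples several elements of an instance may be sent to c, so several values are imposed on
  one tuple over the old elements. They all lie below x iff their join does, which makes the join
  the right value for the collapsed instance. The join presupposes some element in the role of c; an
  instance without one is either refused or maps to any single old element, which requires a
  nonempty template. For the empty template the two languages simply coincide.

  Both reductions are needed: the one to the single symbol transfers membership in P and NP, the one
  back transfers hardness.\<close>

definition tm_symbols :: "tm \<Rightarrow> nat set" where
  "tm_symbols M = {0, 1, 2} \<union> (\<Union>(q, rs, q', as) \<in> instrs M. fst ` set as)"

definition tm_states :: "tm \<Rightarrow> nat set" where
  "tm_states M = insert 0 ((\<lambda>(q, rs, q', as). q') ` instrs M)"

definition config_ok :: "tm \<Rightarrow> config \<Rightarrow> bool" where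
  "config_ok M c \<longleftrightarrow> fst c \<in> tm_states M \<and> length (snd c) = num_tapes M \<and>
     (\<forall>(f, i) \<in> set (snd c). range f \<subseteq> tm_symbols M)"

text \<open>Finiteness of the symbols and states that a run can produce lets the composed machine
  list a switch instruction for every readable situation in which the first machine halts.\<close>

lemma finite_tm_symbols: "turing_machine M \<Longrightarrow> finite (tm_symbols M)"
  unfolding tm_symbols_def turing_machine_def by auto

lemma finite_tm_states: "turing_machine M \<Longrightarrow> finite (tm_states M)"
  unfolding tm_states_def turing_machine_def by auto

lemma range_word_tape: "word_tape x = (f, i) \<Longrightarrow> range f \<subseteq> {0, 1, 2}"
  by (auto simp: word_tape_def split: if_splits)

lemma config_ok_init: "turing_machine M \<Longrightarrow> config_ok M (init_config M x)"
proof -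
  assume M: "turing_machine M"
  have "range f \<subseteq> tm_symbols M" if "(f, i) \<in> set (snd (init_config M x))" for f i
  proof -
    from that obtain w where "(f, i) = word_tape w"
      by (auto simp: init_config_def)
    then have "range f \<subseteq> {0, 1, 2}" by (metis range_word_tape)
    then show ?thesis by (auto simp: tm_symbols_def)
  qed
  then have "\<forall>(f, i) \<in> set (snd (init_config M x)). range f \<subseteq> tm_symbols M" by blast
  then show ?thesis
    using M by (simp add: config_ok_def init_config_def tm_states_def turing_machine_def)
qed

lemma tm_step_length:
  assumes "turing_machine M" "tm_step M c c'" "length (snd c) = num_tapes M"
  shows "length (snd c') = num_tapes M"
  using assms by (auto simp: tm_step_def turing_machine_def)

lemma config_ok_step:
  assumes M: "turing_machine M" and st: "tm_step M c c'" and ok: "config_ok M c"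
  shows "config_ok M c'"
proof -
  obtain q rs q' as where i: "(q, rs, q', as) \<in> instrs M" and c': "c' = (q', map2 act as (snd c))"
    using st by (auto simp: tm_step_def)
  have "range f \<subseteq> tm_symbols M" if "(f, j) \<in> set (snd c')" for f j
  proof -
    have "(f, j) \<in> (\<lambda>(a, t). act a t) ` set (zip as (snd c))"
      using that by (simp add: c')
    then obtain a t where at: "(a, t) \<in> set (zip as (snd c))" "(f, j) = act a t"
      by (auto simp: eq_commute)
    obtain s m g k where [simp]: "a = (s, m)" "t = (g, k)" by (cases a; cases t)
    have "s \<in> tm_symbols M"
      using at(1) i by (force simp: tm_symbols_def dest: set_zip_leftD)
    moreover have "range g \<subseteq> tm_symbols M"
      using at(1) ok by (fastforce simp: config_ok_def dest!: set_zip_rightD)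
    ultimately show ?thesis using at(2) by auto
  qed
  then have "\<forall>(f, j) \<in> set (snd c'). range f \<subseteq> tm_symbols M" by blast
  moreover have "q' \<in> tm_states M"
    using i by (force simp: tm_states_def)
  then have "fst c' \<in> tm_states M" by (simp add: c')
  ultimately show ?thesis
    using tm_step_length[OF M st] ok unfolding config_ok_def by blast
qed

lemma config_ok_run:
  assumes "turing_machine M" "(tm_step M ^^ t) c c'" "config_ok M c"
  shows "config_ok M c'"
  using assms(2) by (induction t arbitrary: c') (use assms config_ok_step in auto)

lemma config_ok_reads:
  assumes "config_ok M c"
  shows "set (map read_tape (snd c)) \<subseteq> tm_symbols M"
  using assms by (fastforce simp: config_ok_def)

lemma deterministic_unique:
  assumes "deterministic M" "(q, rs, q1, as1) \<in> instrs M" "(q, rs, q2, as2) \<in> instrs M"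
  shows "q1 = q2 \<and> as1 = as2"
  using inj_onD[OF assms(1)[unfolded deterministic_def] _ assms(2,3)] by simp

lemma tm_step_functional:
  assumes "deterministic M" "tm_step M c d" "tm_step M c d'"
  shows "d = d'"
proof -
  from assms(2,3) obtain q rs q1 as1 q2 as2 where
    "(q, rs, q1, as1) \<in> instrs M" "d = (q1, map2 act as1 (snd c))"
    "(q, rs, q2, as2) \<in> instrs M" "d' = (q2, map2 act as2 (snd c))"
    by (auto simp: tm_step_def)
  with deterministic_unique[OF assms(1)] show ?thesis
    by blast
qed

text \<open>Steps are unique and a halted configuration has no successor, so every run from
  \<open>a\<close> is an initial segment of the halting one.\<close>

lemma deterministic_run_to_halt:
  assumes "deterministic M" "(tm_step M ^^ t) a c" "halted M c" "(tm_step M ^^ s) a d"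
  shows "s \<le> t \<and> (tm_step M ^^ (t - s)) d c"
  using assms(4)
proof (induction s arbitrary: d)
  case 0
  then show ?case using assms(2) by simp
next
  case (Suc s)
  then obtain e where e: "(tm_step M ^^ s) a e" "tm_step M e d" by auto
  from Suc.IH[OF e(1)] have le: "s \<le> t" and run: "(tm_step M ^^ (t - s)) e c" by auto
  have "t \<noteq> s"
  proof
    assume "t = s"
    with run have "e = c" by simp
    with e(2) assms(3) show False unfolding halted_def by blast
  qed
  with le obtain u where u: "t - s = Suc u" "t - Suc s = u" "Suc s \<le> t"
    by (metis Suc_diff_Suc Suc_leI le_neq_implies_less)
  then obtain d' where "tm_step M e d'" "(tm_step M ^^ u) d' c"
    using run by (metis relpowp_Suc_D2)
  with tm_step_functional[OF assms(1) e(2)] u show ?case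
    by simp
qed

text \<open>The head moves right by at most one cell per step, so after t steps all cells from
  position |x| + t on are still blank. This bounds the input of the second machine in a
  composition.\<close>

lemma output_length_le:
  assumes M: "turing_machine M" and run: "(tm_step M ^^ t) (init_config M x) c"
    and out: "hd (snd c) = word_tape y"
  shows "length y \<le> length x + t"
proof -
  have inv: "\<exists>f i ts. snd c = (f, i) # ts \<and> i \<le> int t \<and> length ts = num_tapes M - 1 \<and>
      (\<forall>j \<ge> int (length x + t). f j = 0)"
    using run
  proof (induction t arbitrary: c)
    case 0
    then show ?case by (auto simp: init_config_def word_tape_def)
  next
    case (Suc t)
    then obtain d where d: "(tm_step M ^^ t) (init_config M x) d" "tm_step M d c" by auto
    obtain f i ts where IH: "snd d = (f, i) # ts" "i \<le> int t" "length ts = num_tapes M - 1"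
        "\<forall>j \<ge> int (length x + t). f j = 0"
      using Suc.IH[OF d(1)] by auto
    obtain q rs q' as where ins: "(q, rs, q', as) \<in> instrs M" "c = (q', map2 act as (snd d))"
      using d(2) by (auto simp: tm_step_def)
    then have "length as = num_tapes M" "num_tapes M \<ge> 1"
      using M by (auto simp: turing_machine_def)
    then obtain s m as' where as: "as = (s, m) # as'" "length as' = num_tapes M - 1"
      by (cases as) auto
    have "offset m \<le> 1" by (cases m) auto
    with IH as show ?case by (auto simp: ins)
  qed
  then obtain f i ts where c: "snd c = (f, i) # ts" "\<forall>j \<ge> int (length x + t). f j = 0" by auto
  show ?thesis
  proof (rule ccontr)
    assume "\<not> ?thesis"
    then have "f (int (length x + t)) \<noteq> 0"
      using out c(1) by (auto simp: word_tape_def)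
    with c(2) show False by simp
  qed
qed

text \<open>The second machine shares only the first tape with the first one; its other tapes are
  still blank when it is started, and those of the first machine are left untouched.
  The state coding fixes the initial state 0 of \<open>M\<^sub>1\<close> and the accepting state 1 of \<open>M\<^sub>2\<close>.\<close>

definition second_state :: "nat \<Rightarrow> nat" where
  "second_state q = (if q = 0 then 3 else if q = 1 then 1 else 2 * q + 1)"

abbreviation keep :: "nat \<Rightarrow> nat \<times> move" where
  "keep s \<equiv> (s, Stay)"

text \<open>The three groups simulate \<open>M\<^sub>1\<close>, switch where it has no instruction,
  and simulate \<open>M\<^sub>2\<close>. First-phase states are even and second-phase states odd, so
  the groups do not interfere and the accepting state 1 belongs to the second phase only. The
  contents that \<open>M\<^sub>1\<close> leaves on its private tapes are arbitrary, so each
  second-phase instruction is copied for every reading \<open>ys\<close> over its alphabet.\<close>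

definition seq_tm :: "tm \<Rightarrow> tm \<Rightarrow> tm" where
  "seq_tm M\<^sub>1 M\<^sub>2 = (let b = num_tapes M\<^sub>2 - 1 in
     \<lparr>num_tapes = num_tapes M\<^sub>1 + b,
      instrs =
        (\<lambda>(q, rs, q', as). (2 * q, rs @ replicate b 0, 2 * q', as @ replicate b (keep 0))) ` instrs M\<^sub>1
        \<union> (\<lambda>(q, rs). (2 * q, rs @ replicate b 0, second_state 0, map keep (rs @ replicate b 0))) `
            {(q, rs). q \<in> tm_states M\<^sub>1 \<and> (set rs \<subseteq> tm_symbols M\<^sub>1 \<and> length rs = num_tapes M\<^sub>1) \<and>
                      (\<forall>q' as. (q, rs, q', as) \<notin> instrs M\<^sub>1)}
        \<union> (\<lambda>((q, rs, q', as), ys). (second_state q, hd rs # ys @ tl rs,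
                                     second_state q', hd as # map keep ys @ tl as)) `
            (instrs M\<^sub>2 \<times> {ys. set ys \<subseteq> tm_symbols M\<^sub>1 \<and> length ys = num_tapes M\<^sub>1 - 1})\<rparr>)"

lemma second_state_eq_iff [simp]: "second_state q = second_state q' \<longleftrightarrow> q = q'"
  by (auto simp: second_state_def split: if_splits)

lemma odd_second_state: "odd (second_state q)"
  by (simp add: second_state_def)

lemma second_state_neq [simp]: "second_state q \<noteq> 2 * q'" "2 * q' \<noteq> second_state q"
  using odd_second_state[of q] by (metis dvd_triv_left)+

lemma second_state_eq_1 [simp]: "second_state q = 1 \<longleftrightarrow> q = 1"
  by (auto simp: second_state_def)

lemma act_keep [simp]: "act (keep (read_tape t)) t = t"
  by (cases t) simp

lemma map2_act_keep [simp]: "map2 act (map (keep \<circ> read_tape) ts) ts = ts"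
  by (induction ts) auto

lemma read_word_tape_Nil [simp]: "read_tape (word_tape []) = 0"
  by (simp add: word_tape_def)

lemma act_keep_blank [simp]: "act (keep 0) (word_tape []) = word_tape []"
  using act_keep[of "word_tape []"] by simp

locale two_machines =
  fixes M1 M2 :: tm
  assumes M1: "turing_machine M1" and M2: "turing_machine M2" and det1: "deterministic M1"
begin

abbreviation "M \<equiv> seq_tm M1 M2"
abbreviation "b \<equiv> num_tapes M2 - 1"

definition embed1 :: "config \<Rightarrow> config" where
  "embed1 c = (2 * fst c, snd c @ replicate b (word_tape []))"

definition embed2 :: "tape list \<Rightarrow> config \<Rightarrow> config" where
  "embed2 j c = (second_state (fst c), hd (snd c) # j @ tl (snd c))"

lemma tapes1: "num_tapes M1 \<ge> 1" and tapes2: "num_tapes M2 \<ge> 1"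
  using M1 M2 by (auto simp: turing_machine_def)

lemma lengths1: "(q, rs, q', as) \<in> instrs M1 \<Longrightarrow> length rs = num_tapes M1 \<and> length as = num_tapes M1"
  using M1 by (auto simp: turing_machine_def)

lemma lengths2: "(q, rs, q', as) \<in> instrs M2 \<Longrightarrow> length rs = num_tapes M2 \<and> length as = num_tapes M2"
  using M2 by (auto simp: turing_machine_def)

lemma turing_machine_seq: "turing_machine M"
proof -
  have "{(q, rs). q \<in> tm_states M1 \<and> (set rs \<subseteq> tm_symbols M1 \<and> length rs = num_tapes M1) \<and>
                      (\<forall>q' as. (q, rs, q', as) \<notin> instrs M1)}
      \<subseteq> tm_states M1 \<times> {rs. set rs \<subseteq> tm_symbols M1 \<and> length rs = num_tapes M1}"
    by auto
  then have "finite {(q, rs). q \<in> tm_states M1 \<and> (set rs \<subseteq> tm_symbols M1 \<and> length rs = num_tapes M1) \<and>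
                      (\<forall>q' as. (q, rs, q', as) \<notin> instrs M1)}"
    by (rule finite_subset)
      (use M1 in \<open>auto intro!: finite_cartesian_product finite_lists_length_eq
                        simp: finite_tm_symbols finite_tm_states\<close>)
  moreover have "finite {ys. set ys \<subseteq> tm_symbols M1 \<and> length ys = num_tapes M1 - 1}"
    using M1 by (simp add: finite_lists_length_eq finite_tm_symbols)
  moreover have "finite (instrs M1)" "finite (instrs M2)"
    using M1 M2 by (auto simp: turing_machine_def)
  ultimately have "finite (instrs M)"
    by (simp add: seq_tm_def Let_def)
  then show ?thesis
    unfolding turing_machine_def using tapes1 tapes2
    by (auto simp: seq_tm_def Let_def dest!: lengths1 lengths2)
qed

lemma instr_first:
  assumes "(q, rs, q', as) \<in> instrs M1"
  shows "(2 * q, rs @ replicate b 0, 2 * q', as @ replicate b (keep 0)) \<in> instrs M"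
  unfolding seq_tm_def Let_def select_convs
  by (intro UnI1, rule image_eqI[OF _ assms]) simp

lemma instr_switch:
  assumes "q \<in> tm_states M1" "set rs \<subseteq> tm_symbols M1" "length rs = num_tapes M1"
    "\<And>q' as. (q, rs, q', as) \<notin> instrs M1"
  shows "(2 * q, rs @ replicate b 0, second_state 0, map keep (rs @ replicate b 0)) \<in> instrs M"
  unfolding seq_tm_def Let_def select_convs
  by (rule UnI1, rule UnI2, rule image_eqI[where x = "(q, rs)"]) (use assms in auto)

lemma instr_second:
  assumes "(q, rs, q', as) \<in> instrs M2" "set ys \<subseteq> tm_symbols M1" "length ys = num_tapes M1 - 1"
  shows "(second_state q, hd rs # ys @ tl rs, second_state q', hd as # map keep ys @ tl as) \<in> instrs M"
  unfolding seq_tm_def Let_def select_convs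
  by (rule UnI2, rule image_eqI[where x = "((q, rs, q', as), ys)"]) (use assms in auto)

lemma instr_cases [consumes 1, case_names first switch second]:
  assumes "(u, ss, v, acts) \<in> instrs M"
  obtains q rs q' as where "(q, rs, q', as) \<in> instrs M1" "u = 2 * q" "ss = rs @ replicate b 0"
      "v = 2 * q'" "acts = as @ replicate b (keep 0)"
  | q rs where "\<And>q' as. (q, rs, q', as) \<notin> instrs M1" "u = 2 * q" "ss = rs @ replicate b 0"
      "v = second_state 0" "acts = map keep (rs @ replicate b 0)"
  | q rs q' as ys where "(q, rs, q', as) \<in> instrs M2" "u = second_state q" "ss = hd rs # ys @ tl rs"
      "v = second_state q'" "acts = hd as # map keep ys @ tl as" "length ys = num_tapes M1 - 1"
  using assms unfolding seq_tm_def Let_def select_convs Un_iff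
  by (elim disjE imageE) (auto split: prod.splits)

lemma tm_stepE:
  assumes "tm_step N c d"
  obtains q as where "(fst c, map read_tape (snd c), q, as) \<in> instrs N" "d = (q, map2 act as (snd c))"
  using assms by (auto simp: tm_step_def)

lemma tm_stepI:
  assumes "(fst c, map read_tape (snd c), q, as) \<in> instrs N" "d = (q, map2 act as (snd c))"
  shows "tm_step N c d"
  using assms by (force simp: tm_step_def)

lemma deterministic_seq:
  assumes "deterministic M2"
  shows "deterministic M"
proof -
  have d1: "q' = q'' \<and> as = as'" if "(q, rs, q', as) \<in> instrs M1" "(q, rs, q'', as') \<in> instrs M1"
    for q rs q' q'' as as'
    using deterministic_unique[OF det1] that by blast
  have d2: "q' = q'' \<and> as = as'" if "(q, rs, q', as) \<in> instrs M2" "(q, rs', q'', as') \<in> instrs M2"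
      "hd rs # ys @ tl rs = hd rs' # ys' @ tl rs'" "length ys = length ys'" for q rs rs' q' q'' as as' ys ys'
  proof -
    have "rs \<noteq> []" "rs' \<noteq> []" using lengths2[OF that(1)] lengths2[OF that(2)] tapes2 by auto
    then have "rs = rs'" using that(3,4) by (metis append_eq_append_conv list.inject list.collapse)
    with that show ?thesis using deterministic_unique[OF assms] by blast
  qed
  have "q1 = q2 \<and> as1 = as2" if "(q, rs, q1, as1) \<in> instrs M" "(q, rs, q2, as2) \<in> instrs M"
    for q rs q1 q2 as1 as2
    using that(1)
  proof (cases rule: instr_cases)
    case (first p r p' as)
    from that(2) show ?thesis
      by (cases rule: instr_cases) (use first in \<open>auto dest: d1\<close>)
  next
    case (switch p r)
    from that(2) show ?thesis
      by (cases rule: instr_cases) (use switch in auto)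
  next
    case (second p r p' as ys)
    note second1 = this
    from that(2) show ?thesis
    proof (cases rule: instr_cases)
      case (second p2 r2 p2' as2 ys2)
      note second2 = this
      have "p = p2" using second2(2) \<open>q = second_state p\<close> by simp
      with d2[of p r p' as r2 p2' as2 ys ys2] second2 second1 show ?thesis by auto
    qed (use second in auto)
  qed
  then show ?thesis
    unfolding deterministic_def by (intro inj_onI) auto
qed

text \<open>Switch instructions exist only for symbols and states that \<open>M1\<close> can
  produce, hence the hypothesis \<open>config_ok\<close>. They fire exactly where \<open>M1\<close>
  halts, so the first phase never gets stuck.\<close>

lemma step_embed1:
  assumes ok: "config_ok M1 c"
  shows "tm_step M (embed1 c) d \<longleftrightarrow>
    (\<exists>c'. tm_step M1 c c' \<and> d = embed1 c') \<or>
    (halted M1 c \<and> d = (second_state 0, snd c @ replicate b (word_tape [])))"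
    (is "?L \<longleftrightarrow> ?R")
proof -
  have len: "length (snd c) = num_tapes M1" and st: "fst c \<in> tm_states M1"
    using ok by (auto simp: config_ok_def)
  note reads = config_ok_reads[OF ok]
  show ?thesis
  proof
    assume ?L
    then consider
      (1) q rs q' as where "(q, rs, q', as) \<in> instrs M1" "q = fst c"
          "map read_tape (snd c) @ replicate b 0 = rs @ replicate b 0"
          "d = (2 * q', map2 act (as @ replicate b (keep 0)) (snd c @ replicate b (word_tape [])))"
    | (2) q rs where "\<forall>q' as. (q, rs, q', as) \<notin> instrs M1" "q = fst c"
          "map read_tape (snd c) @ replicate b 0 = rs @ replicate b 0"
          "d = (second_state 0, map2 act (map keep (rs @ replicate b 0)) (snd c @ replicate b (word_tape [])))"
      by (elim tm_stepE, elim instr_cases) (auto simp: embed1_def)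
    then show ?R
    proof cases
      case 1
      with len lengths1[OF 1(1)] have "tm_step M1 c (q', map2 act as (snd c))"
        "d = embed1 (q', map2 act as (snd c))"
        by (auto intro: tm_stepI simp: embed1_def)
      then show ?thesis by blast
    next
      case 2
      then have rs: "rs = map read_tape (snd c)" by simp
      then have "halted M1 c"
        using 2(1,2) by (auto simp: halted_def elim: tm_stepE)
      moreover have "d = (second_state 0, snd c @ replicate b (word_tape []))"
        using 2(4) by (simp add: rs)
      ultimately show ?thesis by blast
    qed
  next
    assume ?R
    then show ?L
    proof
      assume "\<exists>c'. tm_step M1 c c' \<and> d = embed1 c'"
      then obtain q rs q' as where i: "(q, rs, q', as) \<in> instrs M1" "q = fst c"
          "rs = map read_tape (snd c)" "d = embed1 (q', map2 act as (snd c))"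
        by (elim exE conjE tm_stepE) auto
      show ?L
        by (rule tm_stepI[of _ "2 * q'" "as @ replicate b (keep 0)"])
          (use i lengths1[OF i(1)] len instr_first[OF i(1)] in \<open>auto simp: embed1_def\<close>)
    next
      assume h: "halted M1 c \<and> d = (second_state 0, snd c @ replicate b (word_tape []))"
      let ?rs = "map read_tape (snd c)"
      have "(fst c, ?rs, q', as) \<notin> instrs M1" for q' as
        using h tm_stepI[of c q' as M1] by (auto simp: halted_def)
      then have "(2 * fst c, ?rs @ replicate b 0, second_state 0, map keep (?rs @ replicate b 0)) \<in> instrs M"
        using st reads len by (intro instr_switch) auto
      then show ?L
        by (intro tm_stepI[of _ "second_state 0" "map keep (?rs @ replicate b 0)"])
          (use h in \<open>auto simp: embed1_def\<close>)
    qed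
  qed
qed

lemma step_embed2:
  assumes j: "length j = num_tapes M1 - 1" "set (map read_tape j) \<subseteq> tm_symbols M1"
    and c: "length (snd c) = num_tapes M2"
  shows "tm_step M (embed2 j c) d \<longleftrightarrow> (\<exists>c'. tm_step M2 c c' \<and> d = embed2 j c')"
    (is "?L \<longleftrightarrow> ?R")
proof -
  obtain t ts where ts: "snd c = t # ts" "length ts = b" using c tapes2 by (cases "snd c") auto
  show ?thesis
  proof
    assume ?L
    then obtain q rs q' as ys where i: "(q, rs, q', as) \<in> instrs M2" "q = fst c"
        "length ys = num_tapes M1 - 1"
        "hd rs # ys @ tl rs = read_tape t # map read_tape j @ map read_tape ts"
        "d = (second_state q', map2 act (hd as # map keep ys @ tl as) (t # j @ ts))"
      by (elim tm_stepE, elim instr_cases) (auto simp: embed2_def ts)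
    have ne: "rs \<noteq> []" "as \<noteq> []" using lengths2[OF i(1)] tapes2 by auto
    have ys: "ys = map read_tape j" and "rs = read_tape t # map read_tape ts"
      using i(3,4) j ne by (cases rs; auto)+
    then have "tm_step M2 c (q', map2 act as (snd c))"
      using i(1,2) by (intro tm_stepI) (auto simp: ts)
    moreover have "d = embed2 j (q', map2 act as (snd c))"
      using ne lengths2[OF i(1)] by (cases as) (auto simp: i embed2_def ts ys)
    ultimately show ?R by blast
  next
    assume ?R
    then obtain q rs q' as where i: "(q, rs, q', as) \<in> instrs M2" "q = fst c"
        "rs = map read_tape (snd c)" "d = embed2 j (q', map2 act as (snd c))"
      by (elim exE conjE tm_stepE) auto
    let ?ys = "map read_tape j"
    have mem: "(second_state q, hd rs # ?ys @ tl rs, second_state q', hd as # map keep ?ys @ tl as) \<in> instrs M"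
      using i(1) j by (intro instr_second) auto
    obtain a as' where as: "as = a # as'" using lengths2[OF i(1)] tapes2 by (cases as) auto
    have "rs = read_tape t # map read_tape ts" using i(3) ts(1) by simp
    then have "(fst (embed2 j c), map read_tape (snd (embed2 j c)), second_state q',
        hd as # map keep ?ys @ tl as) \<in> instrs M"
      using mem i(2) ts(1) unfolding embed2_def by simp
    moreover have "d = (second_state q', map2 act (hd as # map keep ?ys @ tl as) (snd (embed2 j c)))"
      using i(4) ts(1) unfolding embed2_def by (simp add: as)
    ultimately show ?L by (rule tm_stepI)
  qed
qed

context
  fixes x y :: "bool list" and t1 :: nat and c1 :: config
  assumes run1: "(tm_step M1 ^^ t1) (init_config M1 x) c1" and halt1: "halted M1 c1"
    and out1: "hd (snd c1) = word_tape y"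
begin

abbreviation "j \<equiv> tl (snd c1)"

lemma ok1: "config_ok M1 c1"
  using config_ok_run[OF M1 run1 config_ok_init[OF M1]] .

lemma j_ok: "length j = num_tapes M1 - 1" "set (map read_tape j) \<subseteq> tm_symbols M1"
proof -
  show "length j = num_tapes M1 - 1" using ok1 by (auto simp: config_ok_def)
  have "set j \<subseteq> set (snd c1)" by (cases "snd c1") auto
  then show "set (map read_tape j) \<subseteq> tm_symbols M1"
    using config_ok_reads[OF ok1] by (metis image_mono set_map subset_trans)
qed

lemma init_embed: "init_config M x = embed1 (init_config M1 x)"
proof -
  have "num_tapes M - 1 = (num_tapes M1 - 1) + b" using tapes1 by (simp add: seq_tm_def Let_def)
  then show ?thesis unfolding init_config_def embed1_def by (simp only: replicate_add) simp
qed

lemma switch_embed: "(second_state 0, snd c1 @ replicate b (word_tape [])) = embed2 j (init_config M2 y)"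
proof -
  have "snd c1 \<noteq> []" using ok1 tapes1 by (auto simp: config_ok_def)
  then show ?thesis using out1 by (cases "snd c1") (auto simp: embed2_def init_config_def)
qed

lemma length_run2:
  assumes "(tm_step M2 ^^ s) (init_config M2 y) c"
  shows "length (snd c) = num_tapes M2"
  using config_ok_run[OF M2 assms config_ok_init[OF M2]] by (simp add: config_ok_def)

lemma run_embed1:
  assumes "(tm_step M1 ^^ s) (init_config M1 x) c"
  shows "(tm_step M ^^ s) (init_config M x) (embed1 c)"
  using assms
proof (induction s arbitrary: c)
  case 0
  then show ?case by (simp add: init_embed)
next
  case (Suc s)
  then obtain d where d: "(tm_step M1 ^^ s) (init_config M1 x) d" "tm_step M1 d c" by auto
  have "tm_step M (embed1 d) (embed1 c)"
    using d(2) by (subst step_embed1[OF config_ok_run[OF M1 d(1) config_ok_init[OF M1]]]) blast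
  with Suc.IH[OF d(1)] show ?case by auto
qed

lemma run_embed2:
  assumes "(tm_step M2 ^^ s) (init_config M2 y) c"
  shows "(tm_step M ^^ (Suc t1 + s)) (init_config M x) (embed2 j c)"
  using assms
proof (induction s arbitrary: c)
  case 0
  have "tm_step M (embed1 c1) (embed2 j (init_config M2 y))"
    using halt1 switch_embed by (subst step_embed1[OF ok1]) simp
  with run_embed1[OF run1] 0 show ?case by auto
next
  case (Suc s)
  then obtain d where d: "(tm_step M2 ^^ s) (init_config M2 y) d" "tm_step M2 d c" by auto
  have "tm_step M (embed2 j d) (embed2 j c)"
    using d(2) by (subst step_embed2[OF j_ok length_run2[OF d(1)]]) blast
  with Suc.IH[OF d(1)] show ?case by auto
qed

text \<open>\<open>M2\<close> may be nondeterministic, but determinism of \<open>M1\<close> fixes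
  the time \<open>t1\<close> and the configuration of the switch on every run.\<close>

lemma run_seq_cases:
  assumes "(tm_step M ^^ s) (init_config M x) d"
  shows "(s \<le> t1 \<and> (\<exists>c. (tm_step M1 ^^ s) (init_config M1 x) c \<and> d = embed1 c)) \<or>
    (\<exists>s' c. s = Suc t1 + s' \<and> (tm_step M2 ^^ s') (init_config M2 y) c \<and> d = embed2 j c)"
  using assms
proof (induction s arbitrary: d)
  case 0
  then show ?case by (auto simp: init_embed)
next
  case (Suc s)
  then obtain e where e: "(tm_step M ^^ s) (init_config M x) e" "tm_step M e d" by auto
  from Suc.IH[OF e(1)] show ?case
  proof
    assume "s \<le> t1 \<and> (\<exists>c. (tm_step M1 ^^ s) (init_config M1 x) c \<and> e = embed1 c)"
    then obtain c where c: "(tm_step M1 ^^ s) (init_config M1 x) c" "e = embed1 c" by auto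
    have ok: "config_ok M1 c" using config_ok_run[OF M1 c(1) config_ok_init[OF M1]] .
    from e(2)[unfolded c(2) step_embed1[OF ok]] show ?thesis
    proof
      assume "\<exists>c'. tm_step M1 c c' \<and> d = embed1 c'"
      then obtain c' where c': "tm_step M1 c c'" "d = embed1 c'" by auto
      have "(tm_step M1 ^^ Suc s) (init_config M1 x) c'" using c c' by auto
      with deterministic_run_to_halt[OF det1 run1 halt1 this] c' show ?thesis by blast
    next
      assume h: "halted M1 c \<and> d = (second_state 0, snd c @ replicate b (word_tape []))"
      have "s \<le> t1" "(tm_step M1 ^^ (t1 - s)) c c1"
        using deterministic_run_to_halt[OF det1 run1 halt1 c(1)] by auto
      \<comment> \<open>A halted configuration admits no further step, so if it lies on the run to
        \<open>c1\<close> it is \<open>c1\<close> itself.\<close>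
      then have "t1 - s = 0 \<and> c = c1"
        using h by (cases "t1 - s") (auto simp: halted_def dest!: relpowp_Suc_D2 simp del: relpowp.simps(2))
      with \<open>s \<le> t1\<close> have "s = t1" "c = c1" by auto
      then have "d = embed2 j (init_config M2 y)" using h switch_embed by simp
      then show ?thesis using \<open>s = t1\<close> by (intro disjI2 exI[of _ 0]) auto
    qed
  next
    assume "\<exists>s' c. s = Suc t1 + s' \<and> (tm_step M2 ^^ s') (init_config M2 y) c \<and> e = embed2 j c"
    then obtain s' c where c: "s = Suc t1 + s'" "(tm_step M2 ^^ s') (init_config M2 y) c" "e = embed2 j c"
      by auto
    from e(2)[unfolded c(3) step_embed2[OF j_ok length_run2[OF c(2)]]] obtain c' where
      "tm_step M2 c c'" "d = embed2 j c'" by auto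
    then show ?thesis using c by (intro disjI2 exI[of _ "Suc s'"] exI[of _ c']) auto
  qed
qed

lemma halted_embed2:
  assumes "(tm_step M2 ^^ s) (init_config M2 y) c"
  shows "halted M (embed2 j c) \<longleftrightarrow> halted M2 c"
  unfolding halted_def step_embed2[OF j_ok length_run2[OF assms]] by blast

lemma not_halted_embed1:
  assumes "(tm_step M1 ^^ s) (init_config M1 x) c"
  shows "\<not> halted M (embed1 c)"
  unfolding halted_def step_embed1[OF config_ok_run[OF M1 assms config_ok_init[OF M1]]] by blast

lemma accepts_seq: "accepts M x \<longleftrightarrow> accepts M2 y"
proof
  assume "accepts M x"
  then obtain s d where d: "(tm_step M ^^ s) (init_config M x) d" "halted M d" "fst d = 1"
    by (auto simp: accepts_def dest: rtranclp_imp_relpowp)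
  from run_seq_cases[OF d(1)] d(2) not_halted_embed1 obtain s' c where
    c: "(tm_step M2 ^^ s') (init_config M2 y) c" "d = embed2 j c" by blast
  with d have "halted M2 c" "fst c = 1" using halted_embed2[OF c(1)] by (auto simp: embed2_def simp del: One_nat_def)
  with relpowp_imp_rtranclp[OF c(1)] show "accepts M2 y" unfolding accepts_def by blast
next
  assume "accepts M2 y"
  then obtain s d where d: "(tm_step M2 ^^ s) (init_config M2 y) d" "halted M2 d" "fst d = 1"
    by (auto simp: accepts_def dest: rtranclp_imp_relpowp)
  from run_embed2[OF d(1)] have "(tm_step M)\<^sup>*\<^sup>* (init_config M x) (embed2 j d)"
    by (rule relpowp_imp_rtranclp)
  then show "accepts M x"
    using d(3) d(2)[folded halted_embed2[OF d(1)]] unfolding accepts_def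
    by (intro exI[of _ "embed2 j d"]) (auto simp: embed2_def second_state_def)
qed

lemma output_seq:
  assumes "(tm_step M2)\<^sup>*\<^sup>* (init_config M2 y) c" "halted M2 c" "hd (snd c) = word_tape z"
  shows "\<exists>c. (tm_step M)\<^sup>*\<^sup>* (init_config M x) c \<and> halted M c \<and> hd (snd c) = word_tape z"
proof -
  obtain s where s: "(tm_step M2 ^^ s) (init_config M2 y) c"
    using assms(1) by (auto dest: rtranclp_imp_relpowp)
  have "(tm_step M)\<^sup>*\<^sup>* (init_config M x) (embed2 j c)"
    using run_embed2[OF s] by (rule relpowp_imp_rtranclp)
  then show ?thesis
    using assms halted_embed2[OF s] by (intro exI[of _ "embed2 j c"]) (auto simp: embed2_def)
qed

end

end

section \<open>Composition of polynomial-time reductions\<close>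

lemma computes_runE:
  assumes "computes M f"
  obtains t c where "(tm_step M ^^ t) (init_config M x) c" "halted M c" "hd (snd c) = word_tape (f x)"
proof -
  obtain c where "(tm_step M)\<^sup>*\<^sup>* (init_config M x) c" "halted M c" "hd (snd c) = word_tape (f x)"
    using assms unfolding computes_def by blast
  then show ?thesis using that rtranclp_imp_relpowp by metis
qed

lemma poly_nat_mono: "x \<le> y \<Longrightarrow> poly (p :: nat poly) x \<le> poly p y"
  by (induction p) (auto intro!: add_mono mult_mono)

lemma poly_time_seq:
  assumes "turing_machine M1" "deterministic M1" "poly_time M1" "computes M1 f"
    and "turing_machine M2" "poly_time M2"
  shows "poly_time (seq_tm M1 M2)"
proof -
  interpret two_machines M1 M2 by unfold_locales (use assms in auto)
  obtain p1 where p1: "\<And>x t c. (tm_step M1 ^^ t) (init_config M1 x) c \<Longrightarrow> t \<le> poly p1 (length x)"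
    using assms(3) unfolding poly_time_def by blast
  obtain p2 where p2: "\<And>x t c. (tm_step M2 ^^ t) (init_config M2 x) c \<Longrightarrow> t \<le> poly p2 (length x)"
    using assms(6) unfolding poly_time_def by blast
  \<comment> \<open>The summand 1 pays for the switch step, and X + p1 bounds the length of the
    intermediate word.\<close>
  define p where "p = p1 + 1 + pcompose p2 ([:0, 1:] + p1)"
  have "t \<le> poly p (length x)" if t: "(tm_step M ^^ t) (init_config M x) d" for x t d
  proof -
    obtain t1 c1 where t1: "(tm_step M1 ^^ t1) (init_config M1 x) c1"
      and c1: "halted M1 c1" "hd (snd c1) = word_tape (f x)"
      using assms(4) by (rule computes_runE)
    have b1: "t1 \<le> poly p1 (length x)" using p1[OF t1] .
    have len: "length (f x) \<le> length x + poly p1 (length x)"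
      using output_length_le[OF assms(1) t1 c1(2)] b1 by simp
    from run_seq_cases[OF t1 c1 t] show ?thesis
    proof
      assume "t \<le> t1 \<and> (\<exists>c. (tm_step M1 ^^ t) (init_config M1 x) c \<and> d = embed1 c)"
      with b1 show ?thesis by (simp add: p_def)
    next
      assume "\<exists>s' c. t = Suc t1 + s' \<and> (tm_step M2 ^^ s') (init_config M2 (f x)) c \<and> d = embed2 (tl (snd c1)) c"
      then obtain s' c where s': "t = Suc t1 + s'" "(tm_step M2 ^^ s') (init_config M2 (f x)) c" by auto
      have "s' \<le> poly p2 (length x + poly p1 (length x))"
        using p2[OF s'(2)] poly_nat_mono[OF len, of p2] by linarith
      with s' b1 show ?thesis by (simp add: p_def poly_pcompose)
    qed
  qed
  then show ?thesis unfolding poly_time_def by blast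
qed

lemma accepts_seq_tm:
  assumes "turing_machine M1" "deterministic M1" "computes M1 f" "turing_machine M2"
  shows "accepts (seq_tm M1 M2) x \<longleftrightarrow> accepts M2 (f x)"
proof -
  interpret two_machines M1 M2 by unfold_locales (use assms in auto)
  obtain t1 c1 where t1: "(tm_step M1 ^^ t1) (init_config M1 x) c1"
      and c1: "halted M1 c1" "hd (snd c1) = word_tape (f x)"
    using assms(3) by (rule computes_runE)
  show ?thesis using accepts_seq[OF t1 c1] .
qed

lemma computes_seq_tm:
  assumes "turing_machine M1" "deterministic M1" "computes M1 f" "turing_machine M2" "computes M2 g"
  shows "computes (seq_tm M1 M2) (g \<circ> f)"
  unfolding computes_def
proof
  fix x
  interpret two_machines M1 M2 by unfold_locales (use assms in auto)
  obtain t1 c1 where t1: "(tm_step M1 ^^ t1) (init_config M1 x) c1"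
      and c1: "halted M1 c1" "hd (snd c1) = word_tape (f x)"
    using assms(3) by (rule computes_runE)
  obtain c2 where c2: "(tm_step M2)\<^sup>*\<^sup>* (init_config M2 (f x)) c2" "halted M2 c2" "hd (snd c2) = word_tape (g (f x))"
    using assms(5) unfolding computes_def by blast
  show "\<exists>c. (tm_step M)\<^sup>*\<^sup>* (init_config M x) c \<and> halted M c \<and> hd (snd c) = word_tape ((g \<circ> f) x)"
    using output_seq[OF t1 c1 c2] by simp
qed

lemma poly_reducibleE:
  assumes "poly_reducible L L'"
  obtains f M where "turing_machine M" "deterministic M" "poly_time M" "computes M f"
    "\<And>x. x \<in> L \<longleftrightarrow> f x \<in> L'"
  using assms unfolding poly_reducible_def poly_time_computable_def by blast

lemma poly_reducible_P:
  assumes "poly_reducible L L'" "L' \<in> class_P"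
  shows "L \<in> class_P"
proof -
  obtain f M1 where N1: "turing_machine M1" "deterministic M1" "poly_time M1" "computes M1 f"
      and f: "\<And>x. x \<in> L \<longleftrightarrow> f x \<in> L'"
    using assms(1) by (rule poly_reducibleE) blast
  obtain M2 where N2: "turing_machine M2" "deterministic M2" "poly_time M2" "L' = {x. accepts M2 x}"
    using assms(2) by (auto simp: class_P_def)
  interpret two_machines M1 M2 by unfold_locales (use N1 N2 in auto)
  have "L = {x. accepts M x}" using f N2(4) accepts_seq_tm[OF N1(1,2,4) N2(1)] by auto
  then show ?thesis
    unfolding class_P_def
    using turing_machine_seq deterministic_seq[OF N2(2)] poly_time_seq[OF N1 N2(1,3)] by blast
qed

lemma poly_reducible_NP:
  assumes "poly_reducible L L'" "L' \<in> class_NP"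
  shows "L \<in> class_NP"
proof -
  obtain f M1 where N1: "turing_machine M1" "deterministic M1" "poly_time M1" "computes M1 f"
      and f: "\<And>x. x \<in> L \<longleftrightarrow> f x \<in> L'"
    using assms(1) by (rule poly_reducibleE) blast
  obtain M2 where N2: "turing_machine M2" "poly_time M2" "L' = {x. accepts M2 x}"
    using assms(2) by (auto simp: class_NP_def)
  interpret two_machines M1 M2 by unfold_locales (use N1 N2 in auto)
  have "L = {x. accepts M x}" using f N2(3) accepts_seq_tm[OF N1(1,2,4) N2(1)] by auto
  then show ?thesis
    unfolding class_NP_def
    using turing_machine_seq poly_time_seq[OF N1 N2(1,2)] by blast
qed

lemma poly_reducible_trans:
  assumes "poly_reducible L L'" "poly_reducible L' L''"
  shows "poly_reducible L L''"
proof -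
  obtain f M1 where N1: "turing_machine M1" "deterministic M1" "poly_time M1" "computes M1 f"
      and f: "\<And>x. x \<in> L \<longleftrightarrow> f x \<in> L'"
    using assms(1) by (rule poly_reducibleE) blast
  obtain g M2 where N2: "turing_machine M2" "deterministic M2" "poly_time M2" "computes M2 g"
      and g: "\<And>x. x \<in> L' \<longleftrightarrow> g x \<in> L''"
    using assms(2) by (rule poly_reducibleE) blast
  interpret two_machines M1 M2 by unfold_locales (use N1 N2 in auto)
  have "poly_time_computable (g \<circ> f)"
    unfolding poly_time_computable_def
    using turing_machine_seq deterministic_seq[OF N2(2)] poly_time_seq[OF N1 N2(1,3)]
      computes_seq_tm[OF N1(1,2,4) N2(1,4)] by blast
  then show ?thesis
    unfolding poly_reducible_def using f g by (intro exI[of _ "g \<circ> f"]) auto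
qed

text \<open>The reduction from \<open>L\<close> to \<open>L'\<close> gives membership in NP, the one
  from \<open>L'\<close> to \<open>L\<close> gives hardness.\<close>

lemma NP_complete_equivalent:
  assumes "NP_complete L'" "poly_reducible L L'" "poly_reducible L' L"
  shows "NP_complete L"
  using assms poly_reducible_NP poly_reducible_trans unfolding NP_complete_def by blast


section \<open>Structured programs on Turing machine tapes\<close>

datatype prog =
    Nop
  | Wr nat nat
  | Mv nat move
  | Seq prog prog  (infixr \<open>;;\<close> 65)
  | Ife nat "nat list" prog prog
  | Whl nat "nat list" prog  \<comment> \<open>loop \<^emph>\<open>until\<close> the symbol is in the list\<close>

text \<open>Countability provides \<open>to_nat\<close>, which turns lists of programs into the
  natural numbers that machines use as states.\<close>

instance move :: countable
  by countable_datatype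

instance prog :: countable
  by countable_datatype

type_synonym tapes = "nat \<Rightarrow> tape"

abbreviation rd :: "tapes \<Rightarrow> nat \<Rightarrow> nat" where
  "rd T j \<equiv> read_tape (T j)"

text \<open>The counter is exact with respect to the machine: unfolding a sequence and testing a
  condition each cost a step of their own.\<close>

inductive exec :: "prog \<Rightarrow> tapes \<Rightarrow> nat \<Rightarrow> tapes \<Rightarrow> bool" where
  Nop: "exec Nop T 1 T"
| Wr: "exec (Wr j s) T 1 (T(j := ((fst (T j))(snd (T j) := s), snd (T j))))"
| Mv: "exec (Mv j m) T 1 (T(j := (fst (T j), snd (T j) + offset m)))"
| Seq: "exec p T t U \<Longrightarrow> exec q U s V \<Longrightarrow> exec (p ;; q) T (Suc (t + s)) V"
| IfTrue: "rd T j \<in> set ss \<Longrightarrow> exec p T t U \<Longrightarrow> exec (Ife j ss p q) T (Suc t) U"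
| IfFalse: "rd T j \<notin> set ss \<Longrightarrow> exec q T t U \<Longrightarrow> exec (Ife j ss p q) T (Suc t) U"
| WhlStop: "rd T j \<in> set ss \<Longrightarrow> exec (Whl j ss p) T 1 T"
| WhlStep: "rd T j \<notin> set ss \<Longrightarrow> exec p T t U \<Longrightarrow> exec (Whl j ss p) U s V
    \<Longrightarrow> exec (Whl j ss p) T (Suc (t + s)) V"

text \<open>The control state of the machine for a program is the list of programs still to be
  executed; only finitely many such lists arise.\<close>

fun pstep :: "prog list \<Rightarrow> (nat \<Rightarrow> nat) \<Rightarrow> prog list \<times> (nat \<Rightarrow> nat \<times> move)" where
  "pstep [] r = ([], \<lambda>i. (r i, Stay))"
| "pstep (Nop # c) r = (c, \<lambda>i. (r i, Stay))"
| "pstep (Wr j s # c) r = (c, (\<lambda>i. (r i, Stay))(j := (s, Stay)))"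
| "pstep (Mv j m # c) r = (c, (\<lambda>i. (r i, Stay))(j := (r j, m)))"
| "pstep ((p ;; q) # c) r = (p # q # c, \<lambda>i. (r i, Stay))"
| "pstep (Ife j ss p q # c) r = ((if r j \<in> set ss then p else q) # c, \<lambda>i. (r i, Stay))"
| "pstep (Whl j ss p # c) r = ((if r j \<in> set ss then c else p # Whl j ss p # c), \<lambda>i. (r i, Stay))"

definition cstep :: "prog list \<times> tapes \<Rightarrow> prog list \<times> tapes \<Rightarrow> bool" where
  "cstep x y \<longleftrightarrow> fst x \<noteq> [] \<and>
     y = (fst (pstep (fst x) (rd (snd x))), \<lambda>i. act (snd (pstep (fst x) (rd (snd x))) i) (snd x i))"

lemma act_fun_upd:
  "(\<lambda>i. act (((\<lambda>i. (rd T i, Stay))(j := a)) i) (T i)) = T(j := act a (T j))"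
  by (auto simp: fun_eq_iff)

lemma exec_csteps: "exec p T t T' \<Longrightarrow> (cstep ^^ t) (p # c, T) (c, T')"
proof (induction arbitrary: c rule: exec.induct)
  case (Nop T)
  have "cstep (Nop # c, T) (c, T)" by (simp add: cstep_def)
  then show ?case by (simp only: relpowp_1)
next
  case (Wr j s T)
  have "cstep (Wr j s # c, T) (c, T(j := ((fst (T j))(snd (T j) := s), snd (T j))))"
    by (cases "T j") (simp add: cstep_def act_fun_upd del: fun_upd_apply)
  then show ?case by (simp only: relpowp_1)
next
  case (Mv j m T)
  have "cstep (Mv j m # c, T) (c, T(j := (fst (T j), snd (T j) + offset m)))"
    by (cases "T j") (simp add: cstep_def act_fun_upd del: fun_upd_apply)
  then show ?case by (simp only: relpowp_1)
next
  case (Seq p T t U q s V)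
  have "cstep ((p ;; q) # c, T) (p # q # c, T)" by (simp add: cstep_def)
  then show ?case
    using relpowp_trans[OF Seq.IH(1)[of "q # c"] Seq.IH(2)[of c]] by (rule relpowp_Suc_I2)
next
  case (IfTrue T j ss p t U q)
  have "cstep (Ife j ss p q # c, T) (p # c, T)" using IfTrue(1) by (simp add: cstep_def)
  with IfTrue.IH show ?case by (metis relpowp_Suc_I2)
next
  case (IfFalse T j ss q t U p)
  have "cstep (Ife j ss p q # c, T) (q # c, T)" using IfFalse(1) by (simp add: cstep_def)
  with IfFalse.IH show ?case by (metis relpowp_Suc_I2)
next
  case (WhlStop T j ss p)
  then have "cstep (Whl j ss p # c, T) (c, T)" by (simp add: cstep_def)
  then show ?case by (simp only: relpowp_1)
next
  case (WhlStep T j ss p t U s V)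
  have "cstep (Whl j ss p # c, T) (p # Whl j ss p # c, T)" using WhlStep(1) by (simp add: cstep_def)
  then show ?case
    using relpowp_trans[OF WhlStep.IH(1)[of "Whl j ss p # c"] WhlStep.IH(2)[of c]]
    by (rule relpowp_Suc_I2)
qed

text \<open>The alphabet consists of the blank 0, the bits 1 and 2, and the left-end marker 3. A
  fixed bound on symbols and tapes keeps the instruction set finite.\<close>

fun prog_ok :: "nat \<Rightarrow> prog \<Rightarrow> bool" where
  "prog_ok k Nop \<longleftrightarrow> True"
| "prog_ok k (Wr j s) \<longleftrightarrow> j < k \<and> s \<le> 3"
| "prog_ok k (Mv j m) \<longleftrightarrow> j < k"
| "prog_ok k (p ;; q) \<longleftrightarrow> prog_ok k p \<and> prog_ok k q"
| "prog_ok k (Ife j ss p q) \<longleftrightarrow> j < k \<and> prog_ok k p \<and> prog_ok k q"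
| "prog_ok k (Whl j ss p) \<longleftrightarrow> j < k \<and> prog_ok k p"

text \<open>The continuation of a subprogram is determined by its place in the program: inside the
  left part of a sequence the right part is still to come, inside a loop body the loop itself. This
  is why only finitely many control lists arise.\<close>

fun controls :: "prog \<Rightarrow> prog list set" where
  "controls (p ;; q) = insert [p ;; q] ((\<lambda>c. c @ [q]) ` controls p \<union> controls q)"
| "controls (Ife j ss p q) = insert [Ife j ss p q] (controls p \<union> controls q)"
| "controls (Whl j ss p) = {[], [Whl j ss p]} \<union> (\<lambda>c. c @ [Whl j ss p]) ` controls p"
| "controls p = {[], [p]}"

lemma finite_controls: "finite (controls p)"
  by (induction p) auto

lemma self_in_controls: "[p] \<in> controls p"
  by (cases p) auto

lemma Nil_in_controls: "[] \<in> controls p"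
  by (induction p) auto

lemma pstep_append: "c \<noteq> [] \<Longrightarrow> fst (pstep (c @ d) r) = fst (pstep c r) @ d"
  by (cases "(c, r)" rule: pstep.cases) auto

lemma pstep_controls: "c \<in> controls p \<Longrightarrow> c \<noteq> [] \<Longrightarrow> fst (pstep c r) \<in> controls p"
proof (induction p arbitrary: c)
  case (Seq p q)
  then consider "c = [p ;; q]" | d where "c = d @ [q]" "d \<in> controls p" | "c \<in> controls q"
    by auto
  then show ?case
  proof cases
    case 1
    have "[p, q] = [p] @ [q]" by simp
    then show ?thesis using 1 self_in_controls[of p] by (simp del: append.simps)
  next
    case 2
    show ?thesis
    proof (cases "d = []")
      case True
      then have "fst (pstep c r) \<in> controls q"
        using 2 Seq.IH(2)[OF self_in_controls] by simp
      then show ?thesis by simp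
    next
      case False
      then show ?thesis using 2 Seq.IH(1)[OF 2(2)] by (simp add: pstep_append)
    qed
  qed (use Seq in auto)
next
  case (Ife j ss p q)
  then show ?case using self_in_controls[of p] self_in_controls[of q] by auto
next
  case (Whl j ss p)
  then consider "c = [Whl j ss p]" | d where "c = d @ [Whl j ss p]" "d \<in> controls p" "d \<noteq> []"
    by auto
  then show ?case
  proof cases
    case 1
    have "[p, Whl j ss p] = [p] @ [Whl j ss p]" by simp
    then show ?thesis using 1 self_in_controls[of p] by (simp del: append.simps)
  next
    case 2
    then show ?thesis using Whl.IH[OF 2(2,3)] by (simp add: pstep_append)
  qed
qed auto

lemma controls_ok:
  assumes "prog_ok k p" "c \<in> controls p" "q \<in> set c"
  shows "prog_ok k q"
  using assms
proof (induction p arbitrary: c)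
  case (Seq p1 p2)
  then consider "q = p1 ;; p2" | d where "d \<in> controls p1" "q \<in> set d"
    | "q = p2" | d where "d \<in> controls p2" "q \<in> set d"
    by auto
  moreover have "prog_ok k p1" "prog_ok k p2"
    using Seq.prems(1) by simp_all
  ultimately show ?case
    using Seq.prems(1) Seq.IH by cases blast+
next
  case (Ife j ss p1 p2)
  then consider "q = Ife j ss p1 p2" | d where "d \<in> controls p1" "q \<in> set d"
    | d where "d \<in> controls p2" "q \<in> set d"
    by auto
  moreover have "prog_ok k p1" "prog_ok k p2"
    using Ife.prems(1) by simp_all
  ultimately show ?case
    using Ife.prems(1) Ife.IH by cases blast+
next
  case (Whl j ss p)
  then consider "q = Whl j ss p" | d where "d \<in> controls p" "q \<in> set d"
    by auto
  moreover have "prog_ok k p"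
    using Whl.prems(1) by simp_all
  ultimately show ?case
    using Whl.prems(1) Whl.IH by cases blast+
qed auto

text \<open>Programs address a family of tapes indexed by all natural numbers. Those from k on must
  be blank, so that reading them yields the 0 which \<open>prog_tm\<close> assumes for missing
  tapes.\<close>

definition tapes_ok :: "nat \<Rightarrow> tapes \<Rightarrow> bool" where
  "tapes_ok k T \<longleftrightarrow> (\<forall>i \<ge> k. T i = word_tape []) \<and> (\<forall>i j. fst (T i) j \<le> 3)"

lemma tapes_ok_rd: "tapes_ok k T \<Longrightarrow> rd T i \<le> 3"
  by (cases "T i") (metis fst_conv read_tape.simps tapes_ok_def)

lemma tapes_ok_upd:
  assumes "tapes_ok k T" "j < k" "s \<le> 3"
  shows "tapes_ok k (T(j := act (s, m) (T j)))"
proof -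
  obtain f i where "T j = (f, i)" by fastforce
  moreover have "f x \<le> 3" for x using assms(1) \<open>T j = (f, i)\<close> by (metis fst_conv tapes_ok_def)
  ultimately show ?thesis using assms by (auto simp: tapes_ok_def)
qed

lemma tapes_ok_cstep:
  assumes "cstep (c, T) (c', T')" "\<forall>q \<in> set c. prog_ok k q" "tapes_ok k T"
  shows "tapes_ok k T'"
  using assms tapes_ok_rd[OF assms(3)]
  by (cases "(c, rd T)" rule: pstep.cases)
    (auto simp: cstep_def act_fun_upd simp del: fun_upd_apply act.simps intro!: tapes_ok_upd)

text \<open>Control state 0 must be the initial one; no other constraint is needed because only
  the output matters.\<close>

definition control_code :: "prog \<Rightarrow> prog list \<Rightarrow> nat" where
  "control_code p c = (if c = [p] then 0 else Suc (to_nat c))"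

lemma control_code_eq_iff [simp]: "control_code p c = control_code p d \<longleftrightarrow> c = d"
  by (auto simp: control_code_def)

definition prog_tm :: "nat \<Rightarrow> prog \<Rightarrow> tm" where
  "prog_tm k p = \<lparr>num_tapes = k,
     instrs = (\<lambda>(c, rs). let r = (\<lambda>i. if i < k then rs ! i else 0) in
         (control_code p c, rs, control_code p (fst (pstep c r)), map (snd (pstep c r)) [0..<k])) `
       ((controls p - {[]}) \<times> {rs. set rs \<subseteq> {..3} \<and> length rs = k})\<rparr>"

lemma turing_machine_prog_tm: "k \<ge> 1 \<Longrightarrow> turing_machine (prog_tm k p)"
  by (auto simp: turing_machine_def prog_tm_def Let_def finite_controls finite_lists_length_eq)

lemma deterministic_prog_tm: "deterministic (prog_tm k p)"
  unfolding deterministic_def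
  by (rule inj_onI) (auto simp: prog_tm_def Let_def)

lemma prog_tm_step:
  assumes c: "c \<in> controls p" and T: "tapes_ok k T"
  shows "tm_step (prog_tm k p) (control_code p c, map T [0..<k]) d \<longleftrightarrow>
    (\<exists>c' T'. cstep (c, T) (c', T') \<and> d = (control_code p c', map T' [0..<k]))"
    (is "?L \<longleftrightarrow> ?R")
proof -
  define rs where "rs = map (rd T) [0..<k]"
  have r: "(\<lambda>i. if i < k then rs ! i else 0) = rd T"
    using T by (auto simp: rs_def fun_eq_iff tapes_ok_def word_tape_def)
  have rs: "set rs \<subseteq> {..3}" "length rs = k"
    using tapes_ok_rd[OF T] by (auto simp: rs_def)
  have map2: "map2 act (map g [0..<k]) (map T [0..<k]) = map (\<lambda>i. act (g i) (T i)) [0..<k]" for g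
    by (rule nth_equalityI) auto
  have "?L \<longleftrightarrow> (\<exists>q' as. (control_code p c, rs, q', as) \<in> instrs (prog_tm k p) \<and>
      d = (q', map2 act as (map T [0..<k])))"
    by (auto simp: tm_step_def rs_def comp_def)
  also have "\<dots> \<longleftrightarrow> c \<noteq> [] \<and> d = (control_code p (fst (pstep c (rd T))),
      map2 act (map (snd (pstep c (rd T))) [0..<k]) (map T [0..<k]))"
    using c rs by (auto simp: prog_tm_def Let_def r image_iff Bex_def)
  also have "\<dots> \<longleftrightarrow> ?R"
    unfolding map2 by (auto simp: cstep_def)
  finally show ?thesis .
qed

lemma csteps_prog_tm:
  assumes p: "prog_ok k p" and run: "(cstep ^^ t) ([p], T) (c, T')" and T: "tapes_ok k T"
  shows "c \<in> controls p \<and> tapes_ok k T' \<and>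
    (tm_step (prog_tm k p) ^^ t) (control_code p [p], map T [0..<k]) (control_code p c, map T' [0..<k])"
  using run
proof (induction t arbitrary: c T')
  case 0
  then show ?case using T self_in_controls by auto
next
  case (Suc t)
  then obtain d U where d: "(cstep ^^ t) ([p], T) (d, U)" "cstep (d, U) (c, T')" by auto
  note IH = Suc.IH[OF d(1)]
  have "c \<in> controls p"
    using d(2) pstep_controls[of d p] IH by (auto simp: cstep_def)
  moreover have "tapes_ok k T'"
    using tapes_ok_cstep[OF d(2)] IH controls_ok[OF p] by blast
  moreover have "tm_step (prog_tm k p) (control_code p d, map U [0..<k]) (control_code p c, map T' [0..<k])"
    using prog_tm_step[of d p k U] IH d(2) by blast
  ultimately show ?case using IH relpowp_Suc_I[of t "tm_step (prog_tm k p)"] by blast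
qed

definition init_tapes :: "bool list \<Rightarrow> tapes" where
  "init_tapes x = (\<lambda>_. word_tape [])(0 := word_tape x)"

lemma functional_run_le:
  assumes functional: "\<And>c d d'. R c d \<Longrightarrow> R c d' \<Longrightarrow> d = d'"
    and "(R ^^ t) a c" "\<And>d. \<not> R c d" "(R ^^ s) a e"
  shows "s \<le> t"
  using assms(2,4)
proof (induction s arbitrary: a t)
  case (Suc s)
  from Suc.prems(2) obtain b where b: "R a b" "(R ^^ s) b e" by (metis relpowp_Suc_D2)
  show ?case
  proof (cases t)
    case 0
    then show ?thesis using Suc.prems(1) b(1) assms(3) by auto
  next
    case (Suc u)
    then obtain b' where "R a b'" "(R ^^ u) b' c" using Suc.prems(1) by (metis relpowp_Suc_D2)
    then show ?thesis using functional[OF b(1)] Suc.IH[of u b] b(2) Suc by auto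
  qed
qed simp

text \<open>The machine halts at the empty control list, for which it has no instruction. By
  determinism the length of this one halting run bounds all runs on the same input.\<close>

theorem prog_poly_time_computable:
  fixes q :: "nat poly"
  assumes k: "k \<ge> 1" and p: "prog_ok k p"
    and ex: "\<And>x. \<exists>t T'. t \<le> poly q (length x) \<and> exec p (init_tapes x) t T' \<and> T' 0 = word_tape (f x)"
  shows "poly_time_computable f"
proof -
  let ?M = "prog_tm k p"
  have run: "\<exists>t c. t \<le> poly q (length x) \<and> (tm_step ?M ^^ t) (init_config ?M x) c \<and>
      halted ?M c \<and> hd (snd c) = word_tape (f x)" for x
  proof -
    obtain t T' where t: "t \<le> poly q (length x)" "exec p (init_tapes x) t T'" "T' 0 = word_tape (f x)"
      using ex[of x] by blast
    have ok: "tapes_ok k (init_tapes x)"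
      using k by (auto simp: tapes_ok_def init_tapes_def word_tape_def)
    have init: "init_config ?M x = (control_code p [p], map (init_tapes x) [0..<k])"
    proof -
      have "map (init_tapes x) [0..<k] = word_tape x # replicate (k - 1) (word_tape [])"
        using k by (intro nth_equalityI) (auto simp: init_tapes_def nth_Cons')
      then show ?thesis by (simp add: init_config_def prog_tm_def control_code_def)
    qed
    note fin = csteps_prog_tm[OF p exec_csteps[OF t(2), of "[]"] ok]
    have "halted ?M (control_code p [], map T' [0..<k])"
      unfolding halted_def using prog_tm_step[OF Nil_in_controls, of k T'] fin by (auto simp: cstep_def)
    moreover have "hd (map T' [0..<k]) = word_tape (f x)"
      using k t(3) by (simp add: hd_map)
    ultimately show ?thesis
      using t(1) fin by (intro exI[of _ t] exI[of _ "(control_code p [], map T' [0..<k])"]) (simp add: init)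
  qed
  have "t \<le> poly q (length x)" if "(tm_step ?M ^^ t) (init_config ?M x) c" for x t c
  proof -
    obtain u d where u: "u \<le> poly q (length x)" "(tm_step ?M ^^ u) (init_config ?M x) d" "halted ?M d"
      using run[of x] by blast
    have "t \<le> u"
    proof (rule functional_run_le[OF _ u(2) _ that])
      show "\<not> tm_step ?M d e" for e using u(3) unfolding halted_def by blast
      show "e = e'" if "tm_step ?M c e" "tm_step ?M c e'" for c e e'
        using tm_step_functional[OF deterministic_prog_tm that] .
    qed
    with u(1) show ?thesis by linarith
  qed
  then have "poly_time ?M" unfolding poly_time_def by blast
  moreover have "computes ?M f"
    unfolding computes_def using run relpowp_imp_rtranclp by metis
  ultimately show ?thesis
    unfolding poly_time_computable_def
    using turing_machine_prog_tm[OF k] deterministic_prog_tm by blast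
qed


section \<open>Execution within a time bound\<close>

definition run :: "prog \<Rightarrow> nat \<Rightarrow> tapes \<Rightarrow> tapes \<Rightarrow> bool" where
  "run p B T T' \<longleftrightarrow> (\<exists>t \<le> B. exec p T t T')"

lemma run_mono: "run p A T T' \<Longrightarrow> A \<le> B \<Longrightarrow> run p B T T'"
  unfolding run_def by (meson le_trans)

lemma run_Nop: "run Nop 1 T T"
  unfolding run_def using exec.Nop by blast

lemma run_Wr: "T j = (f, i) \<Longrightarrow> run (Wr j s) 1 T (T(j := (f(i := s), i)))"
  unfolding run_def using exec.Wr[of j s T] by auto

lemma run_Mv: "T j = (f, i) \<Longrightarrow> run (Mv j m) 1 T (T(j := (f, i + offset m)))"
  unfolding run_def using exec.Mv[of j m T] by auto

lemma run_Seq: "run p A T U \<Longrightarrow> run q B U V \<Longrightarrow> run (p ;; q) (Suc (A + B)) T V"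
  unfolding run_def using exec.Seq by (meson Suc_le_mono add_mono)

lemma run_Ife:
  assumes "rd T j \<in> set ss \<Longrightarrow> run p A T U" "rd T j \<notin> set ss \<Longrightarrow> run q A T U"
  shows "run (Ife j ss p q) (Suc A) T U"
  using assms exec.IfTrue exec.IfFalse unfolding run_def by (meson Suc_le_mono)

text \<open>The loop invariant is an explicit sequence of tape states \<open>T 0\<close>, ...,
  \<open>T m\<close>, which fixes the number of rounds along with the result.\<close>

lemma run_Whl:
  assumes body: "\<And>a. a < m \<Longrightarrow> rd (T a) j \<notin> set ss \<and> run p B (T a) (T (Suc a))"
    and stop: "rd (T m) j \<in> set ss"
  shows "run (Whl j ss p) (Suc (m * Suc B)) (T 0) (T m)"
  using assms
proof (induction m arbitrary: T)
  case 0
  then show ?case unfolding run_def using exec.WhlStop[of "T 0" j ss p] by auto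
next
  case (Suc m)
  have "run (Whl j ss p) (Suc (m * Suc B)) (T (Suc 0)) (T (Suc m))"
    using Suc.IH[of "\<lambda>a. T (Suc a)"] Suc.prems by auto
  then obtain s where s: "s \<le> Suc (m * Suc B)" "exec (Whl j ss p) (T (Suc 0)) s (T (Suc m))"
    unfolding run_def by auto
  obtain t where t: "t \<le> B" "exec p (T 0) t (T (Suc 0))" "rd (T 0) j \<notin> set ss"
    using Suc.prems(1)[of 0] unfolding run_def by auto
  show ?case
    unfolding run_def using exec.WhlStep[OF t(3,2) s(2)] s(1) t(1)
    by (intro exI[of _ "Suc (t + s)"]) auto
qed


section \<open>Bounded loops\<close>

text \<open>A loop variable over the domain: n ones with the end marker 3 on their left and a blank
  on their right. The value of the variable is the position of the head.\<close>

definition loop_content :: "nat \<Rightarrow> int \<Rightarrow> nat" where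
  "loop_content n i = (if i = -1 then 3 else if 0 \<le> i \<and> i < int n then 1 else 0)"

abbreviation loop_tape :: "nat \<Rightarrow> nat \<Rightarrow> tape" where
  "loop_tape n a \<equiv> (loop_content n, int a)"

lemma run_scan:
  assumes T: "T v = (f, i)" and before: "\<And>a. a < m \<Longrightarrow> f (i + offset d * int a) \<notin> set ss"
    and stop: "f (i + offset d * int m) \<in> set ss"
  shows "run (Whl v ss (Mv v d)) (Suc (m * 2)) T (T(v := (f, i + offset d * int m)))"
proof -
  let ?S = "\<lambda>a. T(v := (f, i + offset d * int a))"
  have "run (Whl v ss (Mv v d)) (Suc (m * Suc 1)) (?S 0) (?S m)"
  proof (rule run_Whl[where T = ?S])
    fix a assume "a < m"
    moreover have "run (Mv v d) 1 (?S a) (?S (Suc a))"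
      using run_Mv[of "?S a" v f "i + offset d * int a" d] by (simp add: algebra_simps)
    ultimately show "rd (?S a) v \<notin> set ss \<and> run (Mv v d) 1 (?S a) (?S (Suc a))"
      using before by simp
  qed (use stop in simp)
  moreover have "?S 0 = T" using T by (simp add: fun_eq_iff)
  moreover have "Suc 1 = 2" by simp
  ultimately show ?thesis by metis
qed

definition reset :: "nat \<Rightarrow> prog" where
  "reset v = Mv v MoveLeft ;; Whl v [3] (Mv v MoveLeft) ;; Mv v MoveRight"

lemma run_reset:
  assumes T: "T v = loop_tape n a" and a: "a \<le> n"
  shows "run (reset v) (2 * n + 10) T (T(v := loop_tape n 0))"
proof -
  let ?T1 = "T(v := (loop_content n, int a - 1))" and ?T2 = "T(v := (loop_content n, -1))"
  have 1: "run (Mv v MoveLeft) 1 T ?T1"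
    using run_Mv[of T v, OF T, of MoveLeft] by simp
  have "run (Whl v [3] (Mv v MoveLeft)) (Suc (a * 2)) ?T1
      (?T1(v := (loop_content n, int a - 1 + offset MoveLeft * int a)))"
    by (rule run_scan) (use a in \<open>auto simp: loop_content_def\<close>)
  then have 2: "run (Whl v [3] (Mv v MoveLeft)) (Suc (a * 2)) ?T1 ?T2" by simp
  have 3: "run (Mv v MoveRight) 1 ?T2 (T(v := loop_tape n 0))"
    using run_Mv[of ?T2 v "loop_content n" "-1" MoveRight] by simp
  show ?thesis
    unfolding reset_def by (rule run_mono[OF run_Seq[OF 1 run_Seq[OF 2 3]]]) (use a in simp)
qed

definition for_loop :: "nat \<Rightarrow> prog \<Rightarrow> prog" where
  "for_loop v p = Whl v [0] (p ;; Mv v MoveRight) ;; reset v"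

text \<open>\<open>S a\<close> describes the tapes after a rounds except for tape \<open>v\<close>,
  which is overwritten explicitly. The body may use \<open>v\<close> but has to restore it. The time
  bound is rounded up.\<close>

lemma run_for_loop:
  assumes body: "\<And>a. a < n \<Longrightarrow> run p B ((S a)(v := loop_tape n a)) ((S (Suc a))(v := loop_tape n a))"
  shows "run (for_loop v p) (n * (B + 5) + 20) ((S 0)(v := loop_tape n 0)) ((S n)(v := loop_tape n 0))"
proof -
  let ?S = "\<lambda>a. (S a)(v := loop_tape n a)"
  have "run (Whl v [0] (p ;; Mv v MoveRight)) (Suc (n * Suc (Suc (B + 1)))) (?S 0) (?S n)"
  proof (rule run_Whl[where T = ?S])
    fix a assume a: "a < n"
    have "run (Mv v MoveRight) 1 ((S (Suc a))(v := loop_tape n a)) (?S (Suc a))"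
      using run_Mv[of "(S (Suc a))(v := loop_tape n a)" v "loop_content n" "int a" MoveRight]
      by (simp add: add.commute)
    with body[OF a] have "run (p ;; Mv v MoveRight) (Suc (B + 1)) (?S a) (?S (Suc a))"
      by (rule run_Seq)
    then show "rd (?S a) v \<notin> set [0] \<and> run (p ;; Mv v MoveRight) (Suc (B + 1)) (?S a) (?S (Suc a))"
      using a by (simp add: loop_content_def)
  qed (simp add: loop_content_def)
  moreover have "run (reset v) (2 * n + 10) (?S n) ((S n)(v := loop_tape n 0))"
    using run_reset[of "?S n" v n n] by simp
  ultimately have "run (for_loop v p) (Suc (Suc (n * Suc (Suc (B + 1))) + (2 * n + 10)))
      (?S 0) ((S n)(v := loop_tape n 0))"
    unfolding for_loop_def by (rule run_Seq)
  then show ?thesis by (rule run_mono) (simp add: algebra_simps)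
qed

text \<open>Executes \<open>p\<close> as often as the position of head \<open>v\<close> says. The original position is
  marked with the symbol 2, so that it can be restored.\<close>

definition repeat :: "nat \<Rightarrow> prog \<Rightarrow> prog" where
  "repeat v p = Wr v 2 ;; Mv v MoveLeft ;; Whl v [3] (p ;; Mv v MoveLeft) ;;
     Mv v MoveRight ;; Whl v [2] (Mv v MoveRight) ;; Wr v 1"

text \<open>The body must work for every content x of tape \<open>v\<close>, because during the loop
  this tape carries the mark 2 and its head is somewhere to the left of it.\<close>

lemma run_repeat:
  assumes a: "a < n" and body: "\<And>i x. i < a \<Longrightarrow> run p B ((S i)(v := x)) ((S (Suc i))(v := x))"
  shows "run (repeat v p) (n * (B + 5) + 20) ((S 0)(v := loop_tape n a)) ((S a)(v := loop_tape n a))"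
proof -
  define f where "f = (loop_content n)(int a := 2)"
  let ?S = "\<lambda>i. (S i)(v := (f, int a - 1 - int i))"
  have 1: "run (Wr v 2) 1 ((S 0)(v := loop_tape n a)) ((S 0)(v := (f, int a)))"
    using run_Wr[of "(S 0)(v := loop_tape n a)" v "loop_content n" "int a" 2] by (simp add: f_def)
  have 2: "run (Mv v MoveLeft) 1 ((S 0)(v := (f, int a))) (?S 0)"
    using run_Mv[of "(S 0)(v := (f, int a))" v f "int a" MoveLeft] by simp
  have 3: "run (Whl v [3] (p ;; Mv v MoveLeft)) (Suc (a * Suc (Suc (B + 1)))) (?S 0) (?S a)"
  proof (rule run_Whl[where T = ?S])
    fix i assume i: "i < a"
    have "run (Mv v MoveLeft) 1 ((S (Suc i))(v := (f, int a - 1 - int i))) (?S (Suc i))"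
      using run_Mv[of "(S (Suc i))(v := (f, int a - 1 - int i))" v f "int a - 1 - int i" MoveLeft]
      by (simp add: algebra_simps)
    with body[OF i] have "run (p ;; Mv v MoveLeft) (Suc (B + 1)) (?S i) (?S (Suc i))"
      by (rule run_Seq)
    then show "rd (?S i) v \<notin> set [3] \<and> run (p ;; Mv v MoveLeft) (Suc (B + 1)) (?S i) (?S (Suc i))"
      using i a by (auto simp: f_def loop_content_def)
  qed (use a in \<open>simp add: f_def loop_content_def\<close>)
  have 4: "run (Mv v MoveRight) 1 (?S a) ((S a)(v := (f, 0)))"
    using run_Mv[of "?S a" v f "-1" MoveRight] by simp
  have "run (Whl v [2] (Mv v MoveRight)) (Suc (a * 2)) ((S a)(v := (f, 0)))
      (((S a)(v := (f, 0)))(v := (f, 0 + offset MoveRight * int a)))"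
    by (rule run_scan) (use a in \<open>auto simp: f_def loop_content_def\<close>)
  then have 5: "run (Whl v [2] (Mv v MoveRight)) (Suc (a * 2)) ((S a)(v := (f, 0))) ((S a)(v := (f, int a)))"
    by simp
  have "loop_content n (int a) = 1" using a by (simp add: loop_content_def)
  then have "f(int a := 1) = loop_content n" by (auto simp: f_def fun_eq_iff)
  then have 6: "run (Wr v 1) 1 ((S a)(v := (f, int a))) ((S a)(v := loop_tape n a))"
    using run_Wr[of "(S a)(v := (f, int a))" v f "int a" 1] by simp
  have "Suc (1 + Suc (1 + Suc (Suc (a * Suc (Suc (B + 1))) + Suc (1 + Suc (Suc (a * 2) + 1)))))
      \<le> a * (B + 5) + 20" by (simp add: algebra_simps)
  also have "\<dots> \<le> n * (B + 5) + 20" using a by (intro add_mono mult_le_mono1) auto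
  finally show ?thesis
    unfolding repeat_def
    by (rule run_mono[OF run_Seq[OF 1 run_Seq[OF 2 run_Seq[OF 3 run_Seq[OF 4 run_Seq[OF 5 6]]]]]])
qed

primrec nest :: "nat list \<Rightarrow> prog \<Rightarrow> prog" where
  "nest [] p = p"
| "nest (y # ys) p = for_loop y (nest ys p)"

primrec nest_time :: "nat \<Rightarrow> nat \<Rightarrow> nat \<Rightarrow> nat" where
  "nest_time 0 B n = B"
| "nest_time (Suc m) B n = n * (nest_time m B n + 5) + 20"

text \<open>The state that nested loops transform is confined to tapes 1 and 2, which later hold the
  input and a flag.\<close>

definition put :: "tapes \<Rightarrow> tape \<times> tape \<Rightarrow> tapes" where
  "put T s = T(1 := fst s, 2 := snd s)"

text \<open>Nested loops over the domain serve as a counter up to a power of n: their purpose is the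
  number of rounds, not the values of the variables.\<close>

lemma run_nest:
  assumes "distinct ys" "1 \<notin> set ys" "2 \<notin> set ys" "\<And>y. y \<in> set ys \<Longrightarrow> T y = loop_tape n 0"
    and "\<And>T i. i < n ^ length ys \<Longrightarrow> run p B (put T (s i)) (put T (s (Suc i)))"
  shows "run (nest ys p) (nest_time (length ys) B n) (put T (s 0)) (put T (s (n ^ length ys)))"
  using assms
proof (induction ys arbitrary: T s)
  case Nil
  then show ?case by simp
next
  case (Cons y ys)
  let ?N = "n ^ length ys" and ?B = "nest_time (length ys) B n"
  have comm: "(put T x)(y := z) = put (T(y := z)) x" for T x z
    using Cons.prems(2,3) by (auto simp: put_def fun_eq_iff)
  have "run (for_loop y (nest ys p)) (n * (?B + 5) + 20)
      ((put T (s (0 * ?N)))(y := loop_tape n 0)) ((put T (s (n * ?N)))(y := loop_tape n 0))"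
  proof (rule run_for_loop[where S = "\<lambda>a. put T (s (a * ?N))"])
    fix a assume a: "a < n"
    \<comment> \<open>Round a of the outer loop accounts for the indices from a * \<open>?N\<close>
      up to (a + 1) * \<open>?N\<close>.\<close>
    have "run (nest ys p) ?B (put (T(y := loop_tape n a)) (s (a * ?N + 0)))
        (put (T(y := loop_tape n a)) (s (a * ?N + ?N)))"
    proof (rule Cons.IH[where s = "\<lambda>i. s (a * ?N + i)"])
      fix U i assume i: "i < ?N"
      have "a * ?N + i < Suc a * ?N" using i by simp
      also have "\<dots> \<le> n * ?N" using a by (intro mult_le_mono1) simp
      finally show "run p B (put U (s (a * ?N + i))) (put U (s (a * ?N + Suc i)))"
        using Cons.prems(5)[of "a * ?N + i" U] by simp
    qed (use Cons.prems in auto)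
    then show "run (nest ys p) ?B ((put T (s (a * ?N)))(y := loop_tape n a))
        ((put T (s (Suc a * ?N)))(y := loop_tape n a))"
      by (simp add: comm add.commute)
  qed
  moreover have "T(y := loop_tape n 0) = T" using Cons.prems(4) by (auto simp: fun_eq_iff)
  ultimately show ?case by (simp add: comm)
qed


section \<open>First-order transductions of encoded structures\<close>

text \<open>Variables are de Bruijn levels: the quantifier or loop at depth \<open>d\<close> binds variable \<open>d\<close>.\<close>

datatype fm = Rel nat "nat list" pstar | Neg fm | Conj fm fm | Ex fm

datatype cmd = Skip | Emit bool | Sequ cmd cmd | Cond fm cmd cmd | Loop cmd

primrec sat :: "nat \<Rightarrow> (nat, pstar) struct \<Rightarrow> nat list \<Rightarrow> fm \<Rightarrow> bool" where
  "sat n G xs (Rel i vs a) \<longleftrightarrow> interp G i (map ((!) xs) vs) = a"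
| "sat n G xs (Neg \<phi>) \<longleftrightarrow> \<not> sat n G xs \<phi>"
| "sat n G xs (Conj \<phi> \<psi>) \<longleftrightarrow> sat n G xs \<phi> \<and> sat n G xs \<psi>"
| "sat n G xs (Ex \<phi>) \<longleftrightarrow> (\<exists>x<n. sat n G (xs @ [x]) \<phi>)"

primrec emits :: "nat \<Rightarrow> (nat, pstar) struct \<Rightarrow> nat list \<Rightarrow> cmd \<Rightarrow> bool list" where
  "emits n G xs Skip = []"
| "emits n G xs (Emit b) = [b]"
| "emits n G xs (Sequ c d) = emits n G xs c @ emits n G xs d"
| "emits n G xs (Cond \<phi> c d) = (if sat n G xs \<phi> then emits n G xs c else emits n G xs d)"
| "emits n G xs (Loop c) = concat (map (\<lambda>x. emits n G (xs @ [x]) c) [0..<n])"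

primrec fm_ok :: "signature \<Rightarrow> nat \<Rightarrow> fm \<Rightarrow> bool" where
  "fm_ok \<sigma> d (Rel i vs a) \<longleftrightarrow> i < length \<sigma> \<and> length vs = \<sigma> ! i \<and> set vs \<subseteq> {..<d}"
| "fm_ok \<sigma> d (Neg \<phi>) \<longleftrightarrow> fm_ok \<sigma> d \<phi>"
| "fm_ok \<sigma> d (Conj \<phi> \<psi>) \<longleftrightarrow> fm_ok \<sigma> d \<phi> \<and> fm_ok \<sigma> d \<psi>"
| "fm_ok \<sigma> d (Ex \<phi>) \<longleftrightarrow> fm_ok \<sigma> (Suc d) \<phi>"

primrec cmd_ok :: "signature \<Rightarrow> nat \<Rightarrow> cmd \<Rightarrow> bool" where
  "cmd_ok \<sigma> d Skip \<longleftrightarrow> True"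
| "cmd_ok \<sigma> d (Emit b) \<longleftrightarrow> True"
| "cmd_ok \<sigma> d (Sequ c e) \<longleftrightarrow> cmd_ok \<sigma> d c \<and> cmd_ok \<sigma> d e"
| "cmd_ok \<sigma> d (Cond \<phi> c e) \<longleftrightarrow> fm_ok \<sigma> d \<phi> \<and> cmd_ok \<sigma> d c \<and> cmd_ok \<sigma> d e"
| "cmd_ok \<sigma> d (Loop c) \<longleftrightarrow> cmd_ok \<sigma> (Suc d) c"

primrec fm_depth :: "fm \<Rightarrow> nat" where
  "fm_depth (Rel i vs a) = 0"
| "fm_depth (Neg \<phi>) = fm_depth \<phi>"
| "fm_depth (Conj \<phi> \<psi>) = max (fm_depth \<phi>) (fm_depth \<psi>)"
| "fm_depth (Ex \<phi>) = Suc (fm_depth \<phi>)"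

primrec cmd_depth :: "cmd \<Rightarrow> nat" where
  "cmd_depth Skip = 0"
| "cmd_depth (Emit b) = 0"
| "cmd_depth (Sequ c e) = max (cmd_depth c) (cmd_depth e)"
| "cmd_depth (Cond \<phi> c e) = max (fm_depth \<phi>) (max (cmd_depth c) (cmd_depth e))"
| "cmd_depth (Loop c) = Suc (cmd_depth c)"


subsection \<open>Addresses in encoded structures\<close>

definition table_values :: "signature \<Rightarrow> nat \<Rightarrow> (nat, pstar) struct \<Rightarrow> pstar list" where
  "table_values \<sigma> n G = concat (map (\<lambda>i. map (interp G i) (product_lists (replicate (\<sigma> ! i) [0..<n])))
     [0..<length \<sigma>])"

lemma concat_map_concat_map:
  "concat (map e (concat (map h is))) = concat (map (\<lambda>i. concat (map e (h i))) is)"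
  by (induction "is") auto

lemma encode_eq:
  "encode \<sigma> n G = replicate n True @ False # concat (map encode_value (table_values \<sigma> n G))"
  by (simp add: encode_def table_values_def concat_map_concat_map comp_def)

lemma length_product_lists_upt: "length (product_lists (replicate k [0..<n])) = n ^ k"
  by (induction k) (auto simp: length_concat comp_def sum_list_triv)

lemma nth_concat_uniform:
  assumes "\<And>a. a < n \<Longrightarrow> length (f a) = L" "a < n" "b < L"
  shows "concat (map f [0..<n]) ! (a * L + b) = f a ! b"
  using assms
proof (induction n)
  case (Suc n)
  have len: "length (concat (map f [0..<n])) = n * L"
    using Suc.prems(1) by (induction n) (auto simp: add.commute)
  show ?case
  proof (cases "a = n")
    case True
    then show ?thesis using len by (simp add: nth_append)
  next
    case False
    then have "a < n" using Suc.prems(2) by simp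
    then have "a * L + b < n * L"
      using Suc.prems(3) by (metis add_less_cancel_left less_le_trans mult_le_mono1 mult_Suc add.commute Suc_leI)
    then show ?thesis using Suc.IH Suc.prems \<open>a < n\<close> len by (simp add: nth_append)
  qed
qed simp

text \<open>The number with the given digits in base n, most significant digit first; it is the rank
  of the tuple in lexicographic order.\<close>

primrec address :: "nat \<Rightarrow> nat list \<Rightarrow> nat" where
  "address n [] = 0"
| "address n (t # ts) = t * n ^ length ts + address n ts"

lemma address_less: "set ts \<subseteq> {..<n} \<Longrightarrow> address n ts < n ^ length ts"
proof (induction ts)
  case (Cons t ts)
  then have "t * n ^ length ts + address n ts < Suc t * n ^ length ts" by simp
  also have "\<dots> \<le> n * n ^ length ts" using Cons.prems by (intro mult_le_mono1) auto
  finally show ?case by simp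
qed simp

lemma product_lists_nth_address:
  "set ts \<subseteq> {..<n} \<Longrightarrow> product_lists (replicate (length ts) [0..<n]) ! address n ts = ts"
proof (induction ts)
  case (Cons t ts)
  let ?P = "product_lists (replicate (length ts) [0..<n])"
  have "product_lists (replicate (length (t # ts)) [0..<n]) ! address n (t # ts)
      = concat (map (\<lambda>x. map ((#) x) ?P) [0..<n]) ! (t * n ^ length ts + address n ts)"
    by simp
  also have "\<dots> = map ((#) t) ?P ! address n ts"
    by (rule nth_concat_uniform) (use Cons.prems address_less[of ts n] in \<open>auto simp: length_product_lists_upt\<close>)
  also have "\<dots> = t # ts"
    using Cons address_less[of ts n] by (simp add: length_product_lists_upt)
  finally show ?case .
qed simp

definition table_offset :: "signature \<Rightarrow> nat \<Rightarrow> nat \<Rightarrow> nat" where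
  "table_offset \<sigma> n i = sum_list (map ((^) n) (take i \<sigma>))"

lemma length_table_values: "length (table_values \<sigma> n G) = sum_list (map ((^) n) \<sigma>)"
proof -
  have "map (\<lambda>i. n ^ (\<sigma> ! i)) [0..<length \<sigma>] = map ((^) n) \<sigma>"
    by (rule nth_equalityI) auto
  then show ?thesis
    by (simp add: table_values_def length_concat comp_def length_product_lists_upt)
qed

lemma nth_concat_offset:
  assumes "i < length xss" "b < length (xss ! i)"
  shows "sum_list (map length (take i xss)) + b < length (concat xss)"
    "concat xss ! (sum_list (map length (take i xss)) + b) = xss ! i ! b"
proof -
  have "concat xss = concat (take i xss) @ xss ! i @ concat (drop (Suc i) xss)"
    using assms(1) by (metis append_take_drop_id concat.simps(2) concat_append Cons_nth_drop_Suc)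
  then show "concat xss ! (sum_list (map length (take i xss)) + b) = xss ! i ! b"
    "sum_list (map length (take i xss)) + b < length (concat xss)"
    using assms(2) by (simp_all add: nth_append flip: length_concat)
qed

lemma table_values_nth:
  assumes "i < length \<sigma>" "length ts = \<sigma> ! i" "set ts \<subseteq> {..<n}"
  shows "table_offset \<sigma> n i + address n ts < length (table_values \<sigma> n G)"
    "table_values \<sigma> n G ! (table_offset \<sigma> n i + address n ts) = interp G i ts"
proof -
  let ?xss = "map (\<lambda>i. map (interp G i) (product_lists (replicate (\<sigma> ! i) [0..<n]))) [0..<length \<sigma>]"
  have "map length (take i ?xss) = map ((^) n) (take i \<sigma>)"
    by (rule nth_equalityI) (auto simp: length_product_lists_upt)
  then have off: "table_offset \<sigma> n i = sum_list (map length (take i ?xss))"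
    by (simp add: table_offset_def)
  have "address n ts < length (?xss ! i)"
    using assms address_less[OF assms(3)] by (simp add: length_product_lists_upt)
  note * = nth_concat_offset[of i ?xss, OF _ this]
  show "table_offset \<sigma> n i + address n ts < length (table_values \<sigma> n G)"
    using *(1) assms(1) unfolding table_values_def off by simp
  show "table_values \<sigma> n G ! (table_offset \<sigma> n i + address n ts) = interp G i ts"
    using *(2) assms product_lists_nth_address[OF assms(3)] address_less[OF assms(3)]
    unfolding table_values_def off by (simp add: length_product_lists_upt)
qed

lemma length_encode_value [simp]: "length (encode_value a) = 2"
  by (cases a) auto

lemma length_concat_encode_value: "length (concat (map encode_value vs)) = 2 * length vs"
  by (induction vs) auto

lemma concat_encode_value_nth:
  assumes "j < length vs" "b < 2"
  shows "concat (map encode_value vs) ! (2 * j + b) = encode_value (vs ! j) ! b"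
  using assms
proof (induction vs arbitrary: j)
  case (Cons v vs)
  then show ?case by (cases j) (auto simp: nth_append)
qed simp


section \<open>Polynomially bounded functions of the domain size\<close>

definition poly_bounded :: "(nat \<Rightarrow> nat) \<Rightarrow> bool" where
  "poly_bounded F \<longleftrightarrow> (\<exists>q :: nat poly. \<forall>n. F n \<le> poly q n)"

named_theorems poly_bounded_intros

lemma poly_bounded_const [poly_bounded_intros]: "poly_bounded (\<lambda>n. c)"
  unfolding poly_bounded_def by (rule exI[of _ "[:c:]"]) simp

lemma poly_bounded_id [poly_bounded_intros]: "poly_bounded (\<lambda>n. n)"
  unfolding poly_bounded_def by (rule exI[of _ "[:0, 1:]"]) simp

lemma poly_bounded_add [poly_bounded_intros]:
  assumes "poly_bounded F" "poly_bounded H"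
  shows "poly_bounded (\<lambda>n. F n + H n)"
proof -
  from assms obtain p q :: "nat poly" where "\<And>n. F n \<le> poly p n" "\<And>n. H n \<le> poly q n"
    unfolding poly_bounded_def by blast
  then show ?thesis
    unfolding poly_bounded_def by (intro exI[of _ "p + q"]) (simp add: add_mono)
qed

lemma poly_bounded_mult [poly_bounded_intros]:
  assumes "poly_bounded F" "poly_bounded H"
  shows "poly_bounded (\<lambda>n. F n * H n)"
proof -
  from assms obtain p q :: "nat poly" where "\<And>n. F n \<le> poly p n" "\<And>n. H n \<le> poly q n"
    unfolding poly_bounded_def by blast
  then show ?thesis
    unfolding poly_bounded_def by (intro exI[of _ "p * q"]) (simp add: mult_mono)
qed

lemma poly_bounded_Suc [poly_bounded_intros]: "poly_bounded F \<Longrightarrow> poly_bounded (\<lambda>n. Suc (F n))"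
  using poly_bounded_add[OF _ poly_bounded_const[of 1]] by simp

lemma poly_bounded_power [poly_bounded_intros]: "poly_bounded F \<Longrightarrow> poly_bounded (\<lambda>n. F n ^ k)"
  by (induction k) (auto intro: poly_bounded_intros)

lemma poly_bounded_nest_time [poly_bounded_intros]:
  "poly_bounded B \<Longrightarrow> poly_bounded (\<lambda>n. nest_time m (B n) n)"
  by (induction m) (auto intro!: poly_bounded_intros)

lemma poly_bounded_sum_list_power [poly_bounded_intros]:
  "poly_bounded (\<lambda>n. sum_list (map ((^) n) ks))"
  by (induction ks) (auto intro!: poly_bounded_intros)

section \<open>Tape contents and access to a stored value\<close>

definition word_content :: "bool list \<Rightarrow> int \<Rightarrow> nat" where
  "word_content x i = (if 0 \<le> i \<and> i < int (length x) then (if x ! nat i then 2 else 1) else 0)"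

abbreviation bit_symbol :: "bool \<Rightarrow> nat" where
  "bit_symbol b \<equiv> (if b then 2 else 1)"

lemma word_tape_eq: "word_tape x = (word_content x, 0)"
  by (simp add: word_tape_def word_content_def fun_eq_iff)

lemma word_content_nth: "j < length x \<Longrightarrow> word_content x (int j) = bit_symbol (x ! j)"
  by (simp add: word_content_def)

lemma word_content_snoc: "word_content (x @ [b]) = (word_content x)(int (length x) := bit_symbol b)"
  by (auto simp: word_content_def fun_eq_iff nth_append)

text \<open>The flag \<open>False\<close> is literally the blank tape, so the flag needs no
  initialisation.\<close>

definition flag_tape :: "bool \<Rightarrow> tape" where
  "flag_tape b = ((\<lambda>_. 0)(0 := if b then 1 else 0), 0)"

lemma read_flag_tape [simp]: "read_tape (flag_tape b) = (if b then 1 else 0)"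
  by (simp add: flag_tape_def)

lemma run_Wr_flag:
  assumes "T j = flag_tape b"
  shows "run (Wr j (if c then 1 else 0)) 1 T (T(j := flag_tape c))"
  using run_Wr[of T j "(\<lambda>_. 0)(0 := if b then 1 else 0)" 0 "if c then 1 else 0"] assms
  by (simp add: flag_tape_def)

lemma run_set_flag: "T j = flag_tape b \<Longrightarrow> run (Wr j 1) 1 T (T(j := flag_tape True))"
  using run_Wr_flag[of T j b True] by simp

lemma run_clear_flag: "T j = flag_tape b \<Longrightarrow> run (Wr j 0) 1 T (T(j := flag_tape False))"
  using run_Wr_flag[of T j b False] by simp

definition skip2 :: prog where
  "skip2 = Mv 1 MoveRight ;; Mv 1 MoveRight"

lemma run_skip2:
  assumes "T 1 = (f, p)"
  shows "run skip2 3 T (T(1 := (f, p + 2)))"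
proof -
  have 1: "run (Mv 1 MoveRight) 1 T (T(1 := (f, p + 1)))"
    using run_Mv[of T 1 f p, OF assms, of MoveRight] by simp
  have 2: "run (Mv 1 MoveRight) 1 (T(1 := (f, p + 1))) (T(1 := (f, p + 2)))"
    using run_Mv[of "T(1 := (f, p + 1))" 1 f "p + 1" MoveRight] by (simp add: algebra_simps)
  show ?thesis unfolding skip2_def by (rule run_mono[OF run_Seq[OF 1 2]]) simp
qed

text \<open>Layout of the tapes: 0 for the output, 1 for the input, 2 for the flag, then
  \<open>sum_list \<sigma>\<close> counters for nested loops, then one tape per variable. The sum of
  the arities is a convenient bound for each of them.\<close>

definition scratch :: "nat \<Rightarrow> nat list" where
  "scratch k = [3..<3 + k]"

primrec skip_tables :: "nat list \<Rightarrow> prog" where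
  "skip_tables [] = Nop"
| "skip_tables (k # ks) = nest (scratch k) skip2 ;; skip_tables ks"

text \<open>Evaluates \<open>address\<close> by moving the head: a digit with r digits after it
  stands for that many blocks of n^r values.\<close>

primrec skip_to_address :: "nat list \<Rightarrow> prog" where
  "skip_to_address [] = Nop"
| "skip_to_address (v # vs) = repeat v (nest (scratch (length vs)) skip2) ;; skip_to_address vs"

definition rewind :: "nat \<Rightarrow> prog" where
  "rewind j = Whl j [0] (Mv j MoveLeft) ;; Mv j MoveRight"

text \<open>Writing the position as h - 1 includes the cell to the left of the word, and with it the
  empty word.\<close>

lemma run_rewind:
  assumes T: "T j = (word_content w, int h - 1)" and h: "h \<le> length w"
  shows "run (rewind j) (2 * length w + 10) T (T(j := word_tape w))"
proof -
  have "run (Whl j [0] (Mv j MoveLeft)) (Suc (h * 2)) T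
      (T(j := (word_content w, int h - 1 + offset MoveLeft * int h)))"
    by (rule run_scan[where T = T, OF T]) (use h in \<open>auto simp: word_content_def\<close>)
  then have 1: "run (Whl j [0] (Mv j MoveLeft)) (Suc (h * 2)) T (T(j := (word_content w, -1)))"
    by simp
  have 2: "run (Mv j MoveRight) 1 (T(j := (word_content w, -1))) (T(j := word_tape w))"
    using run_Mv[of "T(j := (word_content w, -1))" j "word_content w" "-1" MoveRight]
    by (simp add: word_tape_eq)
  show ?thesis unfolding rewind_def by (rule run_mono[OF run_Seq[OF 1 2]]) (use h in simp)
qed

definition test_value :: "pstar \<Rightarrow> prog" where
  "test_value a = Ife 1 [bit_symbol (encode_value a ! 0)]
     (Mv 1 MoveRight ;; Ife 1 [bit_symbol (encode_value a ! 1)] (Wr 2 1) (Wr 2 0))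
     (Wr 2 0) ;; rewind 1"

lemma encode_value_eq_iff:
  "v = a \<longleftrightarrow> encode_value v ! 0 = encode_value a ! 0 \<and> encode_value v ! 1 = encode_value a ! 1"
  by (cases v; cases a) auto

lemma bit_symbol_eq_iff: "bit_symbol b = bit_symbol c \<longleftrightarrow> b = c"
  by simp

lemma run_test_value:
  assumes T: "T 1 = (word_content w, int h)" "T 2 = flag_tape b" and h: "Suc h < length w"
    and v: "w ! h = encode_value v ! 0" "w ! Suc h = encode_value v ! 1"
  shows "run (test_value a) (2 * length w + 20) T (T(1 := word_tape w, 2 := flag_tape (v = a)))"
proof -
  have r: "rd T 1 = bit_symbol (encode_value v ! 0)"
    using h v T by (simp add: word_content_nth)
  let ?T1 = "T(1 := (word_content w, int (Suc h)))"
  have r1: "rd ?T1 1 = bit_symbol (encode_value v ! 1)"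
    using word_content_nth[OF h] v by simp
  let ?p = "Ife 1 [bit_symbol (encode_value a ! 1)] (Wr 2 1) (Wr 2 0)"
  \<comment> \<open>The head position after the test depends on whether the first bit already
    differs; the rewinding that follows works from either cell.\<close>
  have "\<exists>h' < length w. run (Ife 1 [bit_symbol (encode_value a ! 0)] (Mv 1 MoveRight ;; ?p) (Wr 2 0))
      5 T (T(1 := (word_content w, int h'), 2 := flag_tape (v = a)))"
  proof (cases "encode_value v ! 0 = encode_value a ! 0")
    case True
    have 1: "run (Mv 1 MoveRight) 1 T ?T1"
      using run_Mv[of T 1, OF T(1), of MoveRight] by (simp add: add.commute)
    have 2: "run ?p (Suc 1) ?T1 (?T1(2 := flag_tape (v = a)))"
    proof (rule run_Ife)
      assume "rd ?T1 1 \<in> set [bit_symbol (encode_value a ! 1)]"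
      then have "encode_value v ! 1 = encode_value a ! 1"
        unfolding r1 by (simp only: list.set singleton_iff bit_symbol_eq_iff)
      then have "v = a" using True unfolding encode_value_eq_iff[of v a] by blast
      then show "run (Wr 2 1) 1 ?T1 (?T1(2 := flag_tape (v = a)))"
        using run_set_flag[of ?T1 2 b] T(2) by simp
    next
      assume "rd ?T1 1 \<notin> set [bit_symbol (encode_value a ! 1)]"
      then have "v \<noteq> a" unfolding r1 by force
      then show "run (Wr 2 0) 1 ?T1 (?T1(2 := flag_tape (v = a)))"
        using run_clear_flag[of ?T1 2 b] T(2) by simp
    qed
    have "run (Ife 1 [bit_symbol (encode_value a ! 0)] (Mv 1 MoveRight ;; ?p) (Wr 2 0)) (Suc (Suc (1 + Suc 1)))
        T (?T1(2 := flag_tape (v = a)))"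
      by (rule run_Ife) (use run_Seq[OF 1 2] r True in auto)
    then have "run (Ife 1 [bit_symbol (encode_value a ! 0)] (Mv 1 MoveRight ;; ?p) (Wr 2 0)) 5
        T (?T1(2 := flag_tape (v = a)))" by (rule run_mono) simp
    then show ?thesis using h by blast
  next
    case False
    then have "v \<noteq> a" by auto
    have "run (Ife 1 [bit_symbol (encode_value a ! 0)] (Mv 1 MoveRight ;; ?p) (Wr 2 0)) (Suc 1)
        T (T(2 := flag_tape (v = a)))"
      by (rule run_Ife) (use run_clear_flag[of T 2 b] T(2) r False \<open>v \<noteq> a\<close> in \<open>auto split: if_splits\<close>)
    then have "run (Ife 1 [bit_symbol (encode_value a ! 0)] (Mv 1 MoveRight ;; ?p) (Wr 2 0)) 5
        T (T(2 := flag_tape (v = a)))" by (rule run_mono) simp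
    moreover have "T(2 := flag_tape (v = a)) = T(1 := (word_content w, int h), 2 := flag_tape (v = a))"
      using T(1) by (auto simp: fun_eq_iff)
    ultimately show ?thesis using h by (metis Suc_lessD)
  qed
  then obtain h' where h': "h' < length w"
    and 1: "run (Ife 1 [bit_symbol (encode_value a ! 0)] (Mv 1 MoveRight ;; ?p) (Wr 2 0)) 5
      T (T(1 := (word_content w, int h'), 2 := flag_tape (v = a)))" by blast
  have 2: "run (rewind 1) (2 * length w + 10) (T(1 := (word_content w, int h'), 2 := flag_tape (v = a)))
      (T(1 := word_tape w, 2 := flag_tape (v = a)))"
    using run_rewind[of "T(1 := (word_content w, int h'), 2 := flag_tape (v = a))" 1 w "Suc h'"] h'
    by (simp add: fun_upd_twist)
  show ?thesis unfolding test_value_def by (rule run_mono[OF run_Seq[OF 1 2]]) simp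
qed

lemma length_encode: "length (encode \<sigma> n G) = n + 1 + 2 * sum_list (map ((^) n) \<sigma>)"
  by (simp add: encode_eq length_concat_encode_value length_table_values)

text \<open>The offset n + 1 skips the unary size and its separator, and every value takes two
  bits.\<close>

lemma encode_nth_value:
  assumes "i < length \<sigma>" "length ts = \<sigma> ! i" "set ts \<subseteq> {..<n}"
  defines "h \<equiv> n + 1 + 2 * (table_offset \<sigma> n i + address n ts)"
  shows "Suc h < length (encode \<sigma> n G)"
    "encode \<sigma> n G ! h = encode_value (interp G i ts) ! 0"
    "encode \<sigma> n G ! Suc h = encode_value (interp G i ts) ! 1"
proof -
  let ?m = "table_offset \<sigma> n i + address n ts"
  note t = table_values_nth[OF assms(1-3), of G]
  show "Suc h < length (encode \<sigma> n G)"
    using t(1) by (simp add: h_def length_encode length_table_values)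
  have "encode \<sigma> n G ! (n + 1 + j) = concat (map encode_value (table_values \<sigma> n G)) ! j" for j
    by (simp add: encode_eq nth_append)
  from this[of "2 * ?m + 0"] this[of "2 * ?m + 1"]
  show "encode \<sigma> n G ! h = encode_value (interp G i ts) ! 0"
    "encode \<sigma> n G ! Suc h = encode_value (interp G i ts) ! 1"
    using concat_encode_value_nth[OF t(1), of 0] concat_encode_value_nth[OF t(1), of 1] t(2)
    by (simp_all add: h_def)
qed

section \<open>Compiling formulas and commands into programs; \<open>D\<close> is the number of
  variable tapes\<close>

locale transducer =
  fixes \<sigma> :: signature and D :: nat
begin

definition var_tape :: "nat \<Rightarrow> nat" where
  "var_tape d = 3 + sum_list \<sigma> + d"

lemma var_tape_simps [simp]:
  "var_tape d = var_tape e \<longleftrightarrow> d = e" "var_tape d \<noteq> 0" "var_tape d \<noteq> 1" "var_tape d \<noteq> Suc 0" "var_tape d \<noteq> 2"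
  "0 \<noteq> var_tape d" "1 \<noteq> var_tape d" "Suc 0 \<noteq> var_tape d" "2 \<noteq> var_tape d"
  by (auto simp: var_tape_def)

definition scratch_ok :: "nat \<Rightarrow> tapes \<Rightarrow> bool" where
  "scratch_ok n T \<longleftrightarrow> (\<forall>y. 3 \<le> y \<and> y < 3 + sum_list \<sigma> \<longrightarrow> T y = loop_tape n 0)"

lemma scratch_ok_upd [simp]:
  "scratch_ok n T \<Longrightarrow> scratch_ok n (T(0 := x))" "scratch_ok n T \<Longrightarrow> scratch_ok n (T(1 := x))"
  "scratch_ok n T \<Longrightarrow> scratch_ok n (T(Suc 0 := x))"
  "scratch_ok n T \<Longrightarrow> scratch_ok n (T(2 := x))" "scratch_ok n T \<Longrightarrow> scratch_ok n (T(var_tape d := x))"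
  by (auto simp: scratch_ok_def var_tape_def)

text \<open>The invariant between commands. The input is rewound, and variables that are not bound
  yet have their heads at 0, so a loop over such a variable can start at once.\<close>

definition ready :: "bool list \<Rightarrow> nat \<Rightarrow> nat list \<Rightarrow> tapes \<Rightarrow> bool" where
  "ready w n xs T \<longleftrightarrow> T 1 = word_tape w \<and> scratch_ok n T \<and> (\<exists>b. T 2 = flag_tape b) \<and>
     (\<forall>d<D. T (var_tape d) = loop_tape n (if d < length xs then xs ! d else 0))"

lemma run_nest_skip2:
  assumes k: "k \<le> sum_list \<sigma>" and T: "scratch_ok n T" "T 1 = (f, p)"
  shows "run (nest (scratch k) skip2) (nest_time k 3 n) T (T(1 := (f, p + 2 * int (n ^ k))))"
proof -
  let ?s = "\<lambda>i. ((f, p + 2 * int i), T 2)"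
  have len: "length (scratch k) = k" by (simp add: scratch_def)
  have "run (nest (scratch k) skip2) (nest_time (length (scratch k)) 3 n)
      (put T (?s 0)) (put T (?s (n ^ length (scratch k))))"
  proof (rule run_nest)
    fix U i
    have "run skip2 3 (put U (?s i)) ((put U (?s i))(1 := (f, p + 2 * int i + 2)))"
      by (rule run_skip2) (simp add: put_def)
    moreover have "(put U (?s i))(1 := (f, p + 2 * int i + 2)) = put U (?s (Suc i))"
      by (auto simp: put_def fun_eq_iff)
    ultimately show "run skip2 3 (put U (?s i)) (put U (?s (Suc i)))" by simp
  qed (use k T in \<open>auto simp: scratch_def scratch_ok_def\<close>)
  moreover have "put T (?s 0) = T" "put T (?s (n ^ k)) = T(1 := (f, p + 2 * int (n ^ k)))"
    using T(2) by (auto simp: put_def fun_eq_iff)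
  ultimately show ?thesis by (simp only: len)
qed

text \<open>The bound is chosen before the domain size and the tapes, so it depends on the program
  alone. The statements below follow the same scheme.\<close>

lemma run_skip_tables:
  assumes "set ks \<subseteq> {..sum_list \<sigma>}"
  shows "\<exists>F. poly_bounded F \<and> (\<forall>n T f p. scratch_ok n T \<longrightarrow> T 1 = (f, p) \<longrightarrow>
    run (skip_tables ks) (F n) T (T(1 := (f, p + 2 * int (sum_list (map ((^) n) ks))))))"
  using assms
proof (induction ks)
  case Nil
  have "run Nop 1 T (T(1 := (f, p)))" if "T 1 = (f, p)" for T f p
  proof -
    have "T(1 := (f, p)) = T" using that by (metis fun_upd_triv)
    then show ?thesis using run_Nop[of T] by simp
  qed
  then have "run Nop 1 T (T(1 := (f, p + 2 * int 0)))" if "T 1 = (f, p)" for T f p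
    using that by (metis add.right_neutral mult_zero_right of_nat_0)
  then show ?case
    unfolding skip_tables.simps list.map sum_list.Nil
    using poly_bounded_const[of 1] by blast
next
  case (Cons k ks)
  from Cons.prems have "set ks \<subseteq> {..sum_list \<sigma>}" by simp
  from Cons.IH[OF this] obtain F where F: "poly_bounded F" "\<And>n T f p. scratch_ok n T \<Longrightarrow> T 1 = (f, p) \<Longrightarrow>
    run (skip_tables ks) (F n) T (T(1 := (f, p + 2 * int (sum_list (map ((^) n) ks)))))"
    by blast
  have "run (skip_tables (k # ks)) (Suc (nest_time k 3 n + F n)) T
      (T(1 := (f, p + 2 * int (sum_list (map ((^) n) (k # ks))))))"
    if T: "scratch_ok n T" "T 1 = (f, p)" for n T f p
  proof -
    have 1: "run (nest (scratch k) skip2) (nest_time k 3 n) T (T(1 := (f, p + 2 * int (n ^ k))))"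
      using run_nest_skip2[OF _ T] Cons.prems by auto
    have 2: "run (skip_tables ks) (F n) (T(1 := (f, p + 2 * int (n ^ k))))
        (T(1 := (f, p + 2 * int (sum_list (map ((^) n) (k # ks))))))"
      using F(2)[of n "T(1 := (f, p + 2 * int (n ^ k)))" f "p + 2 * int (n ^ k)"] T
      by (simp add: algebra_simps)
    show ?thesis using run_Seq[OF 1 2] by simp
  qed
  moreover have "poly_bounded (\<lambda>n. Suc (nest_time k 3 n + F n))"
    by (intro poly_bounded_intros F)
  ultimately show ?case by (intro exI[of _ "\<lambda>n. Suc (nest_time k 3 n + F n)"]) blast
qed

lemma run_skip_to_address:
  assumes "length vs \<le> sum_list \<sigma>"
  shows "\<exists>F. poly_bounded F \<and> (\<forall>n T f p xs. scratch_ok n T \<longrightarrow> T 1 = (f, p) \<longrightarrow>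
    (\<forall>v \<in> set vs. xs ! v < n \<and> T (var_tape v) = loop_tape n (xs ! v)) \<longrightarrow>
    run (skip_to_address (map var_tape vs)) (F n) T (T(1 := (f, p + 2 * int (address n (map ((!) xs) vs))))))"
  using assms
proof (induction vs)
  case Nil
  have "run Nop 1 T (T(1 := (f, p)))" if "T 1 = (f, p)" for T f p
  proof -
    have "T(1 := (f, p)) = T" using that by (metis fun_upd_triv)
    then show ?thesis using run_Nop[of T] by simp
  qed
  then have "run Nop 1 T (T(1 := (f, p + 2 * int 0)))" if "T 1 = (f, p)" for T f p
    using that by (metis add.right_neutral mult_zero_right of_nat_0)
  then show ?case
    unfolding skip_to_address.simps list.map address.simps
    using poly_bounded_const[of 1] by blast
next
  case (Cons v vs)
  from Cons.prems have "length vs \<le> sum_list \<sigma>" by simp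
  from Cons.IH[OF this] obtain F where F: "poly_bounded F" "\<And>n T f p xs. scratch_ok n T \<Longrightarrow> T 1 = (f, p) \<Longrightarrow>
      (\<forall>v \<in> set vs. xs ! v < n \<and> T (var_tape v) = loop_tape n (xs ! v)) \<Longrightarrow>
      run (skip_to_address (map var_tape vs)) (F n) T (T(1 := (f, p + 2 * int (address n (map ((!) xs) vs)))))"
    by blast
  let ?B = "\<lambda>n. n * (nest_time (length vs) 3 n + 5) + 20"
  let ?q = "nest (scratch (length vs)) skip2"
  have "run (skip_to_address (map var_tape (v # vs))) (Suc (?B n + F n)) T
      (T(1 := (f, p + 2 * int (address n (map ((!) xs) (v # vs))))))"
    if T: "scratch_ok n T" "T 1 = (f, p)"
      "\<forall>v \<in> set (v # vs). xs ! v < n \<and> T (var_tape v) = loop_tape n (xs ! v)" for n T f p xs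
  proof -
    let ?S = "\<lambda>i. T(1 := (f, p + 2 * int (i * n ^ length vs)))"
    have "run (repeat (var_tape v) ?q) (?B n)
        ((?S 0)(var_tape v := loop_tape n (xs ! v))) ((?S (xs ! v))(var_tape v := loop_tape n (xs ! v)))"
    proof (rule run_repeat[where S = ?S])
      fix i x
      have "run ?q (nest_time (length vs) 3 n) ((?S i)(var_tape v := x))
          (((?S i)(var_tape v := x))(1 := (f, p + 2 * int (i * n ^ length vs) + 2 * int (n ^ length vs))))"
        by (rule run_nest_skip2) (use T Cons.prems in auto)
      moreover have "((?S i)(var_tape v := x))(1 := (f, p + 2 * int (i * n ^ length vs) + 2 * int (n ^ length vs)))
          = (?S (Suc i))(var_tape v := x)"
        by (auto simp: fun_eq_iff algebra_simps)
      ultimately show "run ?q (nest_time (length vs) 3 n) ((?S i)(var_tape v := x)) ((?S (Suc i))(var_tape v := x))"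
        by metis
    qed (use T in auto)
    moreover have "(?S 0)(var_tape v := loop_tape n (xs ! v)) = T"
      "(?S (xs ! v))(var_tape v := loop_tape n (xs ! v)) = ?S (xs ! v)"
      using T by (auto simp: fun_eq_iff)
    ultimately have 1: "run (repeat (var_tape v) ?q) (?B n) T (?S (xs ! v))" by metis
    have 2: "run (skip_to_address (map var_tape vs)) (F n) (?S (xs ! v))
        (T(1 := (f, p + 2 * int (address n (map ((!) xs) (v # vs))))))"
      using F(2)[of n "?S (xs ! v)" f "p + 2 * int (xs ! v * n ^ length vs)" xs] T
      by (simp add: algebra_simps)
    show ?thesis using run_Seq[OF 1 2] by simp
  qed
  moreover have "poly_bounded (\<lambda>n. Suc (?B n + F n))"
    by (intro poly_bounded_intros F)
  ultimately show ?case by (intro exI[of _ "\<lambda>n. Suc (?B n + F n)"]) blast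
qed

text \<open>The bits False and True are the symbols 1 and 2, so the scan for 1 stops at the
  separator after the unary size.\<close>

definition lookup :: "nat \<Rightarrow> nat list \<Rightarrow> prog" where
  "lookup i vs = Whl 1 [1] (Mv 1 MoveRight) ;; Mv 1 MoveRight ;;
     skip_tables (take i \<sigma>) ;; skip_to_address (map var_tape vs)"

lemma ready_input: "ready w n xs T \<Longrightarrow> T 1 = (word_content w, 0)"
  by (simp add: ready_def word_tape_eq)

lemma ready_var:
  "ready w n xs T \<Longrightarrow> length xs \<le> D \<Longrightarrow> v < length xs \<Longrightarrow> T (var_tape v) = loop_tape n (xs ! v)"
  by (simp add: ready_def)

lemma run_lookup:
  assumes i: "i < length \<sigma>" "length vs = \<sigma> ! i"
  shows "\<exists>F. poly_bounded F \<and> (\<forall>n G T xs. ready (encode \<sigma> n G) n xs T \<longrightarrow> length xs \<le> D \<longrightarrow>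
    set xs \<subseteq> {..<n} \<longrightarrow> set vs \<subseteq> {..<length xs} \<longrightarrow>
    run (lookup i vs) (F n) T (T(1 := (word_content (encode \<sigma> n G),
      int (n + 1 + 2 * (table_offset \<sigma> n i + address n (map ((!) xs) vs)))))))"
proof -
  have "set (take i \<sigma>) \<subseteq> {..sum_list \<sigma>}"
    by (auto dest!: in_set_takeD intro: member_le_sum_list)
  from run_skip_tables[OF this] obtain F1 where F1: "poly_bounded F1"
    "\<And>n T f p. scratch_ok n T \<Longrightarrow> T 1 = (f, p) \<Longrightarrow>
      run (skip_tables (take i \<sigma>)) (F1 n) T (T(1 := (f, p + 2 * int (table_offset \<sigma> n i))))"
    unfolding table_offset_def by blast
  have "length vs \<le> sum_list \<sigma>"
    using i by (auto intro: member_le_sum_list)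
  from run_skip_to_address[OF this] obtain F2 where F2: "poly_bounded F2"
    "\<And>n T f p xs. scratch_ok n T \<Longrightarrow> T 1 = (f, p) \<Longrightarrow>
      (\<forall>v \<in> set vs. xs ! v < n \<and> T (var_tape v) = loop_tape n (xs ! v)) \<Longrightarrow>
      run (skip_to_address (map var_tape vs)) (F2 n) T (T(1 := (f, p + 2 * int (address n (map ((!) xs) vs)))))"
    by blast
  let ?F = "\<lambda>n. Suc (Suc (n * 2) + Suc (1 + Suc (F1 n + F2 n)))"
  have "run (lookup i vs) (?F n) T (T(1 := (word_content (encode \<sigma> n G),
      int (n + 1 + 2 * (table_offset \<sigma> n i + address n (map ((!) xs) vs))))))"
    if T: "ready (encode \<sigma> n G) n xs T" "length xs \<le> D" "set xs \<subseteq> {..<n}" "set vs \<subseteq> {..<length xs}"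
    for n G T xs
  proof -
    define f where "f = word_content (encode \<sigma> n G)"
    let ?h = "n + 1 + 2 * table_offset \<sigma> n i"
    have T1: "T 1 = (f, 0)" using ready_input[OF T(1)] by (simp add: f_def)
    have f: "f (int j) = 2" if "j < n" for j
      using that word_content_nth[of j "encode \<sigma> n G"]
      by (simp add: f_def length_encode encode_eq nth_append)
    have fn: "f (int n) = 1"
      using word_content_nth[of n "encode \<sigma> n G"] by (simp add: f_def length_encode encode_eq nth_append)
    have "run (Whl 1 [1] (Mv 1 MoveRight)) (Suc (n * 2)) T (T(1 := (f, 0 + offset MoveRight * int n)))"
      by (rule run_scan[where T = T, OF T1]) (use f fn in auto)
    then have 1: "run (Whl 1 [1] (Mv 1 MoveRight)) (Suc (n * 2)) T (T(1 := (f, int n)))" by simp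
    have 2: "run (Mv 1 MoveRight) 1 (T(1 := (f, int n))) (T(1 := (f, int (n + 1))))"
      using run_Mv[of "T(1 := (f, int n))" 1 f "int n" MoveRight] by (simp add: add.commute)
    have sc: "scratch_ok n T" using T(1) by (simp add: ready_def)
    have 3: "run (skip_tables (take i \<sigma>)) (F1 n) (T(1 := (f, int (n + 1)))) (T(1 := (f, int ?h)))"
      using F1(2)[of n "T(1 := (f, int (n + 1)))" f "int (n + 1)"] sc by (simp add: algebra_simps)
    have "xs ! v < n \<and> T (var_tape v) = loop_tape n (xs ! v)" if "v \<in> set vs" for v
      using ready_var[OF T(1,2)] T(3,4) that nth_mem by blast
    then have 4: "run (skip_to_address (map var_tape vs)) (F2 n) (T(1 := (f, int ?h)))
        (T(1 := (f, int (n + 1 + 2 * (table_offset \<sigma> n i + address n (map ((!) xs) vs))))))"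
      using F2(2)[of n "T(1 := (f, int ?h))" f "int ?h" xs] sc by (simp add: algebra_simps)
    show ?thesis
      unfolding lookup_def f_def[symmetric] by (rule run_Seq[OF 1 run_Seq[OF 2 run_Seq[OF 3 4]]])
  qed
  moreover have "poly_bounded ?F" by (intro poly_bounded_intros F1 F2)
  ultimately show ?thesis by (intro exI[of _ ?F]) blast
qed

text \<open>The truth value is returned in the flag on tape 2. For \<open>Ex\<close> the flag is at
  the same time the running disjunction: the body is evaluated only while the flag is false, so
  overwriting it loses nothing.\<close>

primrec eval_prog :: "fm \<Rightarrow> nat \<Rightarrow> prog" where
  "eval_prog (Rel i vs a) d = lookup i vs ;; test_value a"
| "eval_prog (Neg \<phi>) d = eval_prog \<phi> d ;; Ife 2 [0] (Wr 2 1) (Wr 2 0)"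
| "eval_prog (Conj \<phi> \<psi>) d = eval_prog \<phi> d ;; Ife 2 [0] Nop (eval_prog \<psi> d)"
| "eval_prog (Ex \<phi>) d = Wr 2 0 ;; for_loop (var_tape d) (Ife 2 [0] (eval_prog \<phi> (Suc d)) Nop)"

lemma ready_flag: "ready w n xs T \<Longrightarrow> ready w n xs (T(2 := flag_tape b))"
  unfolding ready_def by auto

lemma ready_output: "ready w n xs T \<Longrightarrow> ready w n xs (T(0 := x))"
  unfolding ready_def by auto

lemma ready_extend:
  "ready w n xs T \<Longrightarrow> ready w n (xs @ [a]) (T(var_tape (length xs) := loop_tape n a))"
  unfolding ready_def by (auto simp: nth_append)

lemma ready_loop_tape:
  "ready w n xs T \<Longrightarrow> length xs < D \<Longrightarrow> T(var_tape (length xs) := loop_tape n 0) = T"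
  unfolding ready_def by (auto simp: fun_eq_iff)

lemma ready_flagE:
  assumes "ready w n xs T"
  obtains b where "T 2 = flag_tape b"
  using assms unfolding ready_def by auto

definition evaluates :: "(nat \<Rightarrow> nat) \<Rightarrow> fm \<Rightarrow> nat \<Rightarrow> bool" where
  "evaluates F \<phi> d \<longleftrightarrow> (\<forall>n G xs T. length xs = d \<longrightarrow> set xs \<subseteq> {..<n} \<longrightarrow>
    ready (encode \<sigma> n G) n xs T \<longrightarrow>
    run (eval_prog \<phi> d) (F n) T (T(2 := flag_tape (sat n G xs \<phi>))))"

lemma evaluatesD:
  assumes "evaluates F \<phi> d" "ready (encode \<sigma> n G) n xs T" "length xs = d" "set xs \<subseteq> {..<n}"
  shows "run (eval_prog \<phi> d) (F n) T (T(2 := flag_tape (sat n G xs \<phi>)))"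
  using assms unfolding evaluates_def by blast

lemma evaluates_Rel:
  assumes "fm_ok \<sigma> d (Rel i vs a)" "d \<le> D"
  shows "\<exists>F. poly_bounded F \<and> evaluates F (Rel i vs a) d"
proof -
  have i: "i < length \<sigma>" "length vs = \<sigma> ! i" using assms by auto
  from run_lookup[OF i] obtain F where F: "poly_bounded F"
    "\<And>n G T xs. ready (encode \<sigma> n G) n xs T \<Longrightarrow> length xs \<le> D \<Longrightarrow>
      set xs \<subseteq> {..<n} \<Longrightarrow> set vs \<subseteq> {..<length xs} \<Longrightarrow>
      run (lookup i vs) (F n) T (T(1 := (word_content (encode \<sigma> n G),
        int (n + 1 + 2 * (table_offset \<sigma> n i + address n (map ((!) xs) vs))))))"
    by blast
  let ?H = "\<lambda>n. Suc (F n + (2 * (n + 1 + 2 * sum_list (map ((^) n) \<sigma>)) + 20))"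
  have "run (eval_prog (Rel i vs a) d) (?H n) T (T(2 := flag_tape (sat n G xs (Rel i vs a))))"
    if T: "length xs = d" "set xs \<subseteq> {..<n}" "ready (encode \<sigma> n G) n xs T" for n G xs T
  proof -
    let ?w = "encode \<sigma> n G" and ?ts = "map ((!) xs) vs"
    let ?h = "n + 1 + 2 * (table_offset \<sigma> n i + address n ?ts)"
    let ?T1 = "T(1 := (word_content ?w, int ?h))"
    have vs: "set vs \<subseteq> {..<length xs}" using assms T by auto
    have 1: "run (lookup i vs) (F n) T ?T1"
      using F(2)[OF T(3) _ T(2) vs] T(1) assms(2) by simp
    have "xs ! v < n" if "v \<in> set vs" for v
      using that vs T(2) nth_mem by blast
    then have ts: "length ?ts = \<sigma> ! i" "set ?ts \<subseteq> {..<n}"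
      using i(2) by auto
    obtain b where b: "T 2 = flag_tape b" using ready_flagE[OF T(3)] .
    have "run (test_value a) (2 * length ?w + 20) ?T1
        (?T1(1 := word_tape ?w, 2 := flag_tape (interp G i ?ts = a)))"
      by (rule run_test_value[OF _ _ encode_nth_value[OF i(1) ts]]) (use b in auto)
    moreover have "?T1(1 := word_tape ?w, 2 := flag_tape (interp G i ?ts = a))
        = T(2 := flag_tape (interp G i ?ts = a))"
      using T(3) by (auto simp: ready_def fun_eq_iff)
    ultimately have 2: "run (test_value a) (2 * length ?w + 20) ?T1 (T(2 := flag_tape (sat n G xs (Rel i vs a))))"
      by simp
    show ?thesis
      using run_Seq[OF 1 2] by (simp add: length_encode)
  qed
  moreover have "poly_bounded ?H" by (intro poly_bounded_intros F)
  ultimately show ?thesis unfolding evaluates_def by blast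
qed

lemma evaluates_Neg:
  assumes "evaluates F \<phi> d"
  shows "evaluates (\<lambda>n. Suc (F n + Suc 1)) (Neg \<phi>) d"
  unfolding evaluates_def
proof (intro allI impI)
  fix n G xs T
  assume T: "length xs = d" "set xs \<subseteq> {..<n}" "ready (encode \<sigma> n G) n xs T"
  let ?T1 = "T(2 := flag_tape (sat n G xs \<phi>))"
  have 1: "run (eval_prog \<phi> d) (F n) T ?T1" using assms T unfolding evaluates_def by blast
  have 2: "run (Ife 2 [0] (Wr 2 1) (Wr 2 0)) (Suc 1) ?T1 (T(2 := flag_tape (sat n G xs (Neg \<phi>))))"
  proof (rule run_Ife)
    assume "rd ?T1 2 \<in> set [0]"
    then show "run (Wr 2 1) 1 ?T1 (T(2 := flag_tape (sat n G xs (Neg \<phi>))))"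
      using run_set_flag[of ?T1 2 "sat n G xs \<phi>"] by (simp split: if_splits)
  next
    assume "rd ?T1 2 \<notin> set [0]"
    then show "run (Wr 2 0) 1 ?T1 (T(2 := flag_tape (sat n G xs (Neg \<phi>))))"
      using run_clear_flag[of ?T1 2 "sat n G xs \<phi>"] by (simp split: if_splits)
  qed
  show "run (eval_prog (Neg \<phi>) d) (Suc (F n + Suc 1)) T (T(2 := flag_tape (sat n G xs (Neg \<phi>))))"
    using run_Seq[OF 1 2] by simp
qed

lemma evaluates_Conj:
  assumes "evaluates F \<phi> d" "evaluates H \<psi> d"
  shows "evaluates (\<lambda>n. Suc (F n + Suc (H n + 1))) (Conj \<phi> \<psi>) d"
  unfolding evaluates_def
proof (intro allI impI)
  fix n G xs T
  assume T: "length xs = d" "set xs \<subseteq> {..<n}" "ready (encode \<sigma> n G) n xs T"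
  let ?T1 = "T(2 := flag_tape (sat n G xs \<phi>))"
  have 1: "run (eval_prog \<phi> d) (F n) T ?T1" using assms(1) T unfolding evaluates_def by blast
  have H: "run (eval_prog \<psi> d) (H n) ?T1 (?T1(2 := flag_tape (sat n G xs \<psi>)))"
    using assms(2) T ready_flag[OF T(3)] unfolding evaluates_def by blast
  have 2: "run (Ife 2 [0] Nop (eval_prog \<psi> d)) (Suc (H n + 1)) ?T1 (T(2 := flag_tape (sat n G xs (Conj \<phi> \<psi>))))"
  proof (rule run_Ife)
    assume "rd ?T1 2 \<in> set [0]"
    then have "\<not> sat n G xs \<phi>" by (simp split: if_splits)
    then show "run Nop (H n + 1) ?T1 (T(2 := flag_tape (sat n G xs (Conj \<phi> \<psi>))))"
      using run_mono[OF run_Nop, of "H n + 1" ?T1] by simp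
  next
    assume "rd ?T1 2 \<notin> set [0]"
    then have "sat n G xs \<phi>" by (simp split: if_splits)
    then show "run (eval_prog \<psi> d) (H n + 1) ?T1 (T(2 := flag_tape (sat n G xs (Conj \<phi> \<psi>))))"
      using run_mono[OF H, of "H n + 1"] by simp
  qed
  show "run (eval_prog (Conj \<phi> \<psi>) d) (Suc (F n + Suc (H n + 1))) T
      (T(2 := flag_tape (sat n G xs (Conj \<phi> \<psi>))))"
    using run_Seq[OF 1 2] by simp
qed

lemma evaluates_Ex:
  assumes "evaluates F \<phi> (Suc d)" "d < D"
  shows "evaluates (\<lambda>n. Suc (1 + (n * (Suc (F n + 1) + 5) + 20))) (Ex \<phi>) d"
  unfolding evaluates_def
proof (intro allI impI)
  fix n G xs T
  assume T: "length xs = d" "set xs \<subseteq> {..<n}" "ready (encode \<sigma> n G) n xs T"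
  obtain b where "T 2 = flag_tape b" using ready_flagE[OF T(3)] .
  then have 1: "run (Wr 2 0) 1 T (T(2 := flag_tape False))" by (rule run_clear_flag)
  let ?ex = "\<lambda>a. \<exists>x<a. sat n G (xs @ [x]) \<phi>"
  let ?S = "\<lambda>a. T(2 := flag_tape (?ex a))"
  let ?q = "Ife 2 [0] (eval_prog \<phi> (Suc d)) Nop"
  have "run (for_loop (var_tape d) ?q) (n * (Suc (F n + 1) + 5) + 20)
      ((?S 0)(var_tape d := loop_tape n 0)) ((?S n)(var_tape d := loop_tape n 0))"
  proof (rule run_for_loop[where S = ?S])
    fix a assume a: "a < n"
    let ?U = "(?S a)(var_tape d := loop_tape n a)"
    have "ready (encode \<sigma> n G) n (xs @ [a]) ?U"
      using ready_extend[OF ready_flag[OF T(3)]] T(1) by blast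
    then have body: "run (eval_prog \<phi> (Suc d)) (F n) ?U (?U(2 := flag_tape (sat n G (xs @ [a]) \<phi>)))"
      by (rule evaluatesD[OF assms(1)]) (use T a in auto)
    show "run ?q (Suc (F n + 1)) ?U ((?S (Suc a))(var_tape d := loop_tape n a))"
    proof (rule run_Ife)
      assume "rd ?U 2 \<in> set [0]"
      then have "\<not> ?ex a" by (simp split: if_splits)
      then have "?ex (Suc a) \<longleftrightarrow> sat n G (xs @ [a]) \<phi>" using less_Suc_eq by auto
      then have "(?S (Suc a))(var_tape d := loop_tape n a) = ?U(2 := flag_tape (sat n G (xs @ [a]) \<phi>))"
        by (simp add: fun_upd_twist)
      then show "run (eval_prog \<phi> (Suc d)) (F n + 1) ?U ((?S (Suc a))(var_tape d := loop_tape n a))"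
        using run_mono[OF body, of "F n + 1"] by simp
    next
      assume "rd ?U 2 \<notin> set [0]"
      then have "?ex a" by (cases "?ex a") simp_all
      then have "?ex (Suc a) \<longleftrightarrow> ?ex a" by (meson less_SucI)
      then have "(?S (Suc a))(var_tape d := loop_tape n a) = ?U" by presburger
      then show "run Nop (F n + 1) ?U ((?S (Suc a))(var_tape d := loop_tape n a))"
        using run_mono[OF run_Nop, of "F n + 1" ?U] by simp
    qed
  qed
  moreover have "(?S a)(var_tape d := loop_tape n 0) = ?S a" for a
    using ready_loop_tape[OF ready_flag[OF T(3)]] T(1) assms(2) by simp
  ultimately have "run (for_loop (var_tape d) ?q) (n * (Suc (F n + 1) + 5) + 20) (?S 0) (?S n)"
    by (simp only:)
  then have 2: "run (for_loop (var_tape d) ?q) (n * (Suc (F n + 1) + 5) + 20)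
      (T(2 := flag_tape False)) (T(2 := flag_tape (sat n G xs (Ex \<phi>))))"
    by simp
  show "run (eval_prog (Ex \<phi>) d) (Suc (1 + (n * (Suc (F n + 1) + 5) + 20))) T
      (T(2 := flag_tape (sat n G xs (Ex \<phi>))))"
    using run_Seq[OF 1 2] by simp
qed

lemma eval_prog_correct:
  "fm_ok \<sigma> d \<phi> \<Longrightarrow> d + fm_depth \<phi> \<le> D \<Longrightarrow> \<exists>F. poly_bounded F \<and> evaluates F \<phi> d"
proof (induction \<phi> arbitrary: d)
  case (Rel i vs a)
  then show ?case by (intro evaluates_Rel) auto
next
  case (Neg \<phi>)
  then obtain F where F: "poly_bounded F" "evaluates F \<phi> d" by auto
  have "poly_bounded (\<lambda>n. Suc (F n + Suc 1))" by (intro poly_bounded_intros F)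
  with evaluates_Neg[OF F(2)] show ?case by blast
next
  case (Conj \<phi> \<psi>)
  then obtain F H where F: "poly_bounded F" "evaluates F \<phi> d" "poly_bounded H" "evaluates H \<psi> d" by fastforce
  have "poly_bounded (\<lambda>n. Suc (F n + Suc (H n + 1)))" by (intro poly_bounded_intros F)
  with evaluates_Conj[OF F(2,4)] show ?case by blast
next
  case (Ex \<phi>)
  then obtain F where F: "poly_bounded F" "evaluates F \<phi> (Suc d)" by fastforce
  have "poly_bounded (\<lambda>n. Suc (1 + (n * (Suc (F n + 1) + 5) + 20)))" by (intro poly_bounded_intros F)
  moreover have "d < D" using Ex.prems by simp
  ultimately show ?case using evaluates_Ex[OF F(2)] by blast
qed

text \<open>Commands start and end with a cleared flag, so that a command changes nothing but the
  output tape. In \<open>Cond\<close> only the branch for a true formula has to clear it.\<close>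

primrec compile :: "cmd \<Rightarrow> nat \<Rightarrow> prog" where
  "compile Skip d = Nop"
| "compile (Emit b) d = Wr 0 (bit_symbol b) ;; Mv 0 MoveRight"
| "compile (Sequ c e) d = compile c d ;; compile e d"
| "compile (Cond \<phi> c e) d = eval_prog \<phi> d ;; Ife 2 [0] (compile e d) (Wr 2 0 ;; compile c d)"
| "compile (Loop c) d = for_loop (var_tape d) (compile c (Suc d))"

definition end_tape :: "bool list \<Rightarrow> tape" where
  "end_tape x = (word_content x, int (length x))"

definition implements :: "(nat \<Rightarrow> nat) \<Rightarrow> cmd \<Rightarrow> nat \<Rightarrow> bool" where
  "implements F c d \<longleftrightarrow> (\<forall>n G xs T x. length xs = d \<longrightarrow> set xs \<subseteq> {..<n} \<longrightarrow>
    ready (encode \<sigma> n G) n xs T \<longrightarrow> T 2 = flag_tape False \<longrightarrow>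
    run (compile c d) (F n) (T(0 := end_tape x)) (T(0 := end_tape (x @ emits n G xs c))))"

lemma implementsD:
  assumes "implements F c d" "ready (encode \<sigma> n G) n xs T" "T 2 = flag_tape False"
    "length xs = d" "set xs \<subseteq> {..<n}"
  shows "run (compile c d) (F n) (T(0 := end_tape x)) (T(0 := end_tape (x @ emits n G xs c)))"
  using assms unfolding implements_def by blast

lemma implements_Skip: "implements (\<lambda>_. 1) Skip d"
  unfolding implements_def using run_Nop by simp

lemma implements_Emit: "implements (\<lambda>_. 3) (Emit b) d"
  unfolding implements_def
proof (intro allI impI)
  fix n G xs T x
  let ?f = "word_content (x @ [b])"
  have 1: "run (Wr 0 (bit_symbol b)) 1 (T(0 := end_tape x)) (T(0 := (?f, int (length x))))"
    using run_Wr[of "T(0 := end_tape x)" 0 "word_content x" "int (length x)" "bit_symbol b"]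
    by (simp add: end_tape_def word_content_snoc)
  have 2: "run (Mv 0 MoveRight) 1 (T(0 := (?f, int (length x)))) (T(0 := end_tape (x @ [b])))"
    using run_Mv[of "T(0 := (?f, int (length x)))" 0 ?f "int (length x)" MoveRight]
    by (simp add: end_tape_def add.commute)
  show "run (compile (Emit b) d) 3 (T(0 := end_tape x)) (T(0 := end_tape (x @ emits n G xs (Emit b))))"
    using run_mono[OF run_Seq[OF 1 2], of 3] by simp
qed

lemma implements_Sequ:
  assumes "implements F c d" "implements H e d"
  shows "implements (\<lambda>n. Suc (F n + H n)) (Sequ c e) d"
  unfolding implements_def
proof (intro allI impI)
  fix n G xs T x
  assume T: "length xs = d" "set xs \<subseteq> {..<n}" "ready (encode \<sigma> n G) n xs T" "T 2 = flag_tape False"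
  let ?y = "x @ emits n G xs c"
  have 1: "run (compile c d) (F n) (T(0 := end_tape x)) (T(0 := end_tape ?y))"
    using assms(1) T unfolding implements_def by blast
  have 2: "run (compile e d) (H n) (T(0 := end_tape ?y)) (T(0 := end_tape (?y @ emits n G xs e)))"
    using assms(2) T unfolding implements_def by blast
  show "run (compile (Sequ c e) d) (Suc (F n + H n)) (T(0 := end_tape x))
      (T(0 := end_tape (x @ emits n G xs (Sequ c e))))"
    using run_Seq[OF 1 2] by simp
qed

lemma implements_Cond:
  assumes "evaluates E \<phi> d" "implements F c d" "implements H e d"
  shows "implements (\<lambda>n. Suc (E n + Suc (H n + Suc (1 + F n)))) (Cond \<phi> c e) d"
  unfolding implements_def
proof (intro allI impI)
  fix n G xs T x
  assume T: "length xs = d" "set xs \<subseteq> {..<n}" "ready (encode \<sigma> n G) n xs T" "T 2 = flag_tape False"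
  let ?s = "sat n G xs \<phi>"
  let ?T0 = "T(0 := end_tape x)" and ?T1 = "T(0 := end_tape x, 2 := flag_tape (sat n G xs \<phi>))"
  let ?V = "T(0 := end_tape (x @ emits n G xs (Cond \<phi> c e)))"
  have 1: "run (eval_prog \<phi> d) (E n) ?T0 ?T1"
    using assms(1) T ready_output[OF T(3)] unfolding evaluates_def by blast
  have T2: "T(0 := end_tape x, 2 := flag_tape False) = ?T0"
    using T(4) by (auto simp: fun_eq_iff)
  have 2: "run (Ife 2 [0] (compile e d) (Wr 2 0 ;; compile c d)) (Suc (H n + Suc (1 + F n))) ?T1 ?V"
  proof (rule run_Ife)
    assume "rd ?T1 2 \<in> set [0]"
    then have s: "\<not> ?s" by (simp split: if_splits)
    have "run (compile e d) (H n) ?T0 (T(0 := end_tape (x @ emits n G xs e)))"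
      using assms(3) T unfolding implements_def by blast
    then show "run (compile e d) (H n + Suc (1 + F n)) ?T1 ?V"
      using s T2 by (auto intro: run_mono)
  next
    assume "rd ?T1 2 \<notin> set [0]"
    then have s: "?s" by (simp split: if_splits)
    have 1: "run (Wr 2 0) 1 ?T1 ?T0"
      using run_clear_flag[of ?T1 2 ?s] T2 by simp
    have 2: "run (compile c d) (F n) ?T0 (T(0 := end_tape (x @ emits n G xs c)))"
      using assms(2) T unfolding implements_def by blast
    show "run (Wr 2 0 ;; compile c d) (H n + Suc (1 + F n)) ?T1 ?V"
      using run_mono[OF run_Seq[OF 1 2], of "H n + Suc (1 + F n)"] s by simp
  qed
  show "run (compile (Cond \<phi> c e) d) (Suc (E n + Suc (H n + Suc (1 + F n)))) ?T0 ?V"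
    using run_Seq[OF 1 2] by simp
qed

lemma implements_Loop:
  assumes "implements F c (Suc d)" "d < D"
  shows "implements (\<lambda>n. n * (F n + 5) + 20) (Loop c) d"
  unfolding implements_def
proof (intro allI impI)
  fix n G xs T x
  assume T: "length xs = d" "set xs \<subseteq> {..<n}" "ready (encode \<sigma> n G) n xs T" "T 2 = flag_tape False"
  let ?o = "\<lambda>a. x @ concat (map (\<lambda>y. emits n G (xs @ [y]) c) [0..<a])"
  let ?S = "\<lambda>a. T(0 := end_tape (?o a))"
  have "run (for_loop (var_tape d) (compile c (Suc d))) (n * (F n + 5) + 20)
      ((?S 0)(var_tape d := loop_tape n 0)) ((?S n)(var_tape d := loop_tape n 0))"
  proof (rule run_for_loop[where S = ?S])
    fix a assume a: "a < n"
    let ?U = "T(var_tape d := loop_tape n a)"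
    have "ready (encode \<sigma> n G) n (xs @ [a]) ?U"
      using ready_extend[OF T(3)] T(1) by blast
    then have "run (compile c (Suc d)) (F n) (?U(0 := end_tape (?o a)))
        (?U(0 := end_tape (?o a @ emits n G (xs @ [a]) c)))"
      by (rule implementsD[OF assms(1)]) (use T a in auto)
    then show "run (compile c (Suc d)) (F n) ((?S a)(var_tape d := loop_tape n a))
        ((?S (Suc a))(var_tape d := loop_tape n a))"
      by (simp add: fun_upd_twist)
  qed
  moreover have "(?S a)(var_tape d := loop_tape n 0) = ?S a" for a
    using ready_loop_tape[OF ready_output[OF T(3)]] T(1) assms(2) by simp
  ultimately have "run (for_loop (var_tape d) (compile c (Suc d))) (n * (F n + 5) + 20) (?S 0) (?S n)"
    by (simp only:)
  then show "run (compile (Loop c) d) (n * (F n + 5) + 20) (T(0 := end_tape x))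
      (T(0 := end_tape (x @ emits n G xs (Loop c))))"
    by simp
qed

lemma compile_correct:
  "cmd_ok \<sigma> d c \<Longrightarrow> d + cmd_depth c \<le> D \<Longrightarrow> \<exists>F. poly_bounded F \<and> implements F c d"
proof (induction c arbitrary: d)
  case Skip
  then show ?case using implements_Skip poly_bounded_const by blast
next
  case (Emit b)
  then show ?case using implements_Emit poly_bounded_const by blast
next
  case (Sequ c e)
  then obtain F H where F: "poly_bounded F" "implements F c d" "poly_bounded H" "implements H e d" by fastforce
  have "poly_bounded (\<lambda>n. Suc (F n + H n))" by (intro poly_bounded_intros F)
  with implements_Sequ[OF F(2,4)] show ?case by blast
next
  case (Cond \<phi> c e)
  then obtain F H where F: "poly_bounded F" "implements F c d" "poly_bounded H" "implements H e d" by fastforce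
  have "fm_ok \<sigma> d \<phi>" "d + fm_depth \<phi> \<le> D" using Cond.prems by auto
  from eval_prog_correct[OF this] obtain E where E: "poly_bounded E" "evaluates E \<phi> d" by blast
  have "poly_bounded (\<lambda>n. Suc (E n + Suc (H n + Suc (1 + F n))))" by (intro poly_bounded_intros E F)
  with implements_Cond[OF E(2) F(2,4)] show ?case by blast
next
  case (Loop c)
  then obtain F where F: "poly_bounded F" "implements F c (Suc d)" by fastforce
  have "poly_bounded (\<lambda>n. n * (F n + 5) + 20)" by (intro poly_bounded_intros F)
  moreover have "d < D" using Loop.prems by simp
  ultimately show ?case using implements_Loop[OF F(2)] by blast
qed

end


text \<open>Polynomials over the natural numbers are monotone, so a bound in the domain size may be
  evaluated at the input length instead.\<close>

lemma poly_bounded_mono: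
  assumes "poly_bounded F"
  obtains q :: "nat poly" where "\<And>n m. n \<le> m \<Longrightarrow> F n \<le> poly q m"
  using assms poly_nat_mono unfolding poly_bounded_def by (meson le_trans)

text \<open>The final rewinding of the output tape takes time proportional to the length of the
  output.\<close>

lemma emits_length_bounded: "\<exists>F. poly_bounded F \<and> (\<forall>n G xs. length (emits n G xs c) \<le> F n)"
proof (induction c)
  case Skip
  show ?case using poly_bounded_const[of 0] by (intro exI[of _ "\<lambda>_. 0"]) simp
next
  case (Emit b)
  show ?case using poly_bounded_const[of 1] by (intro exI[of _ "\<lambda>_. 1"]) simp
next
  case (Sequ c e)
  then obtain F H where F: "poly_bounded F" "\<And>n G xs. length (emits n G xs c) \<le> F n"
    "poly_bounded H" "\<And>n G xs. length (emits n G xs e) \<le> H n" by blast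
  then show ?case
    by (intro exI[of _ "\<lambda>n. F n + H n"]) (auto intro: poly_bounded_intros add_mono)
next
  case (Cond \<phi> c e)
  then obtain F H where F: "poly_bounded F" "\<And>n G xs. length (emits n G xs c) \<le> F n"
    "poly_bounded H" "\<And>n G xs. length (emits n G xs e) \<le> H n" by blast
  then show ?case
    by (intro exI[of _ "\<lambda>n. F n + H n"]) (auto intro: poly_bounded_intros trans_le_add1 trans_le_add2)
next
  case (Loop c)
  then obtain F where F: "poly_bounded F" "\<And>n G xs. length (emits n G xs c) \<le> F n" by blast
  have "length (emits n G xs (Loop c)) \<le> n * F n" for n G xs
  proof -
    have "sum_list (map (\<lambda>x. length (emits n G (xs @ [x]) c)) [0..<n]) \<le> sum_list (map (\<lambda>_. F n) [0..<n])"
      by (rule sum_list_mono) (rule F(2))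
    then show ?thesis by (simp add: length_concat comp_def sum_list_triv)
  qed
  moreover have "poly_bounded (\<lambda>n. n * F n)" by (intro poly_bounded_intros F)
  ultimately show ?case by blast
qed


subsection \<open>Recognising encodings\<close>

definition unary_prefix :: "bool list \<Rightarrow> nat" where
  "unary_prefix w = length (takeWhile id w)"

text \<open>In terms of tape symbols. The pair (2, 1) is left out because
  \<open>encode_value\<close> never produces it, and pairs with a blank fail, which detects words
  that are too short.\<close>

definition value_code :: "nat \<Rightarrow> nat \<Rightarrow> bool" where
  "value_code a b \<longleftrightarrow> a = 1 \<and> (b = 1 \<or> b = 2) \<or> a = 2 \<and> b = 2"

text \<open>Phrased in terms of cells of the tape, beyond the end of the word if necessary, because
  this is what a machine can check.\<close>

definition well_formed :: "signature \<Rightarrow> bool list \<Rightarrow> bool" where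
  "well_formed \<sigma> w \<longleftrightarrow>
     (let n = unary_prefix w; M = sum_list (map ((^) n) \<sigma>); f = word_content w in
       f (int n) \<noteq> 0 \<and>
       (\<forall>j<M. value_code (f (int n + 1 + 2 * int j)) (f (int n + 1 + 2 * int j + 1))) \<and>
       f (int n + 1 + 2 * int M) = 0)"

lemma word_content_eq_0 [simp]: "word_content w (int j) = 0 \<longleftrightarrow> length w \<le> j"
  by (auto simp: word_content_def)

lemma split_unary_prefix:
  assumes "unary_prefix w < length w"
  shows "w = replicate (unary_prefix w) True @ False # drop (Suc (unary_prefix w)) w"
proof -
  let ?n = "unary_prefix w"
  have "takeWhile id w = replicate ?n True"
    unfolding unary_prefix_def by (rule replicate_eqI) (auto dest: set_takeWhileD)
  then have "take ?n w = replicate ?n True"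
    by (simp add: unary_prefix_def takeWhile_eq_take[symmetric])
  moreover have "\<not> w ! ?n"
    using nth_length_takeWhile[of id w] assms by (simp add: unary_prefix_def)
  ultimately show ?thesis
    using id_take_nth_drop[OF assms] by simp
qed

lemma unary_prefix_replicate [simp]: "unary_prefix (replicate n True @ False # r) = n"
  by (induction n) (auto simp: unary_prefix_def)

lemma decode_values:
  assumes "length r = 2 * M" "\<And>j. j < M \<Longrightarrow> r ! (2 * j) \<Longrightarrow> r ! Suc (2 * j)"
  shows "\<exists>vs. length vs = M \<and> r = concat (map encode_value vs)"
  using assms
proof (induction M arbitrary: r)
  case (Suc M)
  then obtain a b r' where r: "r = a # b # r'" by (cases r; cases "tl r") auto
  have "\<exists>vs. length vs = M \<and> r' = concat (map encode_value vs)"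
  proof (rule Suc.IH)
    show "r' ! Suc (2 * j)" if "j < M" "r' ! (2 * j)" for j
      using Suc.prems(2)[of "Suc j"] that by (simp add: r)
  qed (use Suc.prems(1) r in simp)
  then obtain vs where vs: "length vs = M" "r' = concat (map encode_value vs)" by blast
  have "a \<Longrightarrow> b" using Suc.prems(2)[of 0] by (simp add: r)
  then have "\<exists>v. encode_value v = [a, b]"
    by (metis (full_types) encode_value.simps)
  then obtain v where "encode_value v = [a, b]" by blast
  then show ?case using vs by (intro exI[of _ "v # vs"]) (simp add: r)
qed simp

lemma map_interp_surj: "distinct ts \<Longrightarrow> length vs = length ts \<Longrightarrow> \<exists>g. map g ts = vs"
proof (induction ts arbitrary: vs)
  case (Cons t ts)
  then obtain v vs' where v: "vs = v # vs'" "length vs' = length ts" by (cases vs) auto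
  with Cons obtain g where "map g ts = vs'" by auto
  with Cons.prems(1) v show ?case
    by (intro exI[of _ "g(t := v)"]) (auto simp: map_idI)
qed simp

lemma table_values_cong:
  "(\<And>i. i < length \<sigma> \<Longrightarrow> interp G i = interp H i) \<Longrightarrow> table_values \<sigma> n G = table_values \<sigma> n H"
  unfolding table_values_def by (intro arg_cong[of _ _ concat] map_cong) auto

text \<open>The tuples listed in a table are pairwise distinct, so their values can be prescribed
  independently, and the last table concerns a symbol that the earlier ones do not mention.\<close>

lemma table_values_surj:
  assumes "length vs = sum_list (map ((^) n) \<sigma>)"
  shows "\<exists>G. table_values \<sigma> n G = vs"
  using assms
proof (induction \<sigma> arbitrary: vs rule: rev_induct)
  case Nil
  then show ?case by (simp add: table_values_def)
next
  case (snoc k \<sigma>)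
  let ?us = "take (sum_list (map ((^) n) \<sigma>)) vs" and ?ws = "drop (sum_list (map ((^) n) \<sigma>)) vs"
  let ?P = "product_lists (replicate k [0..<n])"
  have "length ?us = sum_list (map ((^) n) \<sigma>)" "length ?ws = length ?P"
    using snoc.prems by (auto simp: length_product_lists_upt)
  moreover have "distinct ?P" by (rule distinct_product_lists) auto
  ultimately obtain G g where G: "table_values \<sigma> n G = ?us" and g: "map g ?P = ?ws"
    using snoc.IH map_interp_surj by metis
  let ?H = "G\<lparr>interp := (interp G)(length \<sigma> := g)\<rparr>"
  have "table_values (\<sigma> @ [k]) n ?H = table_values \<sigma> n ?H @ map g ?P"
    by (auto simp: table_values_def nth_append intro!: arg_cong[of _ _ concat] map_cong)
  also have "table_values \<sigma> n ?H = table_values \<sigma> n G"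
    by (rule table_values_cong) simp
  finally show ?case using G g by (metis append_take_drop_id)
qed

lemma well_formed_encode: "well_formed \<sigma> (encode \<sigma> n G)"
proof -
  let ?w = "encode \<sigma> n G" and ?M = "sum_list (map ((^) n) \<sigma>)"
  let ?r = "concat (map encode_value (table_values \<sigma> n G))"
  have n: "unary_prefix ?w = n" by (simp add: encode_eq)
  have "value_code (word_content ?w (int n + 1 + 2 * int j)) (word_content ?w (int n + 1 + 2 * int j + 1))"
    if j: "j < ?M" for j
  proof -
    have len: "j < length (table_values \<sigma> n G)" using j by (simp add: length_table_values)
    have "n + 1 + 2 * j + 1 < length ?w" using j by (simp add: length_encode)
    moreover have "int n + 1 + 2 * int j = int (n + 1 + 2 * j)"
      "int n + 1 + 2 * int j + 1 = int (n + 1 + 2 * j + 1)" by simp_all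
    ultimately have "word_content ?w (int n + 1 + 2 * int j) = bit_symbol (?w ! (n + 1 + 2 * j))"
      "word_content ?w (int n + 1 + 2 * int j + 1) = bit_symbol (?w ! (n + 1 + 2 * j + 1))"
      using word_content_nth by (metis add_lessD1)+
    moreover have r: "?w ! (n + 1 + 2 * j + b) = ?r ! (2 * j + b)" for b
      by (simp add: encode_eq nth_append)
    have "?w ! (n + 1 + 2 * j) = encode_value (table_values \<sigma> n G ! j) ! 0"
      "?w ! (n + 1 + 2 * j + 1) = encode_value (table_values \<sigma> n G ! j) ! 1"
      using concat_encode_value_nth[OF len, of 0] concat_encode_value_nth[OF len, of 1] r[of 0] r[of 1]
      by simp_all
    ultimately show ?thesis
      by (cases "table_values \<sigma> n G ! j") (simp_all add: value_code_def)
  qed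
  moreover have "int n + 1 + 2 * int ?M = int (n + 1 + 2 * ?M)" by simp
  then have "word_content ?w (int n + 1 + 2 * int ?M) = 0"
    by (simp only: word_content_eq_0) (simp add: length_encode)
  moreover have "word_content ?w (int n) \<noteq> 0" by (simp add: length_encode)
  ultimately show ?thesis by (simp only: well_formed_def n Let_def) blast
qed

lemma well_formed_encodeE:
  assumes "well_formed \<sigma> w"
  obtains G where "w = encode \<sigma> (unary_prefix w) G"
proof -
  define n where "n = unary_prefix w"
  define M where "M = sum_list (map ((^) n) \<sigma>)"
  have 0: "word_content w (int n) \<noteq> 0"
    and code: "\<And>j. j < M \<Longrightarrow>
      value_code (word_content w (int (n + 1 + 2 * j))) (word_content w (int (n + 1 + 2 * j + 1)))"
    and last: "word_content w (int (n + 1 + 2 * M)) = 0"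
    using assms unfolding well_formed_def Let_def n_def[symmetric] M_def[symmetric]
    by (simp_all add: algebra_simps)
  have n: "n < length w" using 0 by simp
  define r where "r = drop (Suc n) w"
  have w: "w = replicate n True @ False # r"
    using split_unary_prefix[of w] n by (simp add: r_def n_def)
  have "length w \<le> n + 1 + 2 * M" using last by (simp only: word_content_eq_0)
  \<comment> \<open>The last cell required is not blank: it belongs to a valid pair or, if there are
    no values, is the separator.\<close>
  moreover have "n + 1 + 2 * M \<le> length w"
  proof (cases M)
    case (Suc m)
    then have "word_content w (int (n + 1 + 2 * m + 1)) \<noteq> 0"
      using code[of m] unfolding value_code_def by fastforce
    then show ?thesis using Suc by (simp only: word_content_eq_0) simp
  qed (use n in simp)
  ultimately have len: "length r = 2 * M" by (simp add: r_def)
  have "r ! Suc (2 * j)" if j: "j < M" "r ! (2 * j)" for j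
  proof -
    have "n + 1 + 2 * j + 1 < length w" using j len by (simp add: w)
    moreover have wr: "w ! (n + 1 + i) = r ! i" for i by (simp add: w nth_append)
    ultimately have "word_content w (int (n + 1 + 2 * j)) = bit_symbol (r ! (2 * j))"
      "word_content w (int (n + 1 + 2 * j + 1)) = bit_symbol (r ! Suc (2 * j))"
      using word_content_nth[of "n + 1 + 2 * j" w] word_content_nth[of "n + 1 + 2 * j + 1" w]
      using wr[of "2 * j"] wr[of "Suc (2 * j)"] by simp_all
    with code[OF j(1)] j(2) show ?thesis by (auto simp: value_code_def split: if_splits)
  qed
  from decode_values[OF len this] obtain vs where vs: "length vs = M" "r = concat (map encode_value vs)"
    by blast
  obtain G where "table_values \<sigma> n G = vs" using table_values_surj[of vs n \<sigma>] vs(1) M_def by blast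
  then have "w = encode \<sigma> n G" using w vs(2) by (simp add: encode_eq)
  then show ?thesis unfolding n_def by (rule that)
qed


subsection \<open>Reading and validating the input\<close>

text \<open>Tape 0 holds the input at the start but the output at the end, so the input is moved to
  tape 1 first.\<close>

definition fetch_input :: prog where
  "fetch_input =
     Whl 0 [0] (Ife 0 [1] (Wr 1 1) (Wr 1 2) ;; Wr 0 0 ;; Mv 0 MoveRight ;; Mv 1 MoveRight) ;;
     Mv 0 MoveLeft ;; Mv 1 MoveLeft ;;
     Whl 1 [0] (Mv 0 MoveLeft ;; Mv 1 MoveLeft) ;; Mv 0 MoveRight ;; Mv 1 MoveRight"

lemma run_Mv_upd: "run (Mv j m) 1 (T(j := (f, i))) (T(j := (f, i + offset m)))"
  using run_Mv[of "T(j := (f, i))" j f i m] by simp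

lemma run_Wr_upd: "run (Wr j s) 1 (T(j := (f, i))) (T(j := (f(i := s), i)))"
  using run_Wr[of "T(j := (f, i))" j f i s] by simp

lemma word_content_Nil: "word_content [] = (\<lambda>_. 0)"
  by (auto simp: word_content_def)

lemma run_fetch_input:
  assumes "T 0 = word_tape w" "T 1 = word_tape []"
  shows "run fetch_input (20 * length w + 40) T (T(0 := word_tape [], 1 := word_tape w))"
proof -
  let ?L = "length w"
  \<comment> \<open>After a rounds the first a symbols have moved: \<open>cut a\<close> is what
    remains on tape 0, \<open>upto a\<close> what has arrived on tape 1.\<close>
  define cut where "cut a = (\<lambda>i. if i < int a then 0 else word_content w i)" for a
  define upto where "upto a = (\<lambda>i. if i < int a then word_content w i else 0)" for a
  let ?S = "\<lambda>a. T(0 := (cut a, int a), 1 := (upto a, int a))"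
  let ?copy = "Ife 0 [1] (Wr 1 1) (Wr 1 2)"
  let ?body = "?copy ;; Wr 0 0 ;; Mv 0 MoveRight ;; Mv 1 MoveRight"
  have S0: "?S 0 = T"
  proof -
    have "cut 0 = word_content w" "upto 0 = word_content []"
      by (auto simp: cut_def upto_def word_content_def fun_eq_iff)
    then show ?thesis using assms by (auto simp: fun_eq_iff word_tape_eq)
  qed
  have 1: "run (Whl 0 [0] ?body) (Suc (?L * Suc 8)) (?S 0) (?S ?L)"
  proof (rule run_Whl[where T = ?S])
    fix a assume a: "a < ?L"
    let ?U = "T(0 := (cut a, int a), 1 := (upto (Suc a), int a))"
    have sym: "cut a (int a) = bit_symbol (w ! a)"
      using a by (simp add: cut_def word_content_nth)
    have up: "(upto a)(int a := bit_symbol (w ! a)) = upto (Suc a)"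
      using a by (auto simp: upto_def fun_eq_iff word_content_nth)
    have 1: "run ?copy (Suc 1) (?S a) ?U"
    proof (rule run_Ife)
      assume "rd (?S a) 0 \<in> set [1]"
      then have "\<not> w ! a" using sym by (cases "w ! a") simp_all
      then have "(upto a)(int a := 1) = upto (Suc a)" using up by simp
      then show "run (Wr 1 1) 1 (?S a) ?U"
        using run_Wr_upd[of 1 1 "T(0 := (cut a, int a))" "upto a" "int a"] by (simp only:)
    next
      assume "rd (?S a) 0 \<notin> set [1]"
      then have "w ! a" using sym by (cases "w ! a") simp_all
      then have "(upto a)(int a := 2) = upto (Suc a)" using up by simp
      then show "run (Wr 1 2) 1 (?S a) ?U"
        using run_Wr_upd[of 1 2 "T(0 := (cut a, int a))" "upto a" "int a"] by (simp only:)
    qed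
    have "(cut a)(int a := 0) = cut (Suc a)"
      by (auto simp: cut_def fun_eq_iff)
    then have 2: "run (Wr 0 0) 1 ?U (T(0 := (cut (Suc a), int a), 1 := (upto (Suc a), int a)))"
      using run_Wr_upd[of 0 0 "T(1 := (upto (Suc a), int a))" "cut a" "int a"]
      by (simp add: fun_upd_twist)
    have 3: "run (Mv 0 MoveRight) 1 (T(0 := (cut (Suc a), int a), 1 := (upto (Suc a), int a)))
        (T(0 := (cut (Suc a), int (Suc a)), 1 := (upto (Suc a), int a)))"
      using run_Mv_upd[of 0 MoveRight "T(1 := (upto (Suc a), int a))" "cut (Suc a)" "int a"]
      by (simp add: fun_upd_twist add.commute)
    have 4: "run (Mv 1 MoveRight) 1 (T(0 := (cut (Suc a), int (Suc a)), 1 := (upto (Suc a), int a))) (?S (Suc a))"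
      using run_Mv_upd[of 1 MoveRight "T(0 := (cut (Suc a), int (Suc a)))" "upto (Suc a)" "int a"]
      by (simp add: add.commute)
    have "run ?body 8 (?S a) (?S (Suc a))"
      by (rule run_mono[OF run_Seq[OF 1 run_Seq[OF 2 run_Seq[OF 3 4]]]]) simp
    moreover have "rd (?S a) 0 \<notin> set [0]" using sym by simp
    ultimately show "rd (?S a) 0 \<notin> set [0] \<and> run ?body 8 (?S a) (?S (Suc a))" by blast
  next
    show "rd (?S ?L) 0 \<in> set [0]" by (simp add: cut_def word_content_def)
  qed
  let ?V = "\<lambda>i j. T(0 := (word_content [], i), 1 := (word_content w, j))"
  have SL: "?S ?L = ?V (int ?L) (int ?L)"
  proof -
    have "cut ?L = word_content []" "upto ?L = word_content w"
      by (auto simp: cut_def upto_def word_content_def fun_eq_iff)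
    then show ?thesis by simp
  qed
  have mv0: "run (Mv 0 m) 1 (?V i j) (?V (i + offset m) j)" for m i j
    using run_Mv_upd[of 0 m "T(1 := (word_content w, j))" "word_content []" i] by (simp add: fun_upd_twist)
  have mv1: "run (Mv 1 m) 1 (?V i j) (?V i (j + offset m))" for m i j
    using run_Mv_upd[of 1 m "T(0 := (word_content [], i))" "word_content w" j] by simp
  let ?W = "\<lambda>a. ?V (int ?L - 1 - int a) (int ?L - 1 - int a)"
  have 3: "run (Whl 1 [0] (Mv 0 MoveLeft ;; Mv 1 MoveLeft)) (Suc (?L * Suc 3)) (?W 0) (?W ?L)"
  proof (rule run_Whl[where T = ?W])
    fix a assume a: "a < ?L"
    have "run (Mv 0 MoveLeft ;; Mv 1 MoveLeft) (Suc (1 + 1)) (?W a)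
        (?V (int ?L - 1 - int a + offset MoveLeft) (int ?L - 1 - int a + offset MoveLeft))"
      by (rule run_Seq[OF mv0 mv1])
    moreover have "int ?L - 1 - int a + offset MoveLeft = int ?L - 1 - int (Suc a)" by simp
    ultimately have "run (Mv 0 MoveLeft ;; Mv 1 MoveLeft) 3 (?W a) (?W (Suc a))"
      by (metis Suc_1 eval_nat_numeral(3) plus_1_eq_Suc)
    moreover have "rd (?W a) 1 \<notin> set [0]"
      using a by (simp add: word_content_def)
    ultimately show "rd (?W a) 1 \<notin> set [0] \<and> run (Mv 0 MoveLeft ;; Mv 1 MoveLeft) 3 (?W a) (?W (Suc a))"
      by blast
  next
    show "rd (?W ?L) 1 \<in> set [0]" by (simp add: word_content_def)
  qed
  have 2: "run (Mv 0 MoveLeft) 1 (?S ?L) (?V (int ?L - 1) (int ?L))"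
    unfolding SL using mv0[of MoveLeft "int ?L" "int ?L"] by simp
  have twob: "run (Mv 1 MoveLeft) 1 (?V (int ?L - 1) (int ?L)) (?W 0)"
    using mv1[of MoveLeft "int ?L - 1" "int ?L"] by simp
  have 4: "run (Mv 0 MoveRight) 1 (?W ?L) (?V 0 (-1))"
    using mv0[of MoveRight "-1" "-1"] by simp
  have 5: "run (Mv 1 MoveRight) 1 (?V 0 (-1)) (?V 0 0)"
    using mv1[of MoveRight 0 "-1"] by simp
  have "run fetch_input (Suc (Suc (?L * Suc 8) + Suc (1 + Suc (1 + Suc (Suc (?L * Suc 3) + Suc (1 + 1))))))
      (?S 0) (?V 0 0)"
    unfolding fetch_input_def
    by (rule run_Seq[OF 1 run_Seq[OF 2 run_Seq[OF twob run_Seq[OF 3 run_Seq[OF 4 5]]]]])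
  then have "run fetch_input (20 * ?L + 40) (?S 0) (?V 0 0)"
    by (rule run_mono) simp
  then show ?thesis by (simp only: S0 word_tape_eq)
qed

primrec on_tapes :: "(nat \<Rightarrow> prog) \<Rightarrow> nat list \<Rightarrow> prog" where
  "on_tapes p [] = Nop"
| "on_tapes p (v # vs) = p v ;; on_tapes p vs"

definition fill :: "tapes \<Rightarrow> nat list \<Rightarrow> tape \<Rightarrow> tapes" where
  "fill T vs x = (\<lambda>j. if j \<in> set vs then x else T j)"

lemma run_on_tapes:
  assumes "distinct vs" "\<And>T v. v \<in> set vs \<Longrightarrow> T v = x \<Longrightarrow> run (p v) B T (T(v := y))"
  shows "run (on_tapes p vs) (length vs * Suc B + 1) (fill T vs x) (fill T vs y)"
  using assms
proof (induction vs arbitrary: T)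
  case Nil
  then show ?case using run_Nop by (simp add: fill_def)
next
  case (Cons v vs)
  have 1: "run (p v) B (fill T (v # vs) x) ((fill T (v # vs) x)(v := y))"
    by (rule Cons.prems(2)) (auto simp: fill_def)
  have "run (on_tapes p vs) (length vs * Suc B + 1) (fill (T(v := y)) vs x) (fill (T(v := y)) vs y)"
    by (rule Cons.IH) (use Cons.prems in auto)
  moreover have "fill (T(v := y)) vs x = (fill T (v # vs) x)(v := y)"
    "fill (T(v := y)) vs y = fill T (v # vs) y"
    using Cons.prems(1) by (auto simp: fill_def fun_eq_iff)
  ultimately have 2: "run (on_tapes p vs) (length vs * Suc B + 1) ((fill T (v # vs) x)(v := y)) (fill T (v # vs) y)"
    by simp
  show ?case using run_mono[OF run_Seq[OF 1 2]] by simp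
qed

definition prepare_tape :: "nat \<Rightarrow> prog" where
  "prepare_tape v = Mv v MoveLeft ;; Wr v 3 ;; Mv v MoveRight"

lemma run_prepare_tape:
  assumes "T v = word_tape []"
  shows "run (prepare_tape v) 5 T (T(v := loop_tape 0 0))"
proof -
  let ?f = "word_content []"
  have T: "T(v := (?f, 0)) = T" using assms by (auto simp: word_tape_eq fun_eq_iff)
  have 1: "run (Mv v MoveLeft) 1 T (T(v := (?f, -1)))"
    using run_Mv_upd[of v MoveLeft T ?f 0] T by simp
  have 2: "run (Wr v 3) 1 (T(v := (?f, -1))) (T(v := (?f(-1 := 3), -1)))"
    by (rule run_Wr_upd)
  have 3: "run (Mv v MoveRight) 1 (T(v := (?f(-1 := 3), -1))) (T(v := (?f(-1 := 3), 0)))"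
    using run_Mv_upd[of v MoveRight T "?f(-1 := 3)" "-1"] by simp
  have "?f(-1 := 3) = loop_content 0"
    by (auto simp: word_content_Nil loop_content_def fun_eq_iff)
  then show ?thesis
    unfolding prepare_tape_def using run_mono[OF run_Seq[OF 1 run_Seq[OF 2 3]], of 5] by simp
qed

definition grow_tape :: "nat \<Rightarrow> prog" where
  "grow_tape v = Wr v 1 ;; Mv v MoveRight"

lemma run_grow_tape:
  assumes "T v = loop_tape a a"
  shows "run (grow_tape v) 3 T (T(v := loop_tape (Suc a) (Suc a)))"
proof -
  have T: "T(v := loop_tape a a) = T" using assms by (auto simp: fun_eq_iff)
  have "(loop_content a)(int a := 1) = loop_content (Suc a)"
    by (auto simp: loop_content_def fun_eq_iff)
  then have 1: "run (Wr v 1) 1 T (T(v := (loop_content (Suc a), int a)))"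
    using run_Wr_upd[of v 1 T "loop_content a" "int a"] T by simp
  have 2: "run (Mv v MoveRight) 1 (T(v := (loop_content (Suc a), int a))) (T(v := loop_tape (Suc a) (Suc a)))"
    using run_Mv_upd[of v MoveRight T "loop_content (Suc a)" "int a"] by (simp add: add.commute)
  show ?thesis unfolding grow_tape_def by (rule run_mono[OF run_Seq[OF 1 2]]) simp
qed

text \<open>All loop tapes grow simultaneously while the unary size is read once. The blank is also
  a stopping symbol since a malformed input may consist of True bits only.\<close>

definition init_loops :: "nat list \<Rightarrow> prog" where
  "init_loops vs = on_tapes prepare_tape vs ;;
     Whl 1 [0, 1] (on_tapes grow_tape vs ;; Mv 1 MoveRight) ;; on_tapes reset vs"

lemma run_init_loops:
  assumes vs: "distinct vs" "1 \<notin> set vs"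
    and T: "T 1 = word_tape w" "\<And>v. v \<in> set vs \<Longrightarrow> T v = word_tape []"
  shows "run (init_loops vs) (length vs * 30 + length w * (length vs * 10 + 10) + 30) T
    ((fill T vs (loop_tape (unary_prefix w) 0))(1 := (word_content w, int (unary_prefix w))))"
proof -
  let ?n = "unary_prefix w" and ?f = "word_content w" and ?k = "length vs"
  have n: "?n \<le> length w" by (simp add: unary_prefix_def length_takeWhile_le)
  have "fill T vs (word_tape []) = T" using T(2) by (auto simp: fill_def fun_eq_iff)
  moreover have "run (on_tapes prepare_tape vs) (?k * Suc 5 + 1) (fill T vs (word_tape []))
      (fill T vs (loop_tape 0 0))"
    by (rule run_on_tapes[OF vs(1) run_prepare_tape])
  ultimately have 1: "run (on_tapes prepare_tape vs) (?k * Suc 5 + 1) T (fill T vs (loop_tape 0 0))"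
    by (simp only:)
  let ?S = "\<lambda>a. (fill T vs (loop_tape a a))(1 := (?f, int a))"
  have S0: "?S 0 = fill T vs (loop_tape 0 0)"
    using T(1) vs(2) by (auto simp: fill_def fun_eq_iff word_tape_eq)
  let ?body = "on_tapes grow_tape vs ;; Mv 1 MoveRight"
  have comm: "(fill U vs x)(1 := y) = fill (U(1 := y)) vs x" for U x y
    using vs(2) by (auto simp: fill_def fun_eq_iff)
  have 2: "run (Whl 1 [0, 1] ?body) (Suc (?n * Suc (Suc (?k * Suc 3 + 1 + 1)))) (?S 0) (?S ?n)"
  proof (rule run_Whl[where T = ?S])
    fix a assume a: "a < ?n"
    have "w ! a" using a by (metis id_apply nth_mem set_takeWhileD takeWhile_nth unary_prefix_def)
    then have sym: "?f (int a) = 2" using a n by (simp add: word_content_nth)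
    have 1: "run (on_tapes grow_tape vs) (?k * Suc 3 + 1) (?S a)
        ((fill T vs (loop_tape (Suc a) (Suc a)))(1 := (?f, int a)))"
      unfolding comm by (rule run_on_tapes[OF vs(1) run_grow_tape])
    have 2: "run (Mv 1 MoveRight) 1 ((fill T vs (loop_tape (Suc a) (Suc a)))(1 := (?f, int a))) (?S (Suc a))"
      using run_Mv_upd[of 1 MoveRight "fill T vs (loop_tape (Suc a) (Suc a))" ?f "int a"]
      by (simp add: add.commute)
    show "rd (?S a) 1 \<notin> set [0, 1] \<and> run ?body (Suc (?k * Suc 3 + 1 + 1)) (?S a) (?S (Suc a))"
      using sym run_Seq[OF 1 2] by simp
  next
    have "?f (int ?n) \<noteq> 2"
    proof (cases "?n < length w")
      case True
      then have "\<not> w ! ?n" using nth_length_takeWhile[of id w] by (simp add: unary_prefix_def)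
      then show ?thesis using True by (simp add: word_content_nth)
    qed (simp add: word_content_def)
    then show "rd (?S ?n) 1 \<in> set [0, 1]" by (auto simp: word_content_def)
  qed
  have 3: "run (on_tapes reset vs) (?k * Suc (2 * ?n + 10) + 1) (?S ?n)
      ((fill T vs (loop_tape ?n 0))(1 := (?f, int ?n)))"
    unfolding comm by (rule run_on_tapes[OF vs(1) run_reset]) auto
  have "run (init_loops vs) (Suc (?k * Suc 5 + 1 + Suc (Suc (?n * Suc (Suc (?k * Suc 3 + 1 + 1)))
      + (?k * Suc (2 * ?n + 10) + 1)))) T ((fill T vs (loop_tape ?n 0))(1 := (?f, int ?n)))"
    unfolding init_loops_def using run_Seq[OF 1 run_Seq[OF 2[unfolded S0] 3]] .
  moreover have "Suc (?k * Suc 5 + 1 + Suc (Suc (?n * Suc (Suc (?k * Suc 3 + 1 + 1)))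
      + (?k * Suc (2 * ?n + 10) + 1))) \<le> ?k * 30 + ?n * (?k * 10 + 10) + 30"
    by (simp add: algebra_simps)
  moreover have "\<dots> \<le> ?k * 30 + length w * (?k * 10 + 10) + 30"
    using n by (intro add_mono mult_le_mono1) auto
  ultimately show ?thesis by (meson run_mono le_trans)
qed

text \<open>Every branch moves two cells in total, so the position does not depend on the validity
  of what is read. The flag records faults and is never cleared here.\<close>

definition check_value :: prog where
  "check_value = Ife 1 [1] (Mv 1 MoveRight ;; Ife 1 [1, 2] Nop (Wr 2 1))
     (Ife 1 [2] (Mv 1 MoveRight ;; Ife 1 [2] Nop (Wr 2 1)) (Wr 2 1 ;; Mv 1 MoveRight)) ;;
     Mv 1 MoveRight"

lemma run_check_value:
  assumes T: "T 1 = (f, p)" "T 2 = flag_tape b"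
  shows "run check_value 10 T (T(1 := (f, p + 2), 2 := flag_tape (b \<or> \<not> value_code (f p) (f (p + 1)))))"
proof -
  let ?b = "b \<or> \<not> value_code (f p) (f (p + 1))"
  let ?T1 = "T(1 := (f, p + 1))" and ?U = "T(1 := (f, p + 1), 2 := flag_tape ?b)"
  have mv: "run (Mv 1 MoveRight) 1 T ?T1" using run_Mv[of T 1, OF T(1), of MoveRight] by simp
  have T1: "?T1 2 = flag_tape b" using T(2) by simp
  have b: "?T1(2 := flag_tape b) = ?T1" using T1 by (metis fun_upd_triv)
  have good: "run Nop 1 ?T1 ?U" if "value_code (f p) (f (p + 1))"
    using run_Nop[of ?T1] b that by simp
  have bad: "run (Wr 2 1) 1 ?T1 ?U" if "\<not> value_code (f p) (f (p + 1))"
    using run_set_flag[of ?T1 2 b, OF T1] that by simp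
  have r1: "rd ?T1 1 = f (p + 1)" and r: "rd T 1 = f p" using T(1) by simp_all
  have 1: "run (Ife 1 [1] (Mv 1 MoveRight ;; Ife 1 [1, 2] Nop (Wr 2 1))
     (Ife 1 [2] (Mv 1 MoveRight ;; Ife 1 [2] Nop (Wr 2 1)) (Wr 2 1 ;; Mv 1 MoveRight)))
     (Suc (Suc (Suc (1 + Suc 1)))) T ?U"
  proof (rule run_Ife)
    assume "rd T 1 \<in> set [1]"
    then have fp: "f p = 1" using r by simp
    have "run (Ife 1 [1, 2] Nop (Wr 2 1)) (Suc 1) ?T1 ?U"
      by (rule run_Ife; (rule good | rule bad)) (use r1 fp in \<open>auto simp: value_code_def\<close>)
    from run_Seq[OF mv this]
    show "run (Mv 1 MoveRight ;; Ife 1 [1, 2] Nop (Wr 2 1)) (Suc (Suc (1 + Suc 1))) T ?U"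
      by (rule run_mono) simp
  next
    assume ne1: "rd T 1 \<notin> set [1]"
    show "run (Ife 1 [2] (Mv 1 MoveRight ;; Ife 1 [2] Nop (Wr 2 1)) (Wr 2 1 ;; Mv 1 MoveRight))
        (Suc (Suc (1 + Suc 1))) T ?U"
    proof (rule run_Ife)
      assume "rd T 1 \<in> set [2]"
      then have fp: "f p = 2" using r by simp
      have "run (Ife 1 [2] Nop (Wr 2 1)) (Suc 1) ?T1 ?U"
        by (rule run_Ife; (rule good | rule bad)) (use r1 fp in \<open>auto simp: value_code_def\<close>)
      from run_Seq[OF mv this]
      show "run (Mv 1 MoveRight ;; Ife 1 [2] Nop (Wr 2 1)) (Suc (1 + Suc 1)) T ?U" .
    next
      assume "rd T 1 \<notin> set [2]"
      then have "\<not> value_code (f p) (f (p + 1))" using ne1 r by (simp add: value_code_def)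
      then have 1: "run (Wr 2 1) 1 T (T(2 := flag_tape ?b))" using run_set_flag[of T 2 b, OF T(2)] by simp
      have "run (Mv 1 MoveRight) 1 (T(2 := flag_tape ?b)) ?U"
        using run_Mv[of "T(2 := flag_tape ?b)" 1 f p MoveRight] T(1) by (simp add: fun_upd_twist)
      from run_Seq[OF 1 this] show "run (Wr 2 1 ;; Mv 1 MoveRight) (Suc (1 + Suc 1)) T ?U"
        by (rule run_mono) simp
    qed
  qed
  have 2: "run (Mv 1 MoveRight) 1 ?U (T(1 := (f, p + 2), 2 := flag_tape ?b))"
    using run_Mv[of ?U 1 f "p + 1" MoveRight] by (simp add: fun_upd_twist add.assoc)
  show ?thesis unfolding check_value_def by (rule run_mono[OF run_Seq[OF 1 2]]) simp
qed

context transducer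
begin

definition bad_value :: "(int \<Rightarrow> nat) \<Rightarrow> int \<Rightarrow> nat \<Rightarrow> bool" where
  "bad_value f p j \<longleftrightarrow> \<not> value_code (f (p + 2 * int j)) (f (p + 2 * int j + 1))"

lemma run_nest_check:
  assumes k: "k \<le> sum_list \<sigma>" and T: "scratch_ok n T" "T 1 = (f, p)" "T 2 = flag_tape b"
  shows "run (nest (scratch k) check_value) (nest_time k 10 n) T
    (T(1 := (f, p + 2 * int (n ^ k)), 2 := flag_tape (b \<or> (\<exists>j<n ^ k. bad_value f p j))))"
proof -
  let ?s = "\<lambda>i. ((f, p + 2 * int i), flag_tape (b \<or> (\<exists>j<i. bad_value f p j)))"
  have len: "length (scratch k) = k" by (simp add: scratch_def)
  have "run (nest (scratch k) check_value) (nest_time (length (scratch k)) 10 n)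
      (put T (?s 0)) (put T (?s (n ^ length (scratch k))))"
  proof (rule run_nest[where s = ?s])
    fix U i
    let ?b = "b \<or> (\<exists>j<i. bad_value f p j)"
    have "run check_value 10 (put U (?s i)) ((put U (?s i))(1 := (f, p + 2 * int i + 2),
        2 := flag_tape (?b \<or> \<not> value_code (f (p + 2 * int i)) (f (p + 2 * int i + 1)))))"
      by (rule run_check_value) (simp_all add: put_def)
    moreover have "(?b \<or> \<not> value_code (f (p + 2 * int i)) (f (p + 2 * int i + 1)))
        \<longleftrightarrow> (b \<or> (\<exists>j<Suc i. bad_value f p j))"
      unfolding less_Suc_eq by (auto simp: bad_value_def)
    then have "(put U (?s i))(1 := (f, p + 2 * int i + 2),
        2 := flag_tape (?b \<or> \<not> value_code (f (p + 2 * int i)) (f (p + 2 * int i + 1)))) = put U (?s (Suc i))"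
      by (simp only:) (auto simp: put_def fun_eq_iff)
    ultimately show "run check_value 10 (put U (?s i)) (put U (?s (Suc i)))" by (simp only:)
  qed (use k T in \<open>auto simp: scratch_def scratch_ok_def\<close>)
  moreover have "put T (?s 0) = T"
    using T(2,3) by (auto simp: put_def fun_eq_iff)
  ultimately show ?thesis by (simp only: len) (simp add: put_def)
qed

primrec check_tables :: "nat list \<Rightarrow> prog" where
  "check_tables [] = Nop"
| "check_tables (k # ks) = nest (scratch k) check_value ;; check_tables ks"

lemma bad_value_append:
  "(\<exists>j<N. bad_value f p j) \<or> (\<exists>j<M. bad_value f (p + 2 * int N) j) \<longleftrightarrow> (\<exists>j<N + M. bad_value f p j)"
proof -
  have "bad_value f (p + 2 * int N) j \<longleftrightarrow> bad_value f p (N + j)" for j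
    by (simp add: bad_value_def algebra_simps)
  moreover have "(\<exists>j<N + M. P j) \<longleftrightarrow> (\<exists>j<N. P j) \<or> (\<exists>j<M. P (N + j))" for P
  proof
    assume "\<exists>j<N + M. P j"
    then obtain j where j: "j < N + M" "P j" by blast
    show "(\<exists>j<N. P j) \<or> (\<exists>j<M. P (N + j))"
    proof (cases "j < N")
      case False
      then have "j - N < M" "P (N + (j - N))" using j by simp_all
      then show ?thesis by blast
    qed (use j in blast)
  next
    assume "(\<exists>j<N. P j) \<or> (\<exists>j<M. P (N + j))"
    then show "\<exists>j<N + M. P j" by (meson nat_add_left_cancel_less trans_less_add1)
  qed
  ultimately show ?thesis by simp
qed

lemma run_check_tables:
  assumes "set ks \<subseteq> {..sum_list \<sigma>}"
  shows "\<exists>F. poly_bounded F \<and> (\<forall>n T f p b. scratch_ok n T \<longrightarrow> T 1 = (f, p) \<longrightarrow> T 2 = flag_tape b \<longrightarrow>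
    run (check_tables ks) (F n) T (T(1 := (f, p + 2 * int (sum_list (map ((^) n) ks))),
      2 := flag_tape (b \<or> (\<exists>j<sum_list (map ((^) n) ks). bad_value f p j)))))"
  using assms
proof (induction ks)
  case Nil
  have "run Nop 1 T (T(1 := (f, p + 2 * int 0), 2 := flag_tape (b \<or> (\<exists>j<0. bad_value f p j))))"
    if "T 1 = (f, p)" "T 2 = flag_tape b" for T f p b
  proof -
    have "T(1 := (f, p), 2 := flag_tape b) = T" using that by (auto simp: fun_eq_iff)
    then show ?thesis using run_Nop[of T] by simp
  qed
  then show ?case
    unfolding check_tables.simps list.map sum_list.Nil
    using poly_bounded_const[of 1] by blast
next
  case (Cons k ks)
  from Cons.prems have "set ks \<subseteq> {..sum_list \<sigma>}" by simp
  from Cons.IH[OF this] obtain F where F: "poly_bounded F"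
    "\<And>n T f p b. scratch_ok n T \<Longrightarrow> T 1 = (f, p) \<Longrightarrow> T 2 = flag_tape b \<Longrightarrow>
      run (check_tables ks) (F n) T (T(1 := (f, p + 2 * int (sum_list (map ((^) n) ks))),
      2 := flag_tape (b \<or> (\<exists>j<sum_list (map ((^) n) ks). bad_value f p j))))"
    by blast
  have "run (check_tables (k # ks)) (Suc (nest_time k 10 n + F n)) T
      (T(1 := (f, p + 2 * int (sum_list (map ((^) n) (k # ks)))),
        2 := flag_tape (b \<or> (\<exists>j<sum_list (map ((^) n) (k # ks)). bad_value f p j))))"
    if T: "scratch_ok n T" "T 1 = (f, p)" "T 2 = flag_tape b" for n T f p b
  proof -
    let ?b = "b \<or> (\<exists>j<n ^ k. bad_value f p j)" and ?M = "sum_list (map ((^) n) ks)"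
    let ?p = "p + 2 * int (n ^ k)"
    let ?U = "T(1 := (f, ?p), 2 := flag_tape ?b)"
    have 1: "run (nest (scratch k) check_value) (nest_time k 10 n) T ?U"
      using run_nest_check[OF _ T] Cons.prems by auto
    have "run (check_tables ks) (F n) ?U (?U(1 := (f, ?p + 2 * int ?M),
        2 := flag_tape (?b \<or> (\<exists>j<?M. bad_value f ?p j))))"
      by (rule F(2)) (use T in auto)
    moreover have "(?b \<or> (\<exists>j<?M. bad_value f ?p j)) \<longleftrightarrow> b \<or> (\<exists>j<n ^ k + ?M. bad_value f p j)"
      using bad_value_append[of "n ^ k" f p ?M] by blast
    ultimately have 2: "run (check_tables ks) (F n) ?U (?U(1 := (f, ?p + 2 * int ?M),
        2 := flag_tape (b \<or> (\<exists>j<n ^ k + ?M. bad_value f p j))))"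
      by (simp only:)
    show ?thesis using run_Seq[OF 1 2] by (simp add: fun_upd_twist algebra_simps)
  qed
  moreover have "poly_bounded (\<lambda>n. Suc (nest_time k 10 n + F n))"
    by (intro poly_bounded_intros F)
  ultimately show ?case by blast
qed

definition validate :: prog where
  "validate = Ife 1 [0] (Wr 2 1) Nop ;; Mv 1 MoveRight ;; check_tables \<sigma> ;; Ife 1 [0] Nop (Wr 2 1)"

lemma run_validate:
  "\<exists>F. poly_bounded F \<and> (\<forall>T w. scratch_ok (unary_prefix w) T \<longrightarrow>
    T 1 = (word_content w, int (unary_prefix w)) \<longrightarrow> T 2 = flag_tape False \<longrightarrow>
    run validate (F (unary_prefix w)) T (T(1 := (word_content w,
        int (unary_prefix w + 1 + 2 * sum_list (map ((^) (unary_prefix w)) \<sigma>))),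
      2 := flag_tape (\<not> well_formed \<sigma> w))))"
proof -
  have "set \<sigma> \<subseteq> {..sum_list \<sigma>}" by (auto intro: member_le_sum_list)
  from run_check_tables[OF this] obtain F where F: "poly_bounded F"
    "\<And>n T f p b. scratch_ok n T \<Longrightarrow> T 1 = (f, p) \<Longrightarrow> T 2 = flag_tape b \<Longrightarrow>
      run (check_tables \<sigma>) (F n) T (T(1 := (f, p + 2 * int (sum_list (map ((^) n) \<sigma>))),
      2 := flag_tape (b \<or> (\<exists>j<sum_list (map ((^) n) \<sigma>). bad_value f p j))))"
    by blast
  have "run validate (Suc (Suc 1 + Suc (1 + Suc (F n + Suc 1)))) T (T(1 := (word_content w, int (n + 1 + 2 * M)),
      2 := flag_tape (\<not> well_formed \<sigma> w)))"
    if n: "n = unary_prefix w" and M: "M = sum_list (map ((^) n) \<sigma>)"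
      and T: "scratch_ok n T" "T 1 = (word_content w, int n)" "T 2 = flag_tape False"
    for n M T w
  proof -
    let ?f = "word_content w"
    \<comment> \<open>Three kinds of faults accumulate in the flag: a missing separator, an invalid
      pair, and symbols after the last table.\<close>
    define b1 where "b1 \<longleftrightarrow> ?f (int n) = 0"
    define b2 where "b2 \<longleftrightarrow> b1 \<or> (\<exists>j<M. bad_value ?f (int n + 1) j)"
    define b3 where "b3 \<longleftrightarrow> b2 \<or> ?f (int (n + 1 + 2 * M)) \<noteq> 0"
    have wf: "b3 \<longleftrightarrow> \<not> well_formed \<sigma> w"
      unfolding b3_def b2_def b1_def well_formed_def Let_def n[symmetric] M[symmetric] bad_value_def
      by (simp add: algebra_simps)
    have Tf: "T(2 := flag_tape False) = T" using T(3) by (metis fun_upd_triv)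
    let ?T1 = "T(2 := flag_tape b1)"
    have 1: "run (Ife 1 [0] (Wr 2 1) Nop) (Suc 1) T ?T1"
    proof (rule run_Ife)
      assume "rd T 1 \<in> set [0]"
      then have b1 using T(2) by (simp add: b1_def del: word_content_eq_0)
      then show "run (Wr 2 1) 1 T ?T1" using run_set_flag[of T 2 False, OF T(3)] by simp
    next
      assume "rd T 1 \<notin> set [0]"
      then have "\<not> b1" using T(2) by (simp add: b1_def del: word_content_eq_0)
      then show "run Nop 1 T ?T1" using run_Nop[of T] Tf by simp
    qed
    let ?T2 = "T(2 := flag_tape b1, 1 := (?f, int n + 1))"
    have 2: "run (Mv 1 MoveRight) 1 ?T1 ?T2"
      using run_Mv[of ?T1 1 ?f "int n" MoveRight] T(2) by simp
    let ?T3 = "T(1 := (?f, int (n + 1 + 2 * M)), 2 := flag_tape b2)"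
    have "run (check_tables \<sigma>) (F n) ?T2 (?T2(1 := (?f, int n + 1 + 2 * int (sum_list (map ((^) n) \<sigma>))),
      2 := flag_tape (b1 \<or> (\<exists>j<sum_list (map ((^) n) \<sigma>). bad_value ?f (int n + 1) j))))"
      by (rule F(2)) (use T in auto)
    moreover have "int n + 1 + 2 * int M = int (n + 1 + 2 * M)" by simp
    ultimately have "run (check_tables \<sigma>) (F n) ?T2 (?T2(1 := (?f, int (n + 1 + 2 * M)), 2 := flag_tape b2))"
      unfolding M[symmetric] b2_def[symmetric] by (simp only:)
    moreover have "?T2(1 := (?f, int (n + 1 + 2 * M)), 2 := flag_tape b2) = ?T3"
      by (auto simp: fun_eq_iff)
    ultimately have 3: "run (check_tables \<sigma>) (F n) ?T2 ?T3" by (simp only:)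
    let ?T4 = "T(1 := (?f, int (n + 1 + 2 * M)), 2 := flag_tape b3)"
    have r: "rd ?T3 1 = ?f (int (n + 1 + 2 * M))" by simp
    have 4: "run (Ife 1 [0] Nop (Wr 2 1)) (Suc 1) ?T3 ?T4"
    proof (rule run_Ife)
      assume "rd ?T3 1 \<in> set [0]"
      then have "b3 = b2" unfolding r b3_def by (simp del: word_content_eq_0 of_nat_add of_nat_mult of_nat_Suc)
      then show "run Nop 1 ?T3 ?T4" using run_Nop[of ?T3] by simp
    next
      assume "rd ?T3 1 \<notin> set [0]"
      then have "b3" unfolding r b3_def by (simp del: word_content_eq_0 of_nat_add of_nat_mult of_nat_Suc)
      then show "run (Wr 2 1) 1 ?T3 ?T4" using run_set_flag[of ?T3 2 b2] by simp
    qed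
    show ?thesis
      unfolding validate_def wf[symmetric] by (rule run_Seq[OF 1 run_Seq[OF 2 run_Seq[OF 3 4]]])
  qed
  moreover have "poly_bounded (\<lambda>n. Suc (Suc 1 + Suc (1 + Suc (F n + Suc 1))))"
    by (intro poly_bounded_intros F)
  ultimately show ?thesis by blast
qed

definition go_back :: "nat \<Rightarrow> prog" where
  "go_back j = Mv j MoveLeft ;; rewind j"

text \<open>If the input is malformed nothing is written; since \<open>fetch_input\<close> has
  blanked tape 0, the output is then the empty word.\<close>

definition main_prog :: "cmd \<Rightarrow> prog" where
  "main_prog c = fetch_input ;; init_loops [3..<var_tape D] ;; validate ;;
     Ife 2 [0] (go_back 1 ;; compile c 0 ;; go_back 0) Nop"

lemma run_go_back:
  assumes "T j = (word_content w, int h)" "h \<le> length w"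
  shows "run (go_back j) (2 * length w + 20) T (T(j := word_tape w))"
proof -
  have 1: "run (Mv j MoveLeft) 1 T (T(j := (word_content w, int h - 1)))"
    using run_Mv[of T j, OF assms(1), of MoveLeft] by simp
  have 2: "run (rewind j) (2 * length w + 10) (T(j := (word_content w, int h - 1))) (T(j := word_tape w))"
    using run_rewind[of "T(j := (word_content w, int h - 1))" j w h] assms(2) by simp
  show ?thesis unfolding go_back_def by (rule run_mono[OF run_Seq[OF 1 2]]) simp
qed

lemma run_main_prog:
  assumes F: "poly_bounded F" and c: "implements F c 0"
  shows "\<exists>q :: nat poly. \<forall>w. \<exists>x T'. run (main_prog c) (poly q (length w)) (init_tapes w) T' \<and>
    T' 0 = word_tape x \<and>
    (if well_formed \<sigma> w then \<exists>n G. w = encode \<sigma> n G \<and> x = emits n G [] c else x = [])"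
proof -
  obtain V where V: "poly_bounded V" "\<And>T w. scratch_ok (unary_prefix w) T \<Longrightarrow>
      T 1 = (word_content w, int (unary_prefix w)) \<Longrightarrow> T 2 = flag_tape False \<Longrightarrow>
      run validate (V (unary_prefix w)) T (T(1 := (word_content w,
          int (unary_prefix w + 1 + 2 * sum_list (map ((^) (unary_prefix w)) \<sigma>))),
        2 := flag_tape (\<not> well_formed \<sigma> w)))"
    using run_validate by blast
  obtain E where E: "poly_bounded E" "\<And>n G xs. length (emits n G xs c) \<le> E n"
    using emits_length_bounded by blast
  let ?vs = "[3..<var_tape D]"
  let ?B1 = "\<lambda>l. 20 * l + 40"
  let ?B2 = "\<lambda>l. length ?vs * 30 + l * (length ?vs * 10 + 10) + 30"
  let ?B4 = "\<lambda>l n. Suc ((2 * l + 20) + Suc (F n + (2 * E n + 20)))"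
  let ?B = "\<lambda>l n. Suc (?B1 l + Suc (?B2 l + Suc (V n + Suc (?B4 l n))))"
  obtain qV :: "nat poly" where qV: "\<And>n m. n \<le> m \<Longrightarrow> V n \<le> poly qV m"
    using poly_bounded_mono[OF V(1)] by blast
  obtain qE :: "nat poly" where qE: "\<And>n m. n \<le> m \<Longrightarrow> E n \<le> poly qE m"
    using poly_bounded_mono[OF E(1)] by blast
  obtain qF :: "nat poly" where qF: "\<And>n m. n \<le> m \<Longrightarrow> F n \<le> poly qF m"
    using poly_bounded_mono[OF F] by blast
  let ?H = "\<lambda>l. Suc (?B1 l + Suc (?B2 l + Suc (poly qV l + Suc (
    Suc ((2 * l + 20) + Suc (poly qF l + (2 * poly qE l + 20)))))))"
  have polyp: "poly_bounded (poly q)" for q :: "nat poly"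
    unfolding poly_bounded_def by blast
  have "poly_bounded ?H" by (intro poly_bounded_intros polyp)
  then obtain q :: "nat poly" where q: "\<And>l. ?H l \<le> poly q l"
    unfolding poly_bounded_def by blast
  have bound: "?B l n \<le> poly q l" if "n \<le> l" for l n
  proof -
    have "?B l n \<le> ?H l"
      using qV[OF that] qE[OF that] qF[OF that] by linarith
    then show ?thesis using q[of l] by (rule le_trans)
  qed
  have "\<exists>x T'. run (main_prog c) (poly q (length w)) (init_tapes w) T' \<and>
      T' 0 = word_tape x \<and>
      (if well_formed \<sigma> w then \<exists>n G. w = encode \<sigma> n G \<and> x = emits n G [] c else x = [])" for w
  proof -
    let ?n = "unary_prefix w" and ?l = "length w"
    \<comment> \<open>The domain size is written in unary and hence bounded by the input length;
      this makes all the loops over the domain polynomial in the input.\<close>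
    have n: "?n \<le> ?l" by (simp add: unary_prefix_def length_takeWhile_le)
    let ?T0 = "init_tapes w"
    let ?T1 = "?T0(0 := word_tape [], 1 := word_tape w)"
    have 1: "run fetch_input (?B1 ?l) ?T0 ?T1"
      by (rule run_fetch_input) (simp_all add: init_tapes_def)
    define T2 where "T2 = (fill ?T1 ?vs (loop_tape ?n 0))(1 := (word_content w, int ?n))"
    have 2: "run (init_loops ?vs) (?B2 ?l) ?T1 T2"
      unfolding T2_def by (rule run_init_loops) (auto simp: init_tapes_def)
    have T2: "T2 1 = (word_content w, int ?n)" "T2 2 = flag_tape False" "T2 0 = end_tape []"
      by (auto simp: T2_def fill_def init_tapes_def word_tape_eq flag_tape_def end_tape_def word_content_Nil)
    have loops: "T2 v = loop_tape ?n 0" if "3 \<le> v" "v < var_tape D" for v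
      using that by (simp add: T2_def fill_def)
    have sc: "scratch_ok ?n T2"
      unfolding scratch_ok_def using loops by (simp add: var_tape_def)
    let ?T3 = "T2(1 := (word_content w, int (?n + 1 + 2 * sum_list (map ((^) ?n) \<sigma>))),
        2 := flag_tape (\<not> well_formed \<sigma> w))"
    have 3: "run validate (V ?n) T2 ?T3" by (rule V(2)[OF sc T2(1,2)])
    have "\<exists>x T'. run (Ife 2 [0] (go_back 1 ;; compile c 0 ;; go_back 0) Nop) (Suc (?B4 ?l ?n)) ?T3 T' \<and>
      T' 0 = word_tape x \<and>
      (if well_formed \<sigma> w then \<exists>n G. w = encode \<sigma> n G \<and> x = emits n G [] c else x = [])"
    proof (cases "well_formed \<sigma> w")
      case False
      have "run (Ife 2 [0] (go_back 1 ;; compile c 0 ;; go_back 0) Nop) (Suc (?B4 ?l ?n)) ?T3 ?T3"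
        by (rule run_Ife) (use False run_mono[OF run_Nop, of "?B4 ?l ?n" ?T3] in simp_all)
      moreover have "?T3 0 = word_tape []" using T2(3) by (simp add: end_tape_def word_tape_eq)
      ultimately show ?thesis using False by (metis (full_types))
    next
      case True
      then obtain G where w: "w = encode \<sigma> ?n G" by (rule well_formed_encodeE)
      let ?x = "emits ?n G [] c"
      let ?T4 = "T2(1 := word_tape w)"
      \<comment> \<open>On a well-formed input, validation leaves the head at the first blank after
        the word, from where \<open>go_back\<close> can rewind.\<close>
      have len: "?n + 1 + 2 * sum_list (map ((^) ?n) \<sigma>) = ?l"
        using arg_cong[OF w, of length] by (simp only: length_encode)
      have "run (go_back 1) (2 * ?l + 20) ?T3 (?T3(1 := word_tape w))"
        unfolding len by (rule run_go_back[where h = ?l]) simp_all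
      moreover have "?T3(1 := word_tape w) = ?T4"
        using True T2(2) by (auto simp: fun_eq_iff)
      ultimately have a: "run (go_back 1) (2 * ?l + 20) ?T3 ?T4" by (simp only:)
      have "ready w ?n [] ?T4"
        unfolding ready_def using sc T2 loops by (auto simp: var_tape_def)
      then have "ready (encode \<sigma> ?n G) ?n [] ?T4" using w by metis
      then have "run (compile c 0) (F ?n) (?T4(0 := end_tape [])) (?T4(0 := end_tape ([] @ ?x)))"
        by (rule implementsD[OF c]) (simp_all add: T2)
      moreover have "?T4(0 := end_tape []) = ?T4" using T2(3) by (auto simp: fun_eq_iff)
      ultimately have b: "run (compile c 0) (F ?n) ?T4 (?T4(0 := end_tape ?x))"
        by (simp only: append.simps)
      have "run (go_back 0) (2 * length ?x + 20) (?T4(0 := end_tape ?x)) ((?T4(0 := end_tape ?x))(0 := word_tape ?x))"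
        by (rule run_go_back[where h = "length ?x"]) (simp_all add: end_tape_def)
      then have d: "run (go_back 0) (2 * E ?n + 20) (?T4(0 := end_tape ?x)) (?T4(0 := word_tape ?x))"
        using E(2)[of ?n G "[]"] by (auto intro: run_mono)
      have "run (Ife 2 [0] (go_back 1 ;; compile c 0 ;; go_back 0) Nop) (Suc (?B4 ?l ?n)) ?T3 (?T4(0 := word_tape ?x))"
        by (rule run_Ife) (use True run_Seq[OF a run_Seq[OF b d]] in simp_all)
      then show ?thesis using True w
        by (intro exI[of _ ?x] exI[of _ "?T4(0 := word_tape ?x)"] conjI) (simp_all, blast)
    qed
    then obtain x T' where 4: "run (Ife 2 [0] (go_back 1 ;; compile c 0 ;; go_back 0) Nop) (Suc (?B4 ?l ?n)) ?T3 T'"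
      and x: "T' 0 = word_tape x"
        "if well_formed \<sigma> w then \<exists>n G. w = encode \<sigma> n G \<and> x = emits n G [] c else x = []"
      by blast
    have "run (main_prog c) (?B ?l ?n) ?T0 T'"
      unfolding main_prog_def by (rule run_Seq[OF 1 run_Seq[OF 2 run_Seq[OF 3 4]]])
    then have "run (main_prog c) (poly q ?l) ?T0 T'"
      by (rule run_mono) (rule bound[OF n])
    with x show ?thesis by blast
  qed
  then show ?thesis by blast
qed

section \<open>Programs stay within the allotted tapes and the alphabet\<close>

lemma prog_ok_reset: "v < k \<Longrightarrow> prog_ok k (reset v)"
  by (simp add: reset_def)

lemma prog_ok_for_loop: "v < k \<Longrightarrow> prog_ok k p \<Longrightarrow> prog_ok k (for_loop v p)"
  by (simp add: for_loop_def prog_ok_reset)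

lemma prog_ok_nest: "set vs \<subseteq> {..<k} \<Longrightarrow> prog_ok k p \<Longrightarrow> prog_ok k (nest vs p)"
  by (induction vs) (auto intro: prog_ok_for_loop)

lemma prog_ok_on_tapes: "(\<And>v. v \<in> set vs \<Longrightarrow> prog_ok k (p v)) \<Longrightarrow> prog_ok k (on_tapes p vs)"
  by (induction vs) auto

lemma prog_ok_scratch:
  "j \<le> sum_list \<sigma> \<Longrightarrow> prog_ok (var_tape D) p \<Longrightarrow> prog_ok (var_tape D) (nest (scratch j) p)"
  by (rule prog_ok_nest) (auto simp: scratch_def var_tape_def)

lemma prog_ok_skip2: "prog_ok (var_tape D) skip2"
  by (simp add: skip2_def var_tape_def)

lemma prog_ok_skip_tables: "set ks \<subseteq> {..sum_list \<sigma>} \<Longrightarrow> prog_ok (var_tape D) (skip_tables ks)"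
  by (induction ks) (auto intro: prog_ok_scratch prog_ok_skip2)

lemma prog_ok_skip_to_address:
  "length vs \<le> sum_list \<sigma> \<Longrightarrow> set vs \<subseteq> {..<D} \<Longrightarrow> prog_ok (var_tape D) (skip_to_address (map var_tape vs))"
  by (induction vs) (auto simp: repeat_def intro!: prog_ok_scratch prog_ok_skip2, auto simp: var_tape_def)

lemma prog_ok_eval_prog:
  "fm_ok \<sigma> d \<phi> \<Longrightarrow> d + fm_depth \<phi> \<le> D \<Longrightarrow> prog_ok (var_tape D) (eval_prog \<phi> d)"
proof (induction \<phi> arbitrary: d)
  case (Rel i vs a)
  have "length vs \<le> sum_list \<sigma>" "set (take i \<sigma>) \<subseteq> {..sum_list \<sigma>}" "set vs \<subseteq> {..<D}"
    using Rel by (auto intro: member_le_sum_list dest: in_set_takeD)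
  moreover have "2 < var_tape D" by (simp add: var_tape_def)
  ultimately show ?case
    using prog_ok_skip_tables prog_ok_skip_to_address
    by (simp add: lookup_def test_value_def rewind_def)
next
  case (Ex \<phi>)
  then have "prog_ok (var_tape D) (eval_prog \<phi> (Suc d))" by simp
  moreover have "2 < var_tape D" "var_tape d < var_tape D" using Ex.prems by (auto simp: var_tape_def)
  ultimately show ?case by (simp add: prog_ok_for_loop)
qed (auto simp: var_tape_def)

lemma prog_ok_compile:
  "cmd_ok \<sigma> d c \<Longrightarrow> d + cmd_depth c \<le> D \<Longrightarrow> prog_ok (var_tape D) (compile c d)"
proof (induction c arbitrary: d)
  case (Loop c)
  then have "prog_ok (var_tape D) (compile c (Suc d))" by simp
  moreover have "var_tape d < var_tape D" using Loop.prems by (auto simp: var_tape_def)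
  ultimately show ?case by (simp add: prog_ok_for_loop)
next
  case (Cond \<phi> c e)
  then have "prog_ok (var_tape D) (eval_prog \<phi> d)" by (intro prog_ok_eval_prog) auto
  moreover have "2 < var_tape D" by (simp add: var_tape_def)
  ultimately show ?case using Cond by simp
qed (auto simp: var_tape_def)

lemma prog_ok_check_tables: "set ks \<subseteq> {..sum_list \<sigma>} \<Longrightarrow> prog_ok (var_tape D) (check_tables ks)"
proof (induction ks)
  case (Cons k ks)
  have "prog_ok (var_tape D) check_value" by (simp add: check_value_def var_tape_def)
  then show ?case using Cons by (auto intro: prog_ok_scratch)
qed simp

lemma prog_ok_main_prog:
  assumes "cmd_ok \<sigma> 0 c" "cmd_depth c \<le> D"
  shows "prog_ok (var_tape D) (main_prog c)"
proof -
  have "2 < var_tape D" by (simp add: var_tape_def)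
  moreover have "prog_ok (var_tape D) (check_tables \<sigma>)"
    by (rule prog_ok_check_tables) (auto intro: member_le_sum_list)
  moreover have "prog_ok (var_tape D) (init_loops [3..<var_tape D])"
    using \<open>2 < var_tape D\<close>
    by (auto simp: init_loops_def prepare_tape_def grow_tape_def intro!: prog_ok_on_tapes prog_ok_reset)
  ultimately show ?thesis
    using prog_ok_compile[of 0 c] assms
    by (simp add: main_prog_def fetch_input_def validate_def go_back_def rewind_def)
qed

end

text \<open>Words that encode nothing are sent to the empty word, which encodes nothing either, so a
  reduction has to be specified on encodings only.\<close>

theorem transduction_poly_time:
  assumes "cmd_ok \<sigma> 0 c"
  obtains f where "poly_time_computable f"
    "\<And>w. (\<exists>n G. w = encode \<sigma> n G \<and> f w = emits n G [] c) \<or> (\<nexists>n G. w = encode \<sigma> n G) \<and> f w = []"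
proof -
  interpret transducer \<sigma> "cmd_depth c" .
  obtain F where F: "poly_bounded F" "implements F c 0"
    using compile_correct[of 0 c] assms by auto
  obtain q :: "nat poly" where q: "\<And>w. \<exists>x T'. run (main_prog c) (poly q (length w)) (init_tapes w) T' \<and>
      T' 0 = word_tape x \<and>
      (if well_formed \<sigma> w then \<exists>n G. w = encode \<sigma> n G \<and> x = emits n G [] c else x = [])"
    using run_main_prog[OF F] by blast
  then obtain f where f: "\<And>w. \<exists>T'. run (main_prog c) (poly q (length w)) (init_tapes w) T' \<and>
      T' 0 = word_tape (f w) \<and>
      (if well_formed \<sigma> w then \<exists>n G. w = encode \<sigma> n G \<and> f w = emits n G [] c else f w = [])"
    by metis
  have "poly_time_computable f"
  proof (rule prog_poly_time_computable)
    show "prog_ok (var_tape (cmd_depth c)) (main_prog c)"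
      by (rule prog_ok_main_prog) (use assms in simp_all)
    show "1 \<le> var_tape (cmd_depth c)" by (simp add: var_tape_def)
    show "\<exists>t T'. t \<le> poly q (length w) \<and> exec (main_prog c) (init_tapes w) t T' \<and> T' 0 = word_tape (f w)" for w
      using f[of w] unfolding run_def by blast
  qed
  moreover have "(\<exists>n G. w = encode \<sigma> n G \<and> f w = emits n G [] c) \<or> (\<nexists>n G. w = encode \<sigma> n G) \<and> f w = []" for w
    using f[of w] well_formed_encode by (metis (full_types))
  ultimately show ?thesis by (rule that)
qed


section \<open>Merging the symbols of a signature into a single one\<close>

lemma encode_inject:
  assumes "encode \<sigma> n G = encode \<sigma> m H"
  shows "n = m" "\<And>i t. i < length \<sigma> \<Longrightarrow> t \<in> tuples {..<n} (\<sigma> ! i) \<Longrightarrow> interp G i t = interp H i t"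
proof -
  show nm: "n = m"
    using arg_cong[OF assms, of unary_prefix] by (simp add: encode_eq)
  fix i t assume i: "i < length \<sigma>" and t: "t \<in> tuples {..<n} (\<sigma> ! i)"
  then have "length t = \<sigma> ! i" "set t \<subseteq> {..<n}" by (auto simp: tuples_def)
  from encode_nth_value[OF i this, of G] encode_nth_value[OF i this, of H] assms nm
  show "interp G i t = interp H i t" unfolding encode_value_eq_iff by metis
qed

text \<open>An encoding determines the values at all tuples over the domain but ignores the field
  \<open>universe\<close>, which is therefore set explicitly.\<close>

lemma encode_in_MP_iff:
  "encode \<sigma> n G \<in> MP \<sigma> A \<longleftrightarrow> (\<exists>h. homomorphism \<sigma> h (G\<lparr>universe := {..<n}\<rparr>) A)"
proof
  assume "encode \<sigma> n G \<in> MP \<sigma> A"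
  then obtain m H h where H: "encode \<sigma> n G = encode \<sigma> m H" "universe H = {..<m}" "homomorphism \<sigma> h H A"
    by (auto simp: MP_def)
  have "homomorphism \<sigma> h (G\<lparr>universe := {..<n}\<rparr>) A"
    using H(2,3) encode_inject[OF H(1)] by (simp add: homomorphism_def)
  then show "\<exists>h. homomorphism \<sigma> h (G\<lparr>universe := {..<n}\<rparr>) A" by blast
next
  assume "\<exists>h. homomorphism \<sigma> h (G\<lparr>universe := {..<n}\<rparr>) A"
  moreover have "encode \<sigma> n G = encode \<sigma> n (G\<lparr>universe := {..<n}\<rparr>)"
    by (simp add: encode_def)
  ultimately show "encode \<sigma> n G \<in> MP \<sigma> A"
    unfolding MP_def by force
qed

lemma MP_encoding: "w \<in> MP \<sigma> A \<Longrightarrow> \<exists>n G. w = encode \<sigma> n G"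
  by (auto simp: MP_def)

lemma Nil_notin_MP: "[] \<notin> MP \<sigma> A"
  by (auto simp: MP_def encode_def)

lemma encode_0:
  assumes "\<forall>k \<in> set \<sigma>. k \<ge> 1"
  shows "encode \<sigma> 0 G = [False]"
proof -
  have "product_lists (replicate (\<sigma> ! i) [0..<0]) = []" if "i < length \<sigma>" for i
  proof -
    have "\<sigma> ! i \<noteq> 0" using assms that by (metis nth_mem not_one_le_zero)
    then obtain j where "\<sigma> ! i = Suc j" by (cases "\<sigma> ! i") auto
    then show ?thesis by simp
  qed
  then show ?thesis by (simp add: encode_def)
qed

lemma homomorphism_empty:
  assumes "\<forall>k \<in> set \<sigma>. k \<ge> 1" "universe G = {}"
  shows "homomorphism \<sigma> h G A"
proof -
  have "tuples {} (\<sigma> ! i) = {}" if "i < length \<sigma>" for i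
    using assms(1) nth_mem[OF that] by (auto simp: tuples_def)
  then show ?thesis using assms(2) by (auto simp: homomorphism_def)
qed

text \<open>Only the empty instance maps into the empty template, and with positive arities its
  tables are empty. The language is thus the same for all such signatures.\<close>

lemma MP_empty_template:
  assumes "\<forall>k \<in> set \<sigma>. k \<ge> 1" "universe A = {}"
  shows "MP \<sigma> A = {[False]}"
proof -
  have "n = 0" if "homomorphism \<sigma> h G A" "universe G = {..<n}" for h n and G :: "(nat, pstar) struct"
    using that assms(2) by (auto simp: homomorphism_def lessThan_empty_iff bot_nat_def)
  then have "MP \<sigma> A \<subseteq> {[False]}"
    using encode_0[OF assms(1)] by (fastforce simp: MP_def)
  moreover have "[False] \<in> MP \<sigma> A"
    using encode_in_MP_iff[of \<sigma> 0 A A] homomorphism_empty[OF assms(1), of "A\<lparr>universe := {..<0}\<rparr>" id A]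
    by (auto simp: encode_0[OF assms(1)])
  ultimately show ?thesis by blast
qed

lemma product_lists_map: "product_lists (replicate r (map g xs)) = map (map g) (product_lists (replicate r xs))"
  by (induction r) (simp_all add: map_concat comp_def)

lemma concat_map_product_lists_Suc:
  "concat (map F (product_lists (replicate (Suc r) xs))) =
    concat (map (\<lambda>x. concat (map (\<lambda>t. F (x # t)) (product_lists (replicate r xs)))) xs)"
  by (simp add: concat_map_concat_map comp_def)

text \<open>The bound \<open>i + \<sigma> ! i \<le> K\<close> makes room for i copies of c in front
  of the block. The strict bound \<open>\<sigma> ! i < K\<close> puts at least one c into every
  coded tuple.\<close>

locale lifting =
  fixes \<sigma> :: signature and K :: nat
  assumes pos: "\<And>k. k \<in> set \<sigma> \<Longrightarrow> k \<ge> 1"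
    and fits: "\<And>i. i < length \<sigma> \<Longrightarrow> i + \<sigma> ! i \<le> K" "\<And>i. i < length \<sigma> \<Longrightarrow> \<sigma> ! i < K"
    and K_pos: "K \<ge> 1"
begin

text \<open>The value of the symbol \<open>i\<close> at a tuple \<open>t\<close> is found at \<open>c\<^sup>i t c\<^sup>j\<close>, where \<open>c\<close> is a new
  element; patterns record the positions of \<open>c\<close>.\<close>

definition pattern :: "nat \<Rightarrow> bool list" where
  "pattern i = replicate i True @ replicate (\<sigma> ! i) False @ replicate (K - i - \<sigma> ! i) True"

text \<open>A coded block is nonempty, so the number of leading True entries is the only candidate
  for the index of the symbol.\<close>

definition is_code :: "bool list \<Rightarrow> bool" where
  "is_code bs \<longleftrightarrow> length (takeWhile id bs) < length \<sigma> \<and> bs = pattern (length (takeWhile id bs))"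

definition lift_value :: "(nat \<Rightarrow> 'a list \<Rightarrow> pstar) \<Rightarrow> ('a \<Rightarrow> bool) \<Rightarrow> 'a list \<Rightarrow> pstar" where
  "lift_value I C t =
    (let bs = map C t; i = length (takeWhile id bs) in
     if is_code bs then I i (take (\<sigma> ! i) (drop i t))
     else if list_all id bs then One else Zero)"

definition lift_struct :: "('a, pstar) struct \<Rightarrow> 'a \<Rightarrow> ('a, pstar) struct" where
  "lift_struct G c = \<lparr>universe = insert c (universe G), interp = (\<lambda>_. lift_value (interp G) (\<lambda>x. x = c))\<rparr>"

lemma length_pattern: "i < length \<sigma> \<Longrightarrow> length (pattern i) = K"
  using fits(1)[of i] by (simp add: pattern_def)

lemma takeWhile_pattern: "i < length \<sigma> \<Longrightarrow> length (takeWhile id (pattern i)) = i"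
proof -
  assume "i < length \<sigma>"
  then have "\<sigma> ! i \<noteq> 0" using pos by (metis nth_mem not_one_le_zero)
  then obtain j where "\<sigma> ! i = Suc j" by (cases "\<sigma> ! i") auto
  then show ?thesis by (simp add: pattern_def takeWhile_append)
qed

lemma is_code_iff: "is_code bs \<longleftrightarrow> (\<exists>i<length \<sigma>. bs = pattern i)"
  using takeWhile_pattern unfolding is_code_def by metis

lemma lift_value_code:
  assumes "i < length \<sigma>" "map C t = pattern i"
  shows "lift_value I C t = I i (take (\<sigma> ! i) (drop i t))"
  using assms is_code_iff takeWhile_pattern by (auto simp: lift_value_def Let_def)

lemma lift_value_not_code:
  "\<not> is_code (map C t) \<Longrightarrow> lift_value I C t = (if list_all id (map C t) then One else Zero)"
  by (simp add: lift_value_def Let_def)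

text \<open>A pattern contains False because arities are positive and True because they are less
  than \<open>K\<close>.\<close>

lemma constant_not_code: "\<not> is_code (replicate K b)"
proof
  assume "is_code (replicate K b)"
  then obtain i where i: "i < length \<sigma>" "replicate K b = pattern i" by (auto simp: is_code_iff)
  have "\<sigma> ! i \<ge> 1" using i(1) pos by simp
  then have "False \<in> set (pattern i)" by (simp add: pattern_def)
  moreover have "True \<in> set (pattern i)"
    using fits[OF i(1)] by (auto simp: pattern_def)
  ultimately show False using i(2) by (metis in_set_replicate)
qed

lemma lift_value_constant: "lift_value I C (replicate K x) = (if C x then One else Zero)"
  using lift_value_not_code[of C "replicate K x" I] constant_not_code[of "C x"] K_pos
  by (auto simp: list_all_iff in_set_replicate)

lemma pattern_args:
  assumes "i < length \<sigma>" "map C t = pattern i"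
  shows "length (take (\<sigma> ! i) (drop i t)) = \<sigma> ! i" "\<forall>x \<in> set (take (\<sigma> ! i) (drop i t)). \<not> C x"
    "t = take i t @ take (\<sigma> ! i) (drop i t) @ drop (i + \<sigma> ! i) t"
    "\<forall>x \<in> set (take i t @ drop (i + \<sigma> ! i) t). C x"
proof -
  have len: "length t = K" using arg_cong[OF assms(2), of length] length_pattern[OF assms(1)] by simp
  then show "length (take (\<sigma> ! i) (drop i t)) = \<sigma> ! i" using fits(1)[OF assms(1)] by simp
  have "map C (take (\<sigma> ! i) (drop i t)) = take (\<sigma> ! i) (drop i (pattern i))"
    by (simp add: take_map drop_map assms(2)[symmetric])
  also have "\<dots> = replicate (\<sigma> ! i) False" by (simp add: pattern_def)
  finally show "\<forall>x \<in> set (take (\<sigma> ! i) (drop i t)). \<not> C x"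
    by (metis (full_types) in_set_replicate list.set_map imageI)
  show "t = take i t @ take (\<sigma> ! i) (drop i t) @ drop (i + \<sigma> ! i) t"
    by (metis append_take_drop_id drop_drop add.commute)
  have "map C (take i t @ drop (i + \<sigma> ! i) t) = take i (pattern i) @ drop (i + \<sigma> ! i) (pattern i)"
    by (simp add: take_map drop_map assms(2)[symmetric])
  also have "\<dots> = replicate (i + (K - i - \<sigma> ! i)) True"
    by (simp add: pattern_def replicate_add)
  finally show "\<forall>x \<in> set (take i t @ drop (i + \<sigma> ! i) t). C x"
    by (metis (full_types) in_set_replicate list.set_map imageI)
qed

text \<open>A map that preserves being new preserves the pattern of a tuple. Uncoded values depend
  on the pattern alone, so only coded tuples need a comparison.\<close>

lemma lift_value_mono:
  assumes C: "\<And>x. x \<in> set t \<Longrightarrow> D (h x) \<longleftrightarrow> C x"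
    and code: "\<And>i. i < length \<sigma> \<Longrightarrow> map C t = pattern i \<Longrightarrow>
      I i (take (\<sigma> ! i) (drop i t)) \<le> J i (map h (take (\<sigma> ! i) (drop i t)))"
  shows "lift_value I C t \<le> lift_value J D (map h t)"
proof -
  have D: "map D (map h t) = map C t" using C by simp
  show ?thesis
  proof (cases "is_code (map C t)")
    case True
    then obtain i where i: "i < length \<sigma>" "map C t = pattern i" by (auto simp: is_code_iff)
    with D have "map D (map h t) = pattern i" by simp
    from lift_value_code[OF i(1) this, of J] lift_value_code[OF i, of I] code[OF i]
    show ?thesis by (simp add: take_map drop_map)
  next
    case False
    then have "lift_value I C t = lift_value J D (map h t)"
      using lift_value_not_code[of C t I] lift_value_not_code[of D "map h t" J] unfolding D by simp
    then show ?thesis by simp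
  qed
qed

lemma pattern_tuple:
  assumes "i < length \<sigma>" "length s = \<sigma> ! i" "\<forall>x \<in> set s. \<not> C x" "length y = K - \<sigma> ! i" "\<forall>x \<in> set y. C x"
  shows "map C (take i y @ s @ drop i y) = pattern i"
proof -
  have "map C y = replicate (K - \<sigma> ! i) True" "map C s = replicate (\<sigma> ! i) False"
    using assms by (auto intro!: replicate_eqI)
  then show ?thesis
    using fits(1)[OF assms(1)]
    by (auto simp: pattern_def take_map[symmetric] drop_map[symmetric] min_def diff_commute add.commute)
qed

lemma homomorphism_lift_struct_iff:
  assumes c: "c \<notin> universe G" and d: "d \<notin> universe H"
  shows "(\<exists>h. homomorphism [K] h (lift_struct G c) (lift_struct H d)) \<longleftrightarrow> (\<exists>h. homomorphism \<sigma> h G H)"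
proof
  assume "\<exists>h. homomorphism [K] h (lift_struct G c) (lift_struct H d)"
  then obtain h where dom: "h ` insert c (universe G) \<subseteq> insert d (universe H)"
    and le: "\<And>t. t \<in> tuples (insert c (universe G)) K \<Longrightarrow>
      lift_value (interp G) (\<lambda>x. x = c) t \<le> lift_value (interp H) (\<lambda>x. x = d) (map h t)"
    by (auto simp: homomorphism_def lift_struct_def)
  \<comment> \<open>Constant tuples have value \<open>Zero\<close> or \<open>One\<close> on both
    sides, and between these the order is equality; so h preserves and reflects being the new
    element.\<close>
  have const: "(if x = c then One else Zero) \<le> (if h x = d then One else Zero)"
    if "x \<in> insert c (universe G)" for x
  proof -
    have "replicate K x \<in> tuples (insert c (universe G)) K"
      using that by (auto simp: tuples_def)
    from le[OF this] show ?thesis unfolding map_replicate lift_value_constant .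
  qed
  have hc: "h c = d" using const[of c] by (auto simp: less_eq_pstar_def split: if_splits)
  have hx: "h x \<noteq> d" if "x \<in> universe G" for x
    using const[of x] that c by (auto simp: less_eq_pstar_def split: if_splits)
  have "homomorphism \<sigma> h G H"
    unfolding homomorphism_def
  proof (intro conjI allI impI ballI)
    show "h ` universe G \<subseteq> universe H" using dom hx by blast
    fix i t assume i: "i < length \<sigma>" and t: "t \<in> tuples (universe G) (\<sigma> ! i)"
    \<comment> \<open>Both outer blocks of the coded tuple, kept in one list that is split at
      i.\<close>
    let ?y = "replicate (K - \<sigma> ! i) c"
    let ?u = "take i ?y @ t @ drop i ?y"
    have lt: "length t = \<sigma> ! i" "set t \<subseteq> universe G" using t by (auto simp: tuples_def)
    have len: "length (take i ?y) = i" using fits(1)[OF i] by simp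
    have "?u \<in> tuples (insert c (universe G)) K"
      using lt fits[OF i] by (auto simp: tuples_def)
    note 1 = le[OF this]
    have "map (\<lambda>x. x = c) ?u = pattern i"
      by (rule pattern_tuple[OF i lt(1)]) (use lt c in auto)
    from lift_value_code[OF i this, of "interp G"]
    have 2: "lift_value (interp G) (\<lambda>x. x = c) ?u = interp G i t" using len lt(1) by simp
    have "map h ?u = take i (map h ?y) @ map h t @ drop i (map h ?y)"
      by (simp add: take_map drop_map)
    moreover have "map (\<lambda>x. x = d) (take i (map h ?y) @ map h t @ drop i (map h ?y)) = pattern i"
      by (rule pattern_tuple[OF i]) (use lt hx hc in auto)
    ultimately have "map (\<lambda>x. x = d) (map h ?u) = pattern i" by (simp only:)
    from lift_value_code[OF i this, of "interp H"]
    have "lift_value (interp H) (\<lambda>x. x = d) (map h ?u) = interp H i (map h t)"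
      using len lt(1) by simp
    with 1 2 show "interp G i t \<le> interp H i (map h t)" by simp
  qed
  then show "\<exists>h. homomorphism \<sigma> h G H" by blast
next
  assume "\<exists>h. homomorphism \<sigma> h G H"
  then obtain h where h: "homomorphism \<sigma> h G H" ..
  let ?h = "h(c := d)"
  have "lift_value (interp G) (\<lambda>x. x = c) t \<le> lift_value (interp H) (\<lambda>x. x = d) (map ?h t)"
    if t: "t \<in> tuples (insert c (universe G)) K" for t
  proof (rule lift_value_mono)
    fix x assume "x \<in> set t"
    then show "?h x = d \<longleftrightarrow> x = c" using t h d by (auto simp: tuples_def homomorphism_def)
  next
    fix i assume i: "i < length \<sigma>" "map (\<lambda>x. x = c) t = pattern i"
    let ?s = "take (\<sigma> ! i) (drop i t)"
    note args = pattern_args[OF i]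
    have "set ?s \<subseteq> set t" by (meson set_drop_subset set_take_subset subset_trans)
    then have "?s \<in> tuples (universe G) (\<sigma> ! i)"
      using args(1,2) t by (auto simp: tuples_def)
    then have "interp G i ?s \<le> interp H i (map h ?s)"
      using h i(1) unfolding homomorphism_def by blast
    moreover have "map ?h ?s = map h ?s" using args(2) by simp
    ultimately show "interp G i ?s \<le> interp H i (map ?h ?s)"
      by (simp only:)
  qed
  then have "homomorphism [K] ?h (lift_struct G c) (lift_struct H d)"
    using h by (auto simp: homomorphism_def lift_struct_def)
  then show "\<exists>h. homomorphism [K] h (lift_struct G c) (lift_struct H d)" by blast
qed


subsection \<open>From the signature to a single symbol\<close>

definition emit_value :: "pstar \<Rightarrow> cmd" where
  "emit_value a = Sequ (Emit (encode_value a ! 0)) (Emit (encode_value a ! 1))"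

lemma emits_emit_value [simp]: "emits n G xs (emit_value a) = encode_value a"
  by (cases a) (simp_all add: emit_value_def)

lemma cmd_ok_emit_value [simp]: "cmd_ok \<tau> d (emit_value a)"
  by (simp add: emit_value_def)

definition emit_rel :: "nat \<Rightarrow> nat list \<Rightarrow> cmd" where
  "emit_rel i vs = Cond (Rel i vs Star) (emit_value Star)
     (Cond (Rel i vs One) (emit_value One) (emit_value Zero))"

lemma emits_emit_rel: "emits n G xs (emit_rel i vs) = encode_value (interp G i (map ((!) xs) vs))"
  by (cases "interp G i (map ((!) xs) vs)") (simp_all add: emit_rel_def)

text \<open>In the following, \<open>None\<close> stands for the new element and \<open>Some v\<close> for the value of the
  variable \<open>v\<close>; all combinations are unrolled statically.\<close>

definition lift_leaf :: "nat option list \<Rightarrow> cmd" where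
  "lift_leaf pat = (let bs = map (\<lambda>x. x = None) pat; i = length (takeWhile id bs) in
     if is_code bs then emit_rel i (map the (take (\<sigma> ! i) (drop i pat)))
     else if list_all id bs then emit_value One else emit_value Zero)"

text \<open>The new element is numbered n, after the old ones. Its case therefore follows the loop,
  in agreement with the lexicographic order over n + 1 elements.\<close>

primrec lift_cmd :: "nat \<Rightarrow> nat option list \<Rightarrow> nat \<Rightarrow> cmd" where
  "lift_cmd 0 pat d = lift_leaf pat"
| "lift_cmd (Suc r) pat d = Sequ (Loop (lift_cmd r (pat @ [Some d]) (Suc d))) (lift_cmd r (pat @ [None]) d)"

definition inst :: "nat \<Rightarrow> nat list \<Rightarrow> nat option \<Rightarrow> nat" where
  "inst n xs x = (case x of None \<Rightarrow> n | Some v \<Rightarrow> xs ! v)"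

lemma emits_lift_leaf:
  assumes "set xs \<subseteq> {..<n}" "\<And>v. Some v \<in> set pat \<Longrightarrow> v < length xs"
  shows "emits n G xs (lift_leaf pat) =
    encode_value (lift_value (interp G) (\<lambda>x. x = n) (map (inst n xs) pat))"
proof -
  have eq: "inst n xs x = n \<longleftrightarrow> x = None" if "x \<in> set pat" for x
  proof (cases x)
    case (Some v)
    then have "xs ! v \<in> set xs" using assms(2)[of v] that by simp
    then show ?thesis using Some assms(1) by (auto simp: inst_def)
  qed (simp add: inst_def)
  then have bs: "map (\<lambda>x. x = n) (map (inst n xs) pat) = map (\<lambda>x. x = None) pat" by simp
  show ?thesis
  proof (cases "is_code (map (\<lambda>x. x = None) pat)")
    case True
    then obtain i where i: "i < length \<sigma>" "map (\<lambda>x. x = None) pat = pattern i" by (auto simp: is_code_iff)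
    let ?us = "take (\<sigma> ! i) (drop i pat)"
    have us: "map ((!) xs) (map the ?us) = map (inst n xs) ?us"
      using pattern_args(2)[OF i] by (auto simp: inst_def)
    have "lift_leaf pat = emit_rel i (map the ?us)"
      using True i takeWhile_pattern by (simp add: lift_leaf_def Let_def)
    then have "emits n G xs (lift_leaf pat) = encode_value (interp G i (map (inst n xs) ?us))"
      by (simp only: emits_emit_rel us)
    moreover have "map (\<lambda>x. x = n) (map (inst n xs) pat) = pattern i" using bs i(2) by simp
    from lift_value_code[OF i(1) this, of "interp G"]
    have "lift_value (interp G) (\<lambda>x. x = n) (map (inst n xs) pat) = interp G i (map (inst n xs) ?us)"
      by (simp add: take_map drop_map)
    ultimately show ?thesis by simp
  next
    case False
    then have "emits n G xs (lift_leaf pat) =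
        encode_value (if list_all id (map (\<lambda>x. x = None) pat) then One else Zero)"
      by (simp add: lift_leaf_def Let_def)
    then show ?thesis
      using lift_value_not_code[of "\<lambda>x. x = n" "map (inst n xs) pat" "interp G"] False unfolding bs by simp
  qed
qed

lemma emits_lift_cmd:
  assumes "set xs \<subseteq> {..<n}" "\<And>v. Some v \<in> set pat \<Longrightarrow> v < length xs"
  shows "emits n G xs (lift_cmd r pat (length xs)) = concat (map
    (\<lambda>t. encode_value (lift_value (interp G) (\<lambda>x. x = n) (map (inst n xs) pat @ t)))
    (product_lists (replicate r [0..<Suc n])))"
  using assms
proof (induction r arbitrary: pat xs)
  case 0
  then show ?case using emits_lift_leaf[of xs n pat G] by simp
next
  case (Suc r)
  let ?P = "product_lists (replicate r [0..<Suc n])"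
  let ?e = "\<lambda>t. encode_value (lift_value (interp G) (\<lambda>x. x = n) t)"
  let ?p = "map (inst n xs) pat"
  have "emits n G (xs @ [x]) (lift_cmd r (pat @ [Some (length xs)]) (Suc (length xs)))
      = concat (map (\<lambda>t. ?e (?p @ x # t)) ?P)" if x: "x < n" for x
  proof -
    have "emits n G (xs @ [x]) (lift_cmd r (pat @ [Some (length xs)]) (length (xs @ [x])))
        = concat (map (\<lambda>t. ?e (map (inst n (xs @ [x])) (pat @ [Some (length xs)]) @ t)) ?P)"
      by (rule Suc.IH) (use Suc.prems x in \<open>auto simp: less_Suc_eq\<close>)
    moreover have "inst n (xs @ [x]) y = inst n xs y" if "y \<in> set pat" for y
      using Suc.prems(2) that by (cases y) (auto simp: inst_def nth_append)
    then have "map (inst n (xs @ [x])) (pat @ [Some (length xs)]) = ?p @ [x]"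
      by (simp add: inst_def)
    ultimately show ?thesis by (simp only: length_append_singleton append_assoc append.simps)
  qed
  then have loop: "emits n G xs (Loop (lift_cmd r (pat @ [Some (length xs)]) (Suc (length xs))))
      = concat (map (\<lambda>x. concat (map (\<lambda>t. ?e (?p @ x # t)) ?P)) [0..<n])"
    by (auto intro!: arg_cong[of _ _ concat] map_cong)
  have "emits n G xs (lift_cmd r (pat @ [None]) (length xs))
      = concat (map (\<lambda>t. ?e (map (inst n xs) (pat @ [None]) @ t)) ?P)"
    by (rule Suc.IH) (use Suc.prems in auto)
  then have none: "emits n G xs (lift_cmd r (pat @ [None]) (length xs)) = concat (map (\<lambda>t. ?e (?p @ n # t)) ?P)"
    by (simp add: inst_def)
  have "concat (map (\<lambda>t. ?e (?p @ t)) (product_lists (replicate (Suc r) [0..<Suc n])))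
      = concat (map (\<lambda>x. concat (map (\<lambda>t. ?e (?p @ x # t)) ?P)) [0..<Suc n])"
    by (rule concat_map_product_lists_Suc)
  then show ?case using loop none by simp
qed

lemma cmd_ok_lift_leaf:
  assumes "\<And>v. Some v \<in> set pat \<Longrightarrow> v < d"
  shows "cmd_ok \<sigma> d (lift_leaf pat)"
proof (cases "is_code (map (\<lambda>x. x = None) pat)")
  case True
  then obtain i where i: "i < length \<sigma>" "map (\<lambda>x. x = None) pat = pattern i" by (auto simp: is_code_iff)
  let ?us = "take (\<sigma> ! i) (drop i pat)"
  have "set ?us \<subseteq> set pat" by (meson set_drop_subset set_take_subset subset_trans)
  then have "set (map the ?us) \<subseteq> {..<d}"
    using pattern_args(2)[OF i] assms by auto
  then show ?thesis
    using True i takeWhile_pattern pattern_args(1)[OF i]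
    by (simp add: lift_leaf_def Let_def emit_rel_def)
qed (simp add: lift_leaf_def Let_def)

lemma cmd_ok_lift_cmd:
  "(\<And>v. Some v \<in> set pat \<Longrightarrow> v < d) \<Longrightarrow> cmd_ok \<sigma> d (lift_cmd r pat d)"
proof (induction r arbitrary: pat d)
  case (Suc r)
  have "cmd_ok \<sigma> (Suc d) (lift_cmd r (pat @ [Some d]) (Suc d))"
    by (rule Suc.IH) (use Suc.prems in \<open>auto simp: less_Suc_eq\<close>)
  moreover have "cmd_ok \<sigma> d (lift_cmd r (pat @ [None]) d)"
    by (rule Suc.IH) (use Suc.prems in auto)
  ultimately show ?case by simp
qed (simp add: cmd_ok_lift_leaf)

lemma MP_reducible_to_lift:
  assumes c: "c \<notin> universe A"
  shows "poly_reducible (MP \<sigma> A) (MP [K] (lift_struct A c))"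
proof -
  \<comment> \<open>The additional \<open>Emit True\<close> counts the new element in the unary
    size.\<close>
  define p where "p = Sequ (Loop (Emit True)) (Sequ (Emit True) (Sequ (Emit False) (lift_cmd K [] 0)))"
  have "cmd_ok \<sigma> 0 p" using cmd_ok_lift_cmd[of "[]" 0 K] by (simp add: p_def)
  then obtain f where f: "poly_time_computable f"
    "\<And>w. (\<exists>n G. w = encode \<sigma> n G \<and> f w = emits n G [] p) \<or> (\<nexists>n G. w = encode \<sigma> n G) \<and> f w = []"
    by (rule transduction_poly_time) blast
  have p: "emits n G [] p = encode [K] (Suc n) (lift_struct G n)" for n G
  proof -
    have "concat (map (\<lambda>x. [True]) [0..<n]) = replicate n True"
      by (induction n) (simp_all add: replicate_append_same)
    then show ?thesis
      using emits_lift_cmd[of "[]" n "[]" G K]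
      by (simp add: p_def encode_def lift_struct_def replicate_append_same del: upt_Suc replicate_Suc)
        (simp add: replicate_append_same[symmetric])
  qed
  have "w \<in> MP \<sigma> A \<longleftrightarrow> f w \<in> MP [K] (lift_struct A c)" for w
    using f(2)[of w]
  proof
    assume "\<exists>n G. w = encode \<sigma> n G \<and> f w = emits n G [] p"
    then obtain n G where w: "w = encode \<sigma> n G" "f w = encode [K] (Suc n) (lift_struct G n)"
      using p by auto
    have "(lift_struct G n)\<lparr>universe := {..<Suc n}\<rparr> = lift_struct (G\<lparr>universe := {..<n}\<rparr>) n"
      by (auto simp: lift_struct_def)
    then show ?thesis
      unfolding w(2) unfolding w(1) encode_in_MP_iff
      using homomorphism_lift_struct_iff[of n "G\<lparr>universe := {..<n}\<rparr>" c A] c by simp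
  next
    assume "(\<nexists>n G. w = encode \<sigma> n G) \<and> f w = []"
    then show ?thesis using MP_encoding Nil_notin_MP by metis
  qed
  with f(1) show ?thesis unfolding poly_reducible_def by blast
qed


subsection \<open>From the single symbol back to the signature\<close>

text \<open>An element of an instance over the single symbol has to be mapped to the new element
  exactly if its constant tuple has value \<open>One\<close>.\<close>

definition is_new :: "(nat, pstar) struct \<Rightarrow> nat \<Rightarrow> bool" where
  "is_new H x \<longleftrightarrow> interp H 0 (replicate K x) = One"

text \<open>At uncoded tuples the value in the template is minimal, so a homomorphism forces
  equality. This includes constant tuples with value \<open>Star\<close>, whose element counts as
  old and would need \<open>Zero\<close>.\<close>

definition bad :: "nat \<Rightarrow> (nat, pstar) struct \<Rightarrow> bool" where
  "bad n H \<longleftrightarrow> (\<exists>t \<in> tuples {..<n} K. \<not> is_code (map (is_new H) t) \<and>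
     interp H 0 t \<noteq> (if list_all id (map (is_new H) t) then One else Zero))"

text \<open>The list y holds the new elements of both outer blocks, in the order in which they
  occur.\<close>

definition fillings :: "nat \<Rightarrow> (nat, pstar) struct \<Rightarrow> nat \<Rightarrow> nat list \<Rightarrow> pstar set" where
  "fillings n H i t = {interp H 0 (take i y @ t @ drop i y) | y.
     length y = K - \<sigma> ! i \<and> set y \<subseteq> {..<n} \<and> (\<forall>x \<in> set y. is_new H x)}"

text \<open>The least upper bound of a nonempty set: only \<open>Star\<close> lies above both
  \<open>Zero\<close> and \<open>One\<close>. The empty set has no least upper bound, and its value
  \<open>Zero\<close> is a default that \<open>join_le\<close> excludes.\<close>

definition join :: "pstar set \<Rightarrow> pstar" where
  "join V = (if Star \<in> V then Star else if One \<in> V then (if Zero \<in> V then Star else One) else Zero)"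

lemma le_join: "a \<in> V \<Longrightarrow> a \<le> join V"
  by (cases a) (auto simp: join_def less_eq_pstar_def)

lemma join_le:
  assumes "V \<noteq> {}" "\<And>a. a \<in> V \<Longrightarrow> a \<le> x"
  shows "join V \<le> x"
proof -
  obtain a where "a \<in> V" using assms(1) by blast
  then show ?thesis
    using assms(2)[of Zero] assms(2)[of One] assms(2)[of Star]
    by (cases x; cases a) (auto simp: join_def less_eq_pstar_def)
qed

definition olds :: "nat \<Rightarrow> (nat, pstar) struct \<Rightarrow> nat list" where
  "olds n H = filter (\<lambda>x. \<not> is_new H x) [0..<n]"

text \<open>The old elements are renumbered in increasing order, because an encodable domain is an
  initial segment of the natural numbers.\<close>

definition collapse :: "nat \<Rightarrow> (nat, pstar) struct \<Rightarrow> (nat, pstar) struct" where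
  "collapse n H = \<lparr>universe = {..<length (olds n H)},
     interp = (\<lambda>i s. join (fillings n H i (map ((!) (olds n H)) s)))\<rparr>"

lemma homomorphism_single_iff:
  "homomorphism [K] h H L \<longleftrightarrow> h ` universe H \<subseteq> universe L \<and>
     (\<forall>t \<in> tuples (universe H) K. interp H 0 t \<le> interp L 0 (map h t))"
  by (auto simp: homomorphism_def)

lemma homomorphism_singleD:
  "homomorphism [K] h H L \<Longrightarrow> t \<in> tuples (universe H) K \<Longrightarrow> interp H 0 t \<le> interp L 0 (map h t)"
  by (simp add: homomorphism_single_iff)

lemma interp_lift_struct [simp]:
  "interp (lift_struct G c) i t = lift_value (interp G) (\<lambda>x. x = c) t"
  by (simp add: lift_struct_def)

context
  fixes n :: nat and H A :: "(nat, pstar) struct" and c :: nat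
  assumes univ: "universe H = {..<n}" and c: "c \<notin> universe A"
begin

text \<open>The image of the constant tuple at v has value \<open>One\<close> or \<open>Zero\<close>
  according to whether v goes to c. Both are minimal, so the instance has that same value.\<close>

lemma new_iff:
  assumes h: "homomorphism [K] h H (lift_struct A c)" and v: "v < n"
  shows "h v = c \<longleftrightarrow> is_new H v"
proof -
  have "replicate K v \<in> tuples (universe H) K"
    unfolding univ tuples_def using v by (simp add: set_replicate_conv_if)
  from homomorphism_singleD[OF h this]
  have "interp H 0 (replicate K v) \<le> (if h v = c then One else Zero)"
    by (simp only: interp_lift_struct map_replicate lift_value_constant)
  then show ?thesis
    by (cases "h v = c") (simp_all add: is_new_def less_eq_pstar_def)
qed

lemma new_pattern:
  assumes h: "homomorphism [K] h H (lift_struct A c)" and t: "t \<in> tuples {..<n} K"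
  shows "map (\<lambda>x. x = c) (map h t) = map (is_new H) t"
  using new_iff[OF h] t by (auto simp: tuples_def)

lemma homomorphism_not_bad:
  assumes h: "homomorphism [K] h H (lift_struct A c)"
  shows "\<not> bad n H"
proof
  assume "bad n H"
  then obtain t where t: "t \<in> tuples {..<n} K" "\<not> is_code (map (is_new H) t)"
    "interp H 0 t \<noteq> (if list_all id (map (is_new H) t) then One else Zero)"
    unfolding bad_def by blast
  have "interp H 0 t \<le> lift_value (interp A) (\<lambda>x. x = c) (map h t)"
    using homomorphism_singleD[OF h, of t] t(1) univ by simp
  also have "\<dots> = (if list_all id (map (is_new H) t) then One else Zero)"
    using lift_value_not_code[of "\<lambda>x. x = c" "map h t" "interp A"] t(2)
    unfolding new_pattern[OF h t(1)] by simp
  finally show False using t(3) by (auto simp: less_eq_pstar_def split: if_splits)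
qed

text \<open>Without new elements no tuple has a coded pattern, so an instance that is not bad is
  \<open>Zero\<close> everywhere. Any constant map to an old element then works.\<close>

lemma homomorphism_no_new:
  assumes "\<not> bad n H" "\<And>v. v < n \<Longrightarrow> \<not> is_new H v" "a \<in> universe A"
  shows "homomorphism [K] (\<lambda>_. a) H (lift_struct A c)"
  unfolding homomorphism_single_iff
proof (intro conjI ballI)
  fix t assume "t \<in> tuples (universe H) K"
  then have t: "t \<in> tuples {..<n} K" by (simp add: univ)
  then have m: "map (is_new H) t = replicate K False"
    using assms(2) by (intro replicate_eqI) (auto simp: tuples_def)
  have "\<not> is_code (map (is_new H) t)" unfolding m by (rule constant_not_code)
  then have "interp H 0 t = (if list_all id (map (is_new H) t) then One else Zero)"
    using assms(1) t unfolding bad_def by blast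
  then have "interp H 0 t = Zero"
    unfolding m using K_pos by (simp add: list_all_iff)
  moreover have "map (\<lambda>_. a) t = replicate K a" using t by (simp add: tuples_def map_replicate_const)
  then have "interp (lift_struct A c) 0 (map (\<lambda>_. a) t) = Zero"
    using assms(3) c by (auto simp: lift_value_constant)
  ultimately show "interp H 0 t \<le> interp (lift_struct A c) 0 (map (\<lambda>_. a) t)" by (simp only: order_refl)
qed (use assms(3) in \<open>auto simp: lift_struct_def\<close>)

text \<open>All fillings of a tuple are mapped to the same coded tuple of the template, since every
  filler goes to c. Its value is an upper bound of the fillings and hence of their join.\<close>

lemma homomorphism_collapse:
  assumes h: "homomorphism [K] h H (lift_struct A c)" and v: "v < n" "is_new H v"
  shows "homomorphism \<sigma> (\<lambda>s. h (olds n H ! s)) (collapse n H) A"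
  unfolding homomorphism_def
proof (intro conjI allI impI ballI)
  have old: "olds n H ! s < n" "\<not> is_new H (olds n H ! s)" if "s < length (olds n H)" for s
    using nth_mem[OF that] by (auto simp: olds_def)
  show "(\<lambda>s. h (olds n H ! s)) ` universe (collapse n H) \<subseteq> universe A"
  proof
    fix y assume "y \<in> (\<lambda>s. h (olds n H ! s)) ` universe (collapse n H)"
    then obtain s where s: "s < length (olds n H)" "y = h (olds n H ! s)" by (auto simp: collapse_def)
    have "y \<noteq> c" using new_iff[OF h] old[OF s(1)] s(2) by blast
    moreover have "y \<in> insert c (universe A)"
      using h old(1)[OF s(1)] s(2) univ by (auto simp: homomorphism_def lift_struct_def)
    ultimately show "y \<in> universe A" by blast
  qed
  fix i s assume i: "i < length \<sigma>" and s: "s \<in> tuples (universe (collapse n H)) (\<sigma> ! i)"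
  let ?t = "map ((!) (olds n H)) s"
  have t: "length ?t = \<sigma> ! i" "set ?t \<subseteq> {..<n}" "\<forall>x \<in> set ?t. \<not> is_new H x"
    using s old by (auto simp: tuples_def collapse_def)
  have "join (fillings n H i ?t) \<le> interp A i (map h ?t)"
  proof (rule join_le)
    \<comment> \<open>Filling all outer positions with v shows that the join is taken over a
      nonempty set.\<close>
    have "interp H 0 (take i (replicate (K - \<sigma> ! i) v) @ ?t @ drop i (replicate (K - \<sigma> ! i) v)) \<in> fillings n H i ?t"
      unfolding fillings_def using v by fastforce
    then show "fillings n H i ?t \<noteq> {}" by blast
    fix a assume "a \<in> fillings n H i ?t"
    then obtain y where a: "a = interp H 0 (take i y @ ?t @ drop i y)"
      and y: "length y = K - \<sigma> ! i" "set y \<subseteq> {..<n}" "\<forall>x \<in> set y. is_new H x"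
      unfolding fillings_def by blast
    let ?u = "take i y @ ?t @ drop i y"
    have "length ?u = K" using y(1) t(1) fits[OF i] by simp
    moreover have "set ?u \<subseteq> {..<n}"
      using t(2) y(2) set_take_subset[of i y] set_drop_subset[of i y] by auto
    ultimately have u: "?u \<in> tuples {..<n} K" unfolding tuples_def by blast
    have "map (is_new H) ?u = pattern i"
      by (rule pattern_tuple[OF i]) (use t y in auto)
    then have pat: "map (\<lambda>x. x = c) (map h ?u) = pattern i" using new_pattern[OF h u] by simp
    have len: "length (take i y) = i" using y(1) fits(1)[OF i] by simp
    have "a \<le> lift_value (interp A) (\<lambda>x. x = c) (map h ?u)"
      using homomorphism_singleD[OF h, of ?u] u univ unfolding a by simp
    also have "\<dots> = interp A i (map h ?t)"
      using lift_value_code[OF i pat, of "interp A"] len t(1) by simp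
    finally show "a \<le> interp A i (map h ?t)" .
  qed
  then show "interp (collapse n H) i s \<le> interp A i (map (\<lambda>s. h (olds n H ! s)) s)"
    by (simp add: collapse_def comp_def)
qed

text \<open>New elements go to c, and an old one follows its number in \<open>olds\<close>. A coded
  value is one of the fillings and so lies below their join; an uncoded value agrees because the
  instance is not bad.\<close>

lemma homomorphism_uncollapse:
  assumes h: "homomorphism \<sigma> h (collapse n H) A" and bad: "\<not> bad n H"
  shows "\<exists>h. homomorphism [K] h H (lift_struct A c)"
proof -
  define ix where "ix v = (SOME s. s < length (olds n H) \<and> olds n H ! s = v)" for v
  have ix: "ix v < length (olds n H) \<and> olds n H ! ix v = v" if "v < n" "\<not> is_new H v" for v
  proof -
    have "v \<in> set (olds n H)" using that by (simp add: olds_def)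
    then have "\<exists>s. s < length (olds n H) \<and> olds n H ! s = v" by (auto simp: in_set_conv_nth)
    then show ?thesis unfolding ix_def by (rule someI_ex)
  qed
  define g where "g v = (if is_new H v then c else h (ix v))" for v
  have hA: "h s \<in> universe A" if "s < length (olds n H)" for s
    using h that by (auto simp: homomorphism_def collapse_def)
  have g: "g v = c \<longleftrightarrow> is_new H v" "g v \<in> insert c (universe A)" if "v < n" for v
    using ix[OF that] hA[of "ix v"] c by (auto simp: g_def)
  have "homomorphism [K] g H (lift_struct A c)"
    unfolding homomorphism_single_iff
  proof (intro conjI ballI)
    show "g ` universe H \<subseteq> universe (lift_struct A c)"
      using g(2) by (auto simp: univ lift_struct_def)
    fix t assume "t \<in> tuples (universe H) K"
    then have t: "t \<in> tuples {..<n} K" by (simp add: univ)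
    have pat: "map (\<lambda>x. x = c) (map g t) = map (is_new H) t"
      using g(1) t by (auto simp: tuples_def)
    have "interp H 0 t \<le> lift_value (interp A) (\<lambda>x. x = c) (map g t)"
    proof (cases "is_code (map (is_new H) t)")
      case True
      then obtain i where i: "i < length \<sigma>" "map (is_new H) t = pattern i" by (auto simp: is_code_iff)
      let ?s = "take (\<sigma> ! i) (drop i t)"
      let ?y = "take i t @ drop (i + \<sigma> ! i) t"
      note args = pattern_args[OF i]
      have lt: "length t = K" "set t \<subseteq> {..<n}" using t by (auto simp: tuples_def)
      have li: "length (take i t) = i" using lt(1) fits(1)[OF i(1)] by simp
      have s: "set ?s \<subseteq> {..<n}"
        using lt(2) set_take_subset[of "\<sigma> ! i" "drop i t"] set_drop_subset[of i t] by blast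
      have "set ?y \<subseteq> {..<n}"
        using lt(2) set_take_subset[of i t] set_drop_subset[of "i + \<sigma> ! i" t] by auto
      moreover have "length ?y = K - \<sigma> ! i" using lt(1) fits(1)[OF i(1)] by simp
      moreover have "take i ?y @ ?s @ drop i ?y = t" using args(3) li by simp
      then have "interp H 0 t = interp H 0 (take i ?y @ ?s @ drop i ?y)" by (simp only:)
      ultimately have fill: "interp H 0 t \<in> fillings n H i ?s"
        unfolding fillings_def mem_Collect_eq using args(4) by blast
      have s': "map ((!) (olds n H)) (map ix ?s) = ?s"
        using ix s args(2) by (auto intro!: map_idI)
      have "interp H 0 t \<le> interp (collapse n H) i (map ix ?s)"
        unfolding collapse_def struct.simps s' using fill by (rule le_join)
      also have "map ix ?s \<in> tuples (universe (collapse n H)) (\<sigma> ! i)"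
        using ix s args(1,2) by (auto simp: tuples_def collapse_def)
      then have "interp (collapse n H) i (map ix ?s) \<le> interp A i (map h (map ix ?s))"
        using h i(1) unfolding homomorphism_def by blast
      also have "map h (map ix ?s) = map g ?s" using args(2) by (simp add: g_def)
      also have "interp A i (map g ?s) = lift_value (interp A) (\<lambda>x. x = c) (map g t)"
        using lift_value_code[OF i(1), of "\<lambda>x. x = c" "map g t" "interp A"] pat i(2)
        by (simp add: take_map drop_map)
      finally show ?thesis .
    next
      case False
      then have "interp H 0 t = (if list_all id (map (is_new H) t) then One else Zero)"
        using bad t unfolding bad_def by blast
      also have "\<dots> = lift_value (interp A) (\<lambda>x. x = c) (map g t)"
        using lift_value_not_code[of "\<lambda>x. x = c" "map g t" "interp A"] False unfolding pat by simp
      finally show ?thesis by simp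
    qed
    then show "interp H 0 t \<le> interp (lift_struct A c) 0 (map g t)" by simp
  qed
  then show ?thesis by blast
qed

end


section \<open>The reduction back to the signature as a first-order transduction\<close>

definition new_fm :: "nat \<Rightarrow> fm" where
  "new_fm v = Rel 0 (replicate K v) One"

lemma sat_new_fm [simp]: "sat n H xs (new_fm v) \<longleftrightarrow> is_new H (xs ! v)"
  by (simp add: new_fm_def is_new_def map_replicate)

lemma fm_ok_new_fm [simp]: "v < d \<Longrightarrow> fm_ok [K] d (new_fm v)"
  by (auto simp: new_fm_def)

primrec pattern_fm :: "bool list \<Rightarrow> nat \<Rightarrow> fm \<Rightarrow> fm" where
  "pattern_fm [] v \<psi> = \<psi>"
| "pattern_fm (b # bs) v \<psi> = Conj (if b then new_fm v else Neg (new_fm v)) (pattern_fm bs (Suc v) \<psi>)"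

lemma sat_pattern_fm:
  "v + length bs \<le> length xs \<Longrightarrow> sat n H xs (pattern_fm bs v \<psi>) \<longleftrightarrow>
    map (is_new H) (take (length bs) (drop v xs)) = bs \<and> sat n H xs \<psi>"
proof (induction bs arbitrary: v)
  case (Cons b bs)
  then have "drop v xs = xs ! v # drop (Suc v) xs" by (simp add: Cons_nth_drop_Suc)
  with Cons show ?case by auto
qed simp

lemma fm_ok_pattern_fm: "v + length bs \<le> d \<Longrightarrow> fm_ok [K] d \<psi> \<Longrightarrow> fm_ok [K] d (pattern_fm bs v \<psi>)"
  by (induction bs arbitrary: v) auto

lemma sat_exs:
  "sat n H xs ((Ex ^^ m) \<phi>) \<longleftrightarrow> (\<exists>t. length t = m \<and> set t \<subseteq> {..<n} \<and> sat n H (xs @ t) \<phi>)"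
proof (induction m arbitrary: xs)
  case (Suc m)
  have "sat n H xs ((Ex ^^ Suc m) \<phi>) \<longleftrightarrow>
      (\<exists>x<n. \<exists>t. length t = m \<and> set t \<subseteq> {..<n} \<and> sat n H (xs @ x # t) \<phi>)"
    by (simp add: Suc.IH)
  also have "\<dots> \<longleftrightarrow> (\<exists>t. length t = Suc m \<and> set t \<subseteq> {..<n} \<and> sat n H (xs @ t) \<phi>)"
    by (auto simp: length_Suc_conv) fastforce+
  finally show ?case .
qed simp

lemma fm_ok_exs: "fm_ok [K] (d + m) \<phi> \<Longrightarrow> fm_ok [K] d ((Ex ^^ m) \<phi>)"
  by (induction m arbitrary: d) auto

definition bad_fm :: "bool list \<Rightarrow> fm" where
  "bad_fm bs = (Ex ^^ K) (pattern_fm bs 0 (Neg (Rel 0 [0..<K] (if list_all id bs then One else Zero))))"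

lemma sat_bad_fm:
  assumes "length bs = K"
  shows "sat n H [] (bad_fm bs) \<longleftrightarrow> (\<exists>t \<in> tuples {..<n} K. map (is_new H) t = bs \<and>
    interp H 0 t \<noteq> (if list_all id bs then One else Zero))"
proof -
  have "sat n H t (pattern_fm bs 0 (Neg (Rel 0 [0..<K] a))) \<longleftrightarrow> map (is_new H) t = bs \<and> interp H 0 t \<noteq> a"
    if "length t = K" for t a
    using sat_pattern_fm[of 0 bs t n H] that assms by (auto simp: map_nth)
  then show ?thesis
    unfolding bad_fm_def sat_exs tuples_def by auto
qed

lemma fm_ok_bad_fm: "length bs = K \<Longrightarrow> fm_ok [K] 0 (bad_fm bs)"
  unfolding bad_fm_def by (rule fm_ok_exs, rule fm_ok_pattern_fm) auto

text \<open>\<open>K\<close> depends on the signature only, so the uncoded patterns can be listed in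
  the command itself, with one test for each.\<close>

definition non_codes :: "bool list list" where
  "non_codes = filter (\<lambda>bs. \<not> is_code bs) (product_lists (replicate K [False, True]))"

lemma set_non_codes: "set non_codes = {bs. length bs = K \<and> \<not> is_code bs}"
  by (auto simp: non_codes_def product_lists_set list_all2_conv_all_nth)

text \<open>The empty output encodes no instance and hence stands for the answer no.\<close>

definition guard_cmd :: "cmd \<Rightarrow> cmd" where
  "guard_cmd c = foldr (\<lambda>bs. Cond (bad_fm bs) Skip) non_codes c"

lemma emits_guard_cmd: "emits n H [] (guard_cmd c) = (if bad n H then [] else emits n H [] c)"
proof -
  have "emits n H [] (foldr (\<lambda>bs. Cond (bad_fm bs) Skip) bss c) =
      (if \<exists>bs \<in> set bss. sat n H [] (bad_fm bs) then [] else emits n H [] c)" for bss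
    by (induction bss) auto
  moreover have "(\<exists>bs \<in> set non_codes. sat n H [] (bad_fm bs)) \<longleftrightarrow> bad n H"
  proof -
    have len: "length (map (is_new H) t) = K" if "t \<in> tuples {..<n} K" for t
      using that by (simp add: tuples_def)
    have "(\<exists>bs \<in> set non_codes. sat n H [] (bad_fm bs)) \<longleftrightarrow>
        (\<exists>bs. length bs = K \<and> \<not> is_code bs \<and> (\<exists>t \<in> tuples {..<n} K. map (is_new H) t = bs \<and>
          interp H 0 t \<noteq> (if list_all id bs then One else Zero)))"
      unfolding set_non_codes using sat_bad_fm by blast
    also have "\<dots> \<longleftrightarrow> bad n H" (is "?l \<longleftrightarrow> _")
    proof
      assume ?l
      then obtain bs t where "\<not> is_code bs" "t \<in> tuples {..<n} K" "map (is_new H) t = bs"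
        "interp H 0 t \<noteq> (if list_all id bs then One else Zero)" by (elim exE conjE bexE) simp
      then show "bad n H" unfolding bad_def by (intro bexI[of _ t]) simp_all
    next
      assume "bad n H"
      then obtain t where t: "t \<in> tuples {..<n} K" "\<not> is_code (map (is_new H) t)"
        "interp H 0 t \<noteq> (if list_all id (map (is_new H) t) then One else Zero)"
        unfolding bad_def by blast
      then show ?l using len[OF t(1)] by (intro exI[of _ "map (is_new H) t"]) blast
    qed
    finally show ?thesis .
  qed
  ultimately show ?thesis unfolding guard_cmd_def by simp
qed

lemma cmd_ok_guard_cmd:
  assumes "cmd_ok [K] 0 c"
  shows "cmd_ok [K] 0 (guard_cmd c)"
proof -
  have "cmd_ok [K] 0 (foldr (\<lambda>bs. Cond (bad_fm bs) Skip) bss c)" if "\<forall>bs \<in> set bss. length bs = K" for bss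
    using that assms by (induction bss) (simp_all add: fm_ok_bad_fm)
  then show ?thesis unfolding guard_cmd_def using set_non_codes by simp
qed

lemma map_eq_replicate_True: "map P y = replicate (length y) True \<longleftrightarrow> (\<forall>x \<in> set y. P x)"
  by (induction y) auto

text \<open>The free variables 0, ..., k - 1 hold the given tuple and the quantified ones follow.
  The index list moves the first i quantified variables to the front, as in the coded tuple.\<close>

definition filling_fm :: "nat \<Rightarrow> pstar \<Rightarrow> fm" where
  "filling_fm i a = (let k = \<sigma> ! i in (Ex ^^ (K - k)) (pattern_fm (replicate (K - k) True) k
     (Rel 0 ([k..<k + i] @ [0..<k] @ [k + i..<K]) a)))"

lemma map_nth_rotated:
  assumes "length t = k" "length y = K - k" "i + k \<le> K"
  shows "map ((!) (t @ y)) ([k..<k + i] @ [0..<k] @ [k + i..<K]) = take i y @ t @ drop i y"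
proof -
  have "map ((!) (t @ y)) [k..<k + i] = take i y"
    by (rule nth_equalityI) (use assms in \<open>auto simp: nth_append\<close>)
  moreover have "map ((!) (t @ y)) [0..<k] = t"
    by (rule nth_equalityI) (use assms in \<open>auto simp: nth_append\<close>)
  moreover have "map ((!) (t @ y)) [k + i..<K] = drop i y"
    by (rule nth_equalityI) (use assms in \<open>auto simp: nth_append\<close>)
  ultimately show ?thesis by simp
qed

lemma sat_filling_fm:
  assumes i: "i < length \<sigma>" and t: "length t = \<sigma> ! i"
  shows "sat n H t (filling_fm i a) \<longleftrightarrow> a \<in> fillings n H i t"
proof -
  let ?k = "\<sigma> ! i"
  have "sat n H (t @ y) (pattern_fm (replicate (K - ?k) True) ?k (Rel 0 ([?k..<?k + i] @ [0..<?k] @ [?k + i..<K]) a))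
      \<longleftrightarrow> (\<forall>x \<in> set y. is_new H x) \<and> interp H 0 (take i y @ t @ drop i y) = a"
    if y: "length y = K - ?k" for y
  proof -
    have "map (is_new H) y = replicate (K - ?k) True \<longleftrightarrow> (\<forall>x \<in> set y. is_new H x)"
      using map_eq_replicate_True[of "is_new H" y] y by simp
    moreover have "?k + length (replicate (K - ?k) True) \<le> length (t @ y)" using t y by simp
    note sat_pattern_fm[OF this, of n H]
    ultimately show ?thesis
      using map_nth_rotated[OF t y fits(1)[OF i]] t y by (simp del: map_append)
  qed
  then show ?thesis
    unfolding filling_fm_def Let_def sat_exs fillings_def by auto
qed

lemma fm_ok_filling_fm:
  assumes i: "i < length \<sigma>"
  shows "fm_ok [K] (\<sigma> ! i) (filling_fm i a)"
  unfolding filling_fm_def Let_def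
  by (rule fm_ok_exs, rule fm_ok_pattern_fm) (use fits[OF i] in auto)

definition join_leaf :: "nat \<Rightarrow> cmd" where
  "join_leaf i = Cond (filling_fm i Star) (emit_value Star) (Cond (filling_fm i One)
     (Cond (filling_fm i Zero) (emit_value Star) (emit_value One)) (emit_value Zero))"

lemma emits_join_leaf:
  "i < length \<sigma> \<Longrightarrow> length t = \<sigma> ! i \<Longrightarrow>
    emits n H t (join_leaf i) = encode_value (join (fillings n H i t))"
  by (simp add: join_leaf_def sat_filling_fm join_def)

primrec old_loops :: "nat \<Rightarrow> nat \<Rightarrow> cmd \<Rightarrow> cmd" where
  "old_loops 0 d c = c"
| "old_loops (Suc r) d c = Loop (Cond (new_fm d) Skip (old_loops r (Suc d) c))"

lemma concat_map_if: "concat (map (\<lambda>x. if P x then [] else F x) xs) = concat (map F (filter (\<lambda>x. \<not> P x) xs))"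
  by (induction xs) auto

lemma emits_old_loops:
  "emits n H xs (old_loops r (length xs) c) =
    concat (map (\<lambda>t. emits n H (xs @ t) c) (product_lists (replicate r (olds n H))))"
proof (induction r arbitrary: xs)
  case (Suc r)
  have "emits n H xs (old_loops (Suc r) (length xs) c) =
      concat (map (\<lambda>x. if is_new H x then [] else
        emits n H (xs @ [x]) (old_loops r (length (xs @ [x])) c)) [0..<n])"
    by (simp add: nth_append cong: if_cong)
  also have "\<dots> = concat (map (\<lambda>x. emits n H (xs @ [x]) (old_loops r (length (xs @ [x])) c)) (olds n H))"
    unfolding olds_def by (rule concat_map_if)
  also have "\<dots> = concat (map (\<lambda>x. concat (map (\<lambda>t. emits n H (xs @ x # t) c)
      (product_lists (replicate r (olds n H))))) (olds n H))"
    unfolding Suc.IH by simp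
  finally show ?case unfolding concat_map_product_lists_Suc .
qed simp

lemma cmd_ok_old_loops: "cmd_ok [K] (d + r) c \<Longrightarrow> cmd_ok [K] d (old_loops r d c)"
  by (induction r arbitrary: d) auto

definition collapse_cmd :: cmd where
  "collapse_cmd = Sequ (Loop (Cond (new_fm 0) Skip (Emit True))) (Sequ (Emit False)
     (foldr (\<lambda>i. Sequ (old_loops (\<sigma> ! i) 0 (join_leaf i))) [0..<length \<sigma>] Skip))"

text \<open>Renumbering the old elements is increasing. Looping over the whole domain and skipping
  new elements therefore produces the lexicographic order of the renumbered tuples.\<close>

lemma emits_collapse_cmd:
  "emits n H [] collapse_cmd = encode \<sigma> (length (olds n H)) (collapse n H)"
proof -
  let ?m = "length (olds n H)"
  have "concat (map (\<lambda>x. if is_new H x then [] else [True]) [0..<n]) = replicate ?m True"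
    unfolding concat_map_if olds_def[symmetric] by (simp add: map_replicate_const)
  then have header: "emits n H [] (Loop (Cond (new_fm 0) Skip (Emit True))) = replicate ?m True"
    by (simp cong: if_cong)
  have fold: "emits n H [] (foldr (\<lambda>i. Sequ (p i)) is Skip) = concat (map (\<lambda>i. emits n H [] (p i)) is)" for p "is"
    by (induction "is") auto
  have "emits n H [] (old_loops (\<sigma> ! i) 0 (join_leaf i)) =
      concat (map (\<lambda>t. encode_value (interp (collapse n H) i t)) (product_lists (replicate (\<sigma> ! i) [0..<?m])))"
    if i: "i < length \<sigma>" for i
  proof -
    have "olds n H = map ((!) (olds n H)) [0..<?m]" by (simp add: map_nth)
    then have olds: "product_lists (replicate (\<sigma> ! i) (olds n H)) =
        map (map ((!) (olds n H))) (product_lists (replicate (\<sigma> ! i) [0..<?m]))"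
      using product_lists_map by metis
    have "emits n H [] (old_loops (\<sigma> ! i) 0 (join_leaf i)) =
        concat (map (\<lambda>t. emits n H t (join_leaf i)) (product_lists (replicate (\<sigma> ! i) (olds n H))))"
      using emits_old_loops[of n H "[]" "\<sigma> ! i" "join_leaf i"] by simp
    also have "\<dots> = concat (map (\<lambda>t. encode_value (join (fillings n H i t))) (product_lists (replicate (\<sigma> ! i) (olds n H))))"
      using in_set_product_lists_length[of _ "replicate (\<sigma> ! i) (olds n H)"]
      by (auto intro!: arg_cong[of _ _ concat] map_cong emits_join_leaf[OF i])
    finally show ?thesis unfolding olds by (simp add: collapse_def comp_def)
  qed
  then show ?thesis
    unfolding collapse_cmd_def emits.simps(2,3) header fold encode_def
    by (auto intro!: arg_cong[of _ _ concat] map_cong)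
qed

lemma cmd_ok_collapse_cmd: "cmd_ok [K] 0 collapse_cmd"
proof -
  have "cmd_ok [K] 0 (old_loops (\<sigma> ! i) 0 (join_leaf i))" if "i < length \<sigma>" for i
    using that by (intro cmd_ok_old_loops) (simp add: join_leaf_def fm_ok_filling_fm)
  then have "cmd_ok [K] 0 (foldr (\<lambda>i. Sequ (old_loops (\<sigma> ! i) 0 (join_leaf i))) is Skip)"
    if "set is \<subseteq> {..<length \<sigma>}" for "is"
    using that by (induction "is") auto
  then have "cmd_ok [K] 0 (foldr (\<lambda>i. Sequ (old_loops (\<sigma> ! i) 0 (join_leaf i))) [0..<length \<sigma>] Skip)"
    by (simp add: atLeast0LessThan)
  then show ?thesis by (simp add: collapse_cmd_def)
qed

lemma lift_reducible_to_MP: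
  assumes c: "c \<notin> universe A" and a: "a \<in> universe A"
  shows "poly_reducible (MP [K] (lift_struct A c)) (MP \<sigma> A)"
proof -
  \<comment> \<open>Three outcomes: a bad instance yields the empty word, an instance without new
    elements yields \<open>[False]\<close>, the encoding of the empty structure and so a
    yes-instance, and all others are collapsed.\<close>
  define p where "p = guard_cmd (Cond (Ex (new_fm 0)) collapse_cmd (Emit False))"
  have "cmd_ok [K] 0 p"
    unfolding p_def by (rule cmd_ok_guard_cmd) (simp add: cmd_ok_collapse_cmd)
  then obtain f where f: "poly_time_computable f"
    "\<And>w. (\<exists>n H. w = encode [K] n H \<and> f w = emits n H [] p) \<or> (\<nexists>n H. w = encode [K] n H) \<and> f w = []"
    by (rule transduction_poly_time) blast
  have pos': "\<forall>k \<in> set \<sigma>. k \<ge> 1" using pos by blast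
  have "w \<in> MP [K] (lift_struct A c) \<longleftrightarrow> f w \<in> MP \<sigma> A" for w
    using f(2)[of w]
  proof
    assume "\<exists>n H. w = encode [K] n H \<and> f w = emits n H [] p"
    then obtain n H where w: "w = encode [K] n H" "f w = emits n H [] p" by blast
    let ?H = "H\<lparr>universe := {..<n}\<rparr>"
    have H: "universe ?H = {..<n}" by simp
    have new: "is_new ?H = is_new H" by (simp add: is_new_def fun_eq_iff)
    have badH: "bad n ?H \<longleftrightarrow> bad n H" by (simp add: bad_def new)
    have L: "w \<in> MP [K] (lift_struct A c) \<longleftrightarrow> (\<exists>h. homomorphism [K] h ?H (lift_struct A c))"
      unfolding w(1) by (rule encode_in_MP_iff)
    consider "bad n H" | "\<not> bad n H" "\<forall>v<n. \<not> is_new H v" | v where "\<not> bad n H" "v < n" "is_new H v"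
      by blast
    then show ?thesis
    proof cases
      case 1
      then have "f w = []" by (simp add: w(2) p_def emits_guard_cmd)
      then show ?thesis
        using L Nil_notin_MP homomorphism_not_bad[OF H c] 1 badH by metis
    next
      case 2
      then have "f w = [False]" by (auto simp: w(2) p_def emits_guard_cmd)
      also have "\<dots> = encode \<sigma> 0 H" by (simp add: encode_0[OF pos'])
      finally have "f w \<in> MP \<sigma> A"
        using encode_in_MP_iff[of \<sigma> 0 H A] homomorphism_empty[OF pos', of "H\<lparr>universe := {..<0}\<rparr>" id A]
        by auto
      then show ?thesis
        using L homomorphism_no_new[OF H c _ _ a] 2 badH new by metis
    next
      case 3
      have "f w = emits n H [] collapse_cmd"
        using 3 by (auto simp: w(2) p_def emits_guard_cmd)
      then have fw: "f w = encode \<sigma> (length (olds n H)) (collapse n H)"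
        by (simp only: emits_collapse_cmd)
      have "(collapse n H)\<lparr>universe := {..<length (olds n H)}\<rparr> = collapse n ?H"
        by (simp add: collapse_def olds_def new fillings_def[abs_def])
      then have "f w \<in> MP \<sigma> A \<longleftrightarrow> (\<exists>h. homomorphism \<sigma> h (collapse n ?H) A)"
        unfolding fw encode_in_MP_iff by (simp only:)
      moreover have "\<exists>h. homomorphism \<sigma> h (collapse n ?H) A" if "homomorphism [K] h ?H (lift_struct A c)" for h
        using homomorphism_collapse[OF H c that, of v] 3 new by auto
      moreover have "\<exists>h. homomorphism [K] h ?H (lift_struct A c)" if "homomorphism \<sigma> h (collapse n ?H) A" for h
        using homomorphism_uncollapse[OF H c that] 3 badH by blast
      ultimately show ?thesis using L by blast
    qed
  next
    assume "(\<nexists>n H. w = encode [K] n H) \<and> f w = []"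
    then show ?thesis using MP_encoding Nil_notin_MP by metis
  qed
  with f(1) show ?thesis unfolding poly_reducible_def by blast
qed

end

section \<open>Transfer of the dichotomy\<close>

theorem mainTheorem7:
  fixes \<sigma> :: signature
  assumes "\<sigma> \<noteq> []"
    and "\<forall>k \<in> set \<sigma>. k \<ge> 1"
    and "has_dichotomy (MP_class [Max (set \<sigma>) + length \<sigma> - 1])"
  shows "has_dichotomy (MP_class \<sigma>)"
proof (cases "length \<sigma> = 1")
  case True
  then obtain k where "\<sigma> = [k]" by (auto simp: length_Suc_conv)
  then show ?thesis using assms(3) by simp
next
  case False
  define K where "K = Max (set \<sigma>) + length \<sigma> - 1"
  have len: "length \<sigma> \<ge> 2" using False assms(1) by (cases \<sigma>; cases "tl \<sigma>") auto
  have max: "\<sigma> ! i \<le> Max (set \<sigma>)" if "i < length \<sigma>" for i using that by simp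
  interpret lifting \<sigma> K
  proof
    fix i assume i: "i < length \<sigma>"
    \<comment> \<open>The first bound uses i <= p - 1; the strict one uses p >= 2, which makes
      \<open>K\<close> exceed the maximal arity.\<close>
    show "i + \<sigma> ! i \<le> K" "\<sigma> ! i < K" using max[OF i] i len unfolding K_def by linarith+
  qed (use assms(2) len in \<open>auto simp: K_def\<close>)
  have dich: "L \<in> class_P \<or> NP_complete L" if "L \<in> MP_class [K]" for L
    using assms(3) that unfolding K_def has_dichotomy_def by blast
  show ?thesis
    unfolding has_dichotomy_def
  proof
    fix L assume "L \<in> MP_class \<sigma>"
    then obtain A where A: "L = MP \<sigma> A" "finite (universe A)" by (auto simp: MP_class_def)
    show "L \<in> class_P \<or> NP_complete L"
    \<comment> \<open>The reduction back needs an element of the template. The empty template itself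
      serves over the single symbol, since both languages are \<open>{[False]}\<close>.\<close>
    proof (cases "universe A = {}")
      case True
      then have "L = MP [K] A"
        using MP_empty_template[OF assms(2)] MP_empty_template[of "[K]" A] K_pos A(1) by simp
      then show ?thesis using dich A(2) unfolding MP_class_def by blast
    next
      case False
      then obtain a where a: "a \<in> universe A" by blast
      obtain c where c: "c \<notin> universe A" using ex_new_if_finite[OF infinite_UNIV_nat A(2)] by blast
      have "finite (universe (lift_struct A c))" using A(2) by (simp add: lift_struct_def)
      then have "MP [K] (lift_struct A c) \<in> MP_class [K]" unfolding MP_class_def by blast
      from dich[OF this] show ?thesis
        using poly_reducible_P[OF MP_reducible_to_lift[OF c]]
          NP_complete_equivalent[OF _ MP_reducible_to_lift[OF c] lift_reducible_to_MP[OF c a]]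
        unfolding A(1) by blast
    qed
  qed
qed

end
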